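(* Every correct triangle tiling $T$ of the plane is composable, i.e. there is a (necessarily unique) tiling $T_0$ of the plane by triangle tiles whose decomposition is $T$; moreover this composition $T_0$ is again a correct triangle tiling of the plane.
   Context: Colors are red and green. An arrow is a segment with an orientation and a color. Triangle tiles: congruent isosceles right triangles, each colored red or green, each of whose three sides is an arrow (arbitrary orientation and color). Crossings: the crossing at a vertex $v$ is the set of arrows (tile sides) having $v$ as an endpoint. Type $C_4$: four arrows at right angles: two collinear arrows of the same color passing through $v$ in the same direction (one entering, one leaving; the axis), and two arrows perpendicular to the axis, both entering $v$, of different colors. Type $C_8$: eight arrows at consecutive angles $45^\circ$: an axis as before, two arrows perpendicular to it both entering $v$ and of different colors, and four arrows at $45^\circ$ to the axis leaving $v$, such that for each perpendicular entering arrow, of the two leaving arrows at $45^\circ$ to it, the one on its left (as seen moving along it towards $v$) is red and the one on its right is green. A correct triangle tiling of the plane is a tiling of the plane by triangle tiles (pairwise disjoint interiors) such that: (1) tiles meet side to side and shared sides have the same color and orientation; (2) two triangles with a common side have different colors; (3) the crossing at every vertex is of type $C_4$ or $C_8$; (4) at every crossing of type $C_4$, for each of its two perpendicular entering arrows, the triangle immediately to its left (seen moving towards $v$) is red and the one to its right is green. Substitution: a triangle tile is cut by its height (from the right-angle vertex to the midpoint of the hypotenuse) into two triangles similar to it with ratio $\sqrt2$; the height is an arrow oriented from the right-angle vertex to the hypotenuse, colored with the color of the original tile; the new triangle on the left of the height (viewed in the direction of the arrow) is red and the one on the right green; all other sides (including the two halves of the hypotenuse) keep the color and orientation of the corresponding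 side of the original. The decomposition of a tiling is obtained by applying the substitution to all its tiles and then scaling by the factor $\sqrt2$ (about the origin). The decomposition map is injective; the tiling (if any) whose decomposition is $T$ is called the composition of $T$, and $T$ is then called composable. *)

theory Defs
  imports "HOL-Analysis.Analysis"
begin

text \<open>The plane is the type of complex numbers, so that multiplication by \<open>\<i>\<close> is the
  counterclockwise rotation by a right angle.\<close>

datatype color = Red | Green

record arrow =
  src :: complex
  tgt :: complex
  acol :: color

text \<open>An isosceles right triangle is given by its right-angle vertex and by the end points of
  its hypotenuse, named as seen from the right-angle vertex. In this way every tile has exactly one
  representation.\<close>

record tile =
  apex :: complex
  rv :: complex
  lv :: complex
  tcol :: color
  rleg :: arrow
  lleg :: arrow
  hyp :: arrow

definition joins :: "arrow \<Rightarrow> complex \<Rightarrow> complex \<Rightarrow> bool" where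
  "joins a x y \<longleftrightarrow> {src a, tgt a} = {x, y}"

definition triangle_tile :: "real \<Rightarrow> tile \<Rightarrow> bool" where
  "triangle_tile s t \<longleftrightarrow>
     dist (apex t) (rv t) = s \<and> lv t - apex t = \<i> * (rv t - apex t) \<and>
     joins (rleg t) (apex t) (rv t) \<and> joins (lleg t) (apex t) (lv t) \<and> joins (hyp t) (rv t) (lv t)"

definition vertices :: "tile \<Rightarrow> complex set" where
  "vertices t = {apex t, rv t, lv t}"

definition sides :: "tile \<Rightarrow> arrow set" where
  "sides t = {rleg t, lleg t, hyp t}"

definition region :: "tile \<Rightarrow> complex set" where
  "region t = convex hull (vertices t)"

definition seg :: "arrow \<Rightarrow> complex set" where
  "seg a = closed_segment (src a) (tgt a)"

definition tiling :: "tile set \<Rightarrow> bool" where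
  "tiling T \<longleftrightarrow>
     (\<exists>s>0. \<forall>t\<in>T. triangle_tile s t) \<and>
     (\<Union>t\<in>T. region t) = UNIV \<and>
     (\<forall>t\<in>T. \<forall>t'\<in>T. t \<noteq> t' \<longrightarrow> interior (region t) \<inter> interior (region t') = {})"

definition side_to_side :: "tile set \<Rightarrow> bool" where
  "side_to_side T \<longleftrightarrow> (\<forall>t\<in>T. \<forall>t'\<in>T. t \<noteq> t' \<longrightarrow>
     region t \<inter> region t' = {} \<or>
     (\<exists>v\<in>vertices t \<inter> vertices t'. region t \<inter> region t' = {v}) \<or>
     (\<exists>a\<in>sides t. \<exists>b\<in>sides t'. seg a = seg b \<and> region t \<inter> region t' = seg a))"

definition crossing :: "tile set \<Rightarrow> complex \<Rightarrow> arrow set" where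
  "crossing T v = {a \<in> (\<Union>t\<in>T. sides t). src a = v \<or> tgt a = v}"

text \<open>In the next two definitions \<open>d\<close> is the direction from \<open>v\<close> to the other end of the arrow, also
  for arrows that enter \<open>v\<close>.\<close>

definition enters :: "complex \<Rightarrow> complex \<Rightarrow> color \<Rightarrow> arrow \<Rightarrow> bool" where
  "enters v d c a \<longleftrightarrow> tgt a = v \<and> (\<exists>r>0. src a = v + of_real r * d) \<and> acol a = c"

definition leaves :: "complex \<Rightarrow> complex \<Rightarrow> color \<Rightarrow> arrow \<Rightarrow> bool" where
  "leaves v d c a \<longleftrightarrow> src a = v \<and> (\<exists>r>0. tgt a = v + of_real r * d) \<and> acol a = c"

text \<open>The parameter \<open>u\<close> is the direction of the axis. The perpendicular arrow that lies in direction
  \<open>\<i> * u\<close> from \<open>v\<close> runs in direction \<open>- \<i> * u\<close>, so \<open>u\<close> is on its left; the perpendicular arrow on the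
  other side has \<open>- u\<close> on its left.\<close>

definition C4 :: "complex \<Rightarrow> complex \<Rightarrow> arrow set \<Rightarrow> bool" where
  "C4 v u X \<longleftrightarrow> u \<noteq> 0 \<and>
     (\<exists>a1 a2 b1 b2 k c1 c2. X = {a1, a2, b1, b2} \<and>
        enters v (- u) k a1 \<and> leaves v u k a2 \<and>
        enters v (\<i> * u) c1 b1 \<and> enters v (- \<i> * u) c2 b2 \<and> c1 \<noteq> c2)"

definition C8 :: "complex \<Rightarrow> complex \<Rightarrow> arrow set \<Rightarrow> bool" where
  "C8 v u X \<longleftrightarrow> u \<noteq> 0 \<and>
     (\<exists>a1 a2 b1 b2 d1 d2 d3 d4 k c1 c2. X = {a1, a2, b1, b2, d1, d2, d3, d4} \<and>
        enters v (- u) k a1 \<and> leaves v u k a2 \<and>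
        enters v (\<i> * u) c1 b1 \<and> enters v (- \<i> * u) c2 b2 \<and> c1 \<noteq> c2 \<and>
        leaves v ((1 + \<i>) * u) Red d1 \<and> leaves v ((- 1 + \<i>) * u) Green d2 \<and>
        leaves v ((- 1 - \<i>) * u) Red d3 \<and> leaves v ((1 - \<i>) * u) Green d4)"

definition on_left :: "arrow \<Rightarrow> tile \<Rightarrow> bool" where
  "on_left a t \<longleftrightarrow> a \<in> sides t \<and>
     (\<forall>x\<in>vertices t. Im (cnj (tgt a - src a) * (x - src a)) \<ge> 0)"

definition on_right :: "arrow \<Rightarrow> tile \<Rightarrow> bool" where
  "on_right a t \<longleftrightarrow> a \<in> sides t \<and>
     (\<forall>x\<in>vertices t. Im (cnj (tgt a - src a) * (x - src a)) \<le> 0)"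

definition correct_tiling :: "tile set \<Rightarrow> bool" where
  "correct_tiling T \<longleftrightarrow>
     tiling T \<and> side_to_side T \<and>
     (\<forall>t\<in>T. \<forall>t'\<in>T. \<forall>a\<in>sides t. \<forall>b\<in>sides t'. seg a = seg b \<longrightarrow> a = b) \<and>
     (\<forall>t\<in>T. \<forall>t'\<in>T. t \<noteq> t' \<and> sides t \<inter> sides t' \<noteq> {} \<longrightarrow> tcol t \<noteq> tcol t') \<and>
     (\<forall>v\<in>(\<Union>t\<in>T. vertices t). \<exists>u. C4 v u (crossing T v) \<or> C8 v u (crossing T v)) \<and>
     (\<forall>v u b. C4 v u (crossing T v) \<and> b \<in> crossing T v \<and> tgt b = v \<and> (src b - v) \<bullet> u = 0 \<longrightarrow>
        (\<forall>t\<in>T. (on_left b t \<longrightarrow> tcol t = Red) \<and> (on_right b t \<longrightarrow> tcol t = Green)))"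

definition height :: "tile \<Rightarrow> arrow" where
  "height t = \<lparr>src = apex t, tgt = midpoint (rv t) (lv t), acol = tcol t\<rparr>"

definition half_at :: "complex \<Rightarrow> arrow \<Rightarrow> arrow" where
  "half_at x a =
     (if src a = x then a\<lparr>tgt := midpoint (src a) (tgt a)\<rparr>
      else a\<lparr>src := midpoint (src a) (tgt a)\<rparr>)"

definition left_part :: "tile \<Rightarrow> tile" where
  "left_part t = \<lparr>apex = midpoint (rv t) (lv t), rv = lv t, lv = apex t, tcol = Red,
     rleg = half_at (lv t) (hyp t), lleg = height t, hyp = lleg t\<rparr>"

definition right_part :: "tile \<Rightarrow> tile" where
  "right_part t = \<lparr>apex = midpoint (rv t) (lv t), rv = apex t, lv = rv t, tcol = Green,
     rleg = height t, lleg = half_at (rv t) (hyp t), hyp = rleg t\<rparr>"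

definition scale_arrow :: "real \<Rightarrow> arrow \<Rightarrow> arrow" where
  "scale_arrow k a = \<lparr>src = k *\<^sub>R src a, tgt = k *\<^sub>R tgt a, acol = acol a\<rparr>"

definition scale_tile :: "real \<Rightarrow> tile \<Rightarrow> tile" where
  "scale_tile k t = \<lparr>apex = k *\<^sub>R apex t, rv = k *\<^sub>R rv t, lv = k *\<^sub>R lv t, tcol = tcol t,
     rleg = scale_arrow k (rleg t), lleg = scale_arrow k (lleg t), hyp = scale_arrow k (hyp t)\<rparr>"

definition decomposition :: "tile set \<Rightarrow> tile set" where
  "decomposition T = scale_tile (sqrt 2) ` (\<Union>t\<in>T. {left_part t, right_part t})"

end

theory Submission
  imports Defs
begin

text \<open>
  A right-angled corner does not fit into a crossing of type \<open>C8\<close>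
    and an acute corner does not fit into
  one of type \<open>C4\<close>. So the apex \<open>m\<close> of every tile is a crossing of type \<open>C4\<close>, around which the four
  tiles with apex \<open>m\<close> are arranged,
    and the colouring rule at \<open>m\<close> says that they are the halves of two
  larger triangles whose common hypotenuse is the axis of the crossing and whose heights are the two
  perpendicular arrows.

  Every vertex \<open>v\<close> of the composed tiling is an acute corner, hence of type \<open>C8\<close> in \<open>T\<close>. Neighbouring
  tiles around \<open>v\<close> have different colours, so either all legs at \<open>v\<close> are halves of long hypotenuses,
  and the crossing keeps its eight arrows (four of them lengthened), or all legs at \<open>v\<close> are heights.
  In the latter case they all leave \<open>v\<close>, so they are the four diagonal arrows; erasing them leaves a
  crossing of type \<open>C4\<close>,
    and the alternating colours of the diagonals become the colours of the four
  composed triangles with apex \<open>v\<close>.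
\<close>

section \<open>Triangles in coordinates\<close>

text \<open>A tiling is given only as a covering by closed triangles with disjoint interiors, so
  that a tile lies beyond each side is itself a claim; it rests on local finiteness and supplies
  every later neighbour. Crossings list arrows rather than tiles, hence their information is read
  through directions: within one crossing two sides pointing the same way are the same arrow, and as
  legs have length \<open>s\<close> and hypotenuses length \<open>sqrt 2 * s\<close>, a leg and a
  hypotenuse never do. The colour of a composed tile is invisible in the colours of its halves,
  which are always red on the left and green on the right; it survives as the colour of the height.
  Thus the different colours of the perpendicular arrows at a midpoint become different colours of
  the tiles on both sides of a long hypotenuse, and the colours of the diagonals of a
  \<open>C8\<close> crossing govern the tiles around a composed apex. The factor
  \<open>sqrt 2\<close> is kept out of all this: halving commutes with scaling, so the work is done
  with tiles of two sizes in one plane.\<close>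

lemma joins_iff: "joins a x y \<longleftrightarrow> src a = x \<and> tgt a = y \<or> src a = y \<and> tgt a = x"
  by (auto simp: joins_def doubleton_eq_iff)

lemma joins_commute: "joins a x y \<longleftrightarrow> joins a y x"
  by (auto simp: joins_iff)

lemma seg_joins: "joins a x y \<Longrightarrow> seg a = closed_segment x y"
  by (auto simp: joins_iff seg_def closed_segment_commute)

lemma triangle_tile_rv_lv:
  assumes "triangle_tile s t"
  shows "rv t = apex t + (rv t - apex t)" "lv t = apex t + \<i> * (rv t - apex t)"
  using assms by (auto simp: triangle_tile_def algebra_simps)

lemma triangle_tile_dir_nonzero: "triangle_tile s t \<Longrightarrow> s > 0 \<Longrightarrow> rv t - apex t \<noteq> 0"
  by (auto simp: triangle_tile_def)

lemma norm_dir: "triangle_tile s t \<Longrightarrow> norm (rv t - apex t) = s"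
  by (auto simp: triangle_tile_def dist_norm norm_minus_commute)

text \<open>Dividing by the leg vector \<open>rv t - apex t\<close> carries every tile to the
  standard triangle with vertices 0, 1 and \<open>\<i>\<close>. Questions about points of tiles
  become linear inequalities in the real and imaginary part of the coordinate
  \<open>c\<close>.\<close>

lemma tile_point_in_region:
  assumes "triangle_tile s t" "s > 0"
  shows "apex t + c * (rv t - apex t) \<in> region t \<longleftrightarrow> 0 \<le> Re c \<and> 0 \<le> Im c \<and> Re c + Im c \<le> 1"
proof -
  define d where "d = rv t - apex t"
  have d: "d \<noteq> 0" using triangle_tile_dir_nonzero assms d_def by auto
  have "lv t - apex t = \<i> * d" using assms by (auto simp: triangle_tile_def d_def)
  then have "region t = {apex t + u *\<^sub>R d + v *\<^sub>R (\<i> * d) | u v. 0 \<le> u \<and> 0 \<le> v \<and> u + v \<le> 1}"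
    by (simp add: region_def vertices_def convex_hull_3_alt d_def)
  also have "\<dots> = {apex t + (complex_of_real u + \<i> * complex_of_real v) * d | u v. 0 \<le> u \<and> 0 \<le> v \<and> u + v \<le> 1}"
    by (simp add: scaleR_conv_of_real algebra_simps)
  finally have R: "region t = \<dots>" .
  have *: "apex t + c * d = apex t + c' * d \<longleftrightarrow> c = c'" for c c' using d by auto
  show ?thesis unfolding d_def[symmetric] R mem_Collect_eq *
    by (auto simp: complex_eq_iff)
qed

lemma tile_point_in_interior:
  assumes "triangle_tile s t" "s > 0" "0 < Re c" "0 < Im c" "Re c + Im c < 1"
  shows "apex t + c * (rv t - apex t) \<in> interior (region t)"
proof -
  define d where "d = rv t - apex t"
  have d: "d \<noteq> 0" using triangle_tile_dir_nonzero assms d_def by auto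
  define f where "f z = (z - apex t) / d" for z
  let ?U = "{z. 0 < Re (f z)} \<inter> {z. 0 < Im (f z)} \<inter> {z. Re (f z) + Im (f z) < 1}"
  have "open ?U" unfolding f_def using d
    by (intro open_Int open_Collect_less continuous_intros) auto
  moreover have "?U \<subseteq> region t"
  proof
    fix z assume z: "z \<in> ?U"
    have "z = apex t + f z * d" using d by (simp add: f_def)
    then show "z \<in> region t" using z tile_point_in_region[OF assms(1,2), of "f z"]
      by (simp add: d_def)
  qed
  moreover have "apex t + c * d \<in> ?U" using assms d by (simp add: f_def)
  ultimately show ?thesis unfolding d_def using interior_maximal by blast
qed

lemma closed_region: "closed (region t)"
  by (simp add: region_def vertices_def compact_convex_hull compact_imp_closed finite_imp_compact)

lemma interior_region_nonempty:
  assumes "triangle_tile s t" "s > 0"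
  shows "interior (region t) \<noteq> {}"
  using tile_point_in_interior[OF assms, of "Complex (1/4) (1/4)"] by auto

lemma closure_interior_region:
  assumes "triangle_tile s t" "s > 0"
  shows "closure (interior (region t)) = region t"
  using convex_closure_interior[of "region t"] interior_region_nonempty[OF assms] closed_region
  by (auto simp: region_def)

text \<open>A tile is the closure of its interior, so an open set that merely touches it already
  meets its interior. This turns contact at a point into an overlap.\<close>

lemma open_meets_interior_region:
  assumes "triangle_tile s t" "s > 0" "open U" "z \<in> U" "z \<in> region t"
  shows "U \<inter> interior (region t) \<noteq> {}"
  using assms closure_interior_region[OF assms(1,2)] open_Int_closure_eq_empty by fastforce

lemma rleg_point:
  assumes "triangle_tile s t" "s > 0"
  shows "apex t + c * (rv t - apex t) \<in> seg (rleg t) \<longleftrightarrow> Im c = 0 \<and> 0 \<le> Re c \<and> Re c \<le> 1"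
proof -
  define d where "d = rv t - apex t"
  have d: "d \<noteq> 0" using triangle_tile_dir_nonzero assms d_def by auto
  have "seg (rleg t) = closed_segment (apex t) (apex t + d)"
    using assms by (auto simp: triangle_tile_def d_def intro!: seg_joins)
  moreover have "apex t + c * d = (1 - u) *\<^sub>R apex t + u *\<^sub>R (apex t + d) \<longleftrightarrow> c = of_real u" for u
  proof -
    have "(1 - u) *\<^sub>R apex t + u *\<^sub>R (apex t + d) = apex t + of_real u * d"
      by (simp add: scaleR_conv_of_real algebra_simps)
    then show ?thesis using d by simp
  qed
  ultimately show ?thesis unfolding d_def[symmetric] by (auto simp: in_segment complex_eq_iff)
qed

lemma lleg_point:
  assumes "triangle_tile s t" "s > 0"
  shows "apex t + c * (rv t - apex t) \<in> seg (lleg t) \<longleftrightarrow> Re c = 0 \<and> 0 \<le> Im c \<and> Im c \<le> 1"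
proof -
  define d where "d = rv t - apex t"
  have d: "d \<noteq> 0" using triangle_tile_dir_nonzero assms d_def by auto
  have "seg (lleg t) = closed_segment (apex t) (apex t + \<i> * d)"
    using assms triangle_tile_rv_lv(2)[OF assms(1)]
    by (auto simp: triangle_tile_def d_def intro!: seg_joins)
  moreover have "apex t + c * d = (1 - u) *\<^sub>R apex t + u *\<^sub>R (apex t + \<i> * d) \<longleftrightarrow> c = of_real u * \<i>" for u
  proof -
    have "(1 - u) *\<^sub>R apex t + u *\<^sub>R (apex t + \<i> * d) = apex t + (of_real u * \<i>) * d"
      by (simp add: scaleR_conv_of_real algebra_simps)
    then show ?thesis by (simp only: add_left_cancel mult_right_cancel[OF d])
  qed
  ultimately show ?thesis unfolding d_def[symmetric] by (auto simp: in_segment complex_eq_iff)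
qed

lemma hyp_point:
  assumes "triangle_tile s t" "s > 0"
  shows "apex t + c * (rv t - apex t) \<in> seg (hyp t) \<longleftrightarrow> 0 \<le> Re c \<and> 0 \<le> Im c \<and> Re c + Im c = 1"
proof -
  define d where "d = rv t - apex t"
  have d: "d \<noteq> 0" using triangle_tile_dir_nonzero assms d_def by auto
  have "seg (hyp t) = closed_segment (apex t + d) (apex t + \<i> * d)"
    using assms triangle_tile_rv_lv(2)[OF assms(1)]
    by (auto simp: triangle_tile_def d_def intro!: seg_joins)
  moreover have "apex t + c * d = (1 - u) *\<^sub>R (apex t + d) + u *\<^sub>R (apex t + \<i> * d) \<longleftrightarrow> c = of_real (1 - u) + of_real u * \<i>" for u
  proof -
    have "(1 - u) *\<^sub>R (apex t + d) + u *\<^sub>R (apex t + \<i> * d) = apex t + (of_real (1 - u) + of_real u * \<i>) * d"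
      by (simp add: scaleR_conv_of_real algebra_simps)
    then show ?thesis by (simp only: add_left_cancel mult_right_cancel[OF d])
  qed
  ultimately show ?thesis unfolding d_def[symmetric] by (auto simp: in_segment complex_eq_iff)
qed

lemma tile_coordinate:
  assumes "triangle_tile s t" "s > 0"
  obtains c where "z = apex t + c * (rv t - apex t)"
proof
  show "z = apex t + (z - apex t) / (rv t - apex t) * (rv t - apex t)"
    using triangle_tile_dir_nonzero[OF assms] by simp
qed

lemma dist_rleg: "triangle_tile s t \<Longrightarrow> dist (src (rleg t)) (tgt (rleg t)) = s"
  by (auto simp: triangle_tile_def joins_iff dist_commute)

lemma dist_lleg: "triangle_tile s t \<Longrightarrow> dist (src (lleg t)) (tgt (lleg t)) = s"
proof -
  assume t: "triangle_tile s t"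
  have "dist (apex t) (lv t) = s"
    using norm_dir[OF t] triangle_tile_rv_lv(2)[OF t] by (simp add: dist_norm norm_mult)
  then show ?thesis using t by (auto simp: triangle_tile_def joins_iff dist_commute)
qed

lemma dist_hyp: "triangle_tile s t \<Longrightarrow> dist (src (hyp t)) (tgt (hyp t)) = sqrt 2 * s"
proof -
  assume t: "triangle_tile s t"
  have "lv t - rv t = (\<i> - 1) * (rv t - apex t)"
    using triangle_tile_rv_lv(2)[OF t] by (simp add: algebra_simps)
  moreover have "norm (\<i> - 1) = sqrt 2" by (simp add: cmod_def)
  ultimately have "dist (rv t) (lv t) = sqrt 2 * s"
    using norm_dir[OF t] by (simp add: dist_norm norm_mult norm_minus_commute)
  then show ?thesis using t by (auto simp: triangle_tile_def joins_iff dist_commute)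
qed

lemma sqrt2_mult_neq: "s > 0 \<Longrightarrow> sqrt 2 * s \<noteq> (s::real)"
  by auto

text \<open>The apex and one acute vertex fix the region, and different tiles cannot have the same
  nonempty interior. Hence position determines colour and arrows, and tiles are later identified by
  comparing two vertices only.\<close>

lemma tile_eqI_position:
  assumes "tiling T" "t \<in> T" "t' \<in> T" "apex t = apex t'" "rv t = rv t'"
  shows "t = t'"
proof -
  obtain s where s: "s > 0" "\<forall>t\<in>T. triangle_tile s t" using assms(1)
    by (auto simp: tiling_def)
  have "lv t = lv t'" using s assms triangle_tile_rv_lv(2) by metis
  then have "region t = region t'" using assms by (simp add: region_def vertices_def)
  moreover have "interior (region t) \<noteq> {}" using interior_region_nonempty s assms by blast
  ultimately show ?thesis using assms unfolding tiling_def by fastforce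
qed

section \<open>Crossings and local finiteness\<close>

definition far :: "complex \<Rightarrow> arrow \<Rightarrow> complex" where
  "far v a = (if src a = v then tgt a else src a)"

text \<open>The eight directions at multiples of 45 degrees from \<open>u\<close> are told apart
  by the signs of the
  real and imaginary part of the direction divided by \<open>u\<close>.\<close>

definition sgn_pair :: "complex \<Rightarrow> real \<times> real" where
  "sgn_pair z = (sgn (Re z), sgn (Im z))"

text \<open>Length and orientation of the arrow do not enter, so a side of a tile can be located in
  a crossing before its orientation is known.\<close>

definition dirsgn :: "complex \<Rightarrow> complex \<Rightarrow> arrow \<Rightarrow> real \<times> real" where
  "dirsgn v u a = sgn_pair ((far v a - v) / u)"

lemma dirsgn_joins: "joins a v (v + z) \<Longrightarrow> dirsgn v u a = sgn_pair (z / u)"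
  by (auto simp: joins_iff dirsgn_def far_def)

lemma sgn_pair_scale: "r > 0 \<Longrightarrow> sgn_pair (of_real r * z) = sgn_pair z"
  by (auto simp: sgn_pair_def sgn_mult)

lemma enters_joins: "enters v d c a \<Longrightarrow> \<exists>r>0. joins a v (v + of_real r * d)"
  by (auto simp: enters_def joins_iff)

lemma leaves_joins: "leaves v d c a \<Longrightarrow> \<exists>r>0. joins a v (v + of_real r * d)"
  by (auto simp: leaves_def joins_iff)

lemma dirsgn_direction:
  assumes "\<exists>r>0. joins a v (v + of_real r * (w * u))" "u \<noteq> 0"
  shows "dirsgn v u a = sgn_pair w"
proof -
  obtain r where "r > 0" "joins a v (v + of_real r * (w * u))" using assms by auto
  then show ?thesis
    using dirsgn_joins[of a v "of_real r * (w * u)" u] assms(2) sgn_pair_scale[of r w] by simp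
qed

lemma C4E:
  assumes "C4 v u X"
  obtains a1 a2 b1 b2 k c1 c2 where "u \<noteq> 0" "X = {a1, a2, b1, b2}"
    "enters v (- u) k a1" "leaves v u k a2"
    "enters v (\<i> * u) c1 b1" "enters v (- \<i> * u) c2 b2" "c1 \<noteq> c2"
    "dirsgn v u a1 = (-1, 0)" "dirsgn v u a2 = (1, 0)"
    "dirsgn v u b1 = (0, 1)" "dirsgn v u b2 = (0, -1)"
proof -
  obtain a1 a2 b1 b2 k c1 c2 where *: "u \<noteq> 0" "X = {a1, a2, b1, b2}"
    "enters v (- u) k a1" "leaves v u k a2"
    "enters v (\<i> * u) c1 b1" "enters v (- \<i> * u) c2 b2" "c1 \<noteq> c2"
    using assms unfolding C4_def by blast
  have "dirsgn v u a1 = sgn_pair (-1)" "dirsgn v u a2 = sgn_pair 1"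
    "dirsgn v u b1 = sgn_pair \<i>" "dirsgn v u b2 = sgn_pair (-\<i>)"
    using *(3,5,6)[THEN enters_joins] *(4)[THEN leaves_joins]
    by (auto intro!: dirsgn_direction[OF _ *(1)])
  then show ?thesis using * by (intro that[of a1 a2 b1 b2 k c1 c2]) (simp_all add: sgn_pair_def)
qed

lemma C8E:
  assumes "C8 v u X"
  obtains a1 a2 b1 b2 d1 d2 d3 d4 k c1 c2 where "u \<noteq> 0"
    "X = {a1, a2, b1, b2, d1, d2, d3, d4}"
    "enters v (- u) k a1" "leaves v u k a2"
    "enters v (\<i> * u) c1 b1" "enters v (- \<i> * u) c2 b2" "c1 \<noteq> c2"
    "leaves v ((1 + \<i>) * u) Red d1" "leaves v ((- 1 + \<i>) * u) Green d2"
    "leaves v ((- 1 - \<i>) * u) Red d3" "leaves v ((1 - \<i>) * u) Green d4"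
    "dirsgn v u a1 = (-1, 0)" "dirsgn v u a2 = (1, 0)"
    "dirsgn v u b1 = (0, 1)" "dirsgn v u b2 = (0, -1)"
    "dirsgn v u d1 = (1, 1)" "dirsgn v u d2 = (-1, 1)"
    "dirsgn v u d3 = (-1, -1)" "dirsgn v u d4 = (1, -1)"
proof -
  obtain a1 a2 b1 b2 d1 d2 d3 d4 k c1 c2 where *: "u \<noteq> 0"
    "X = {a1, a2, b1, b2, d1, d2, d3, d4}"
    "enters v (- u) k a1" "leaves v u k a2"
    "enters v (\<i> * u) c1 b1" "enters v (- \<i> * u) c2 b2" "c1 \<noteq> c2"
    "leaves v ((1 + \<i>) * u) Red d1" "leaves v ((- 1 + \<i>) * u) Green d2"
    "leaves v ((- 1 - \<i>) * u) Red d3" "leaves v ((1 - \<i>) * u) Green d4"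
    using assms unfolding C8_def by blast
  have "dirsgn v u a1 = sgn_pair (-1)" "dirsgn v u a2 = sgn_pair 1"
    "dirsgn v u b1 = sgn_pair \<i>" "dirsgn v u b2 = sgn_pair (-\<i>)"
    "dirsgn v u d1 = sgn_pair (1 + \<i>)" "dirsgn v u d2 = sgn_pair (-1 + \<i>)"
    "dirsgn v u d3 = sgn_pair (-1 - \<i>)" "dirsgn v u d4 = sgn_pair (1 - \<i>)"
    using *(3,5,6)[THEN enters_joins] *(4,8-11)[THEN leaves_joins]
    by (auto intro!: dirsgn_direction[OF _ *(1)])
  then show ?thesis using *
    by (intro that[of a1 a2 b1 b2 d1 d2 d3 d4 k c1 c2]) (simp_all add: sgn_pair_def)
qed

text \<open>The arrows of a crossing have pairwise different sign pairs, so \<open>dirsgn\<close> is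
  injective on it. Sides of tiles that point the same way from \<open>v\<close> are thereby the same
  arrow, without comparing their lengths.\<close>

lemma C4_arrow_unique:
  assumes "C4 v u X" "a \<in> X" "b \<in> X" "dirsgn v u a = dirsgn v u b"
  shows "a = b"
proof -
  obtain a1 a2 b1 b2 where "X = {a1, a2, b1, b2}"
    "dirsgn v u a1 = (-1, 0)" "dirsgn v u a2 = (1, 0)"
    "dirsgn v u b1 = (0, 1)" "dirsgn v u b2 = (0, -1)"
    using assms(1) by (elim C4E)
  then show ?thesis using assms(2-4) by auto
qed

lemma C8_arrow_unique:
  assumes "C8 v u X" "a \<in> X" "b \<in> X" "dirsgn v u a = dirsgn v u b"
  shows "a = b"
proof -
  obtain a1 a2 b1 b2 d1 d2 d3 d4 where "X = {a1, a2, b1, b2, d1, d2, d3, d4}"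
    "dirsgn v u a1 = (-1, 0)" "dirsgn v u a2 = (1, 0)"
    "dirsgn v u b1 = (0, 1)" "dirsgn v u b2 = (0, -1)"
    "dirsgn v u d1 = (1, 1)" "dirsgn v u d2 = (-1, 1)"
    "dirsgn v u d3 = (-1, -1)" "dirsgn v u d4 = (1, -1)"
    using assms(1) by (elim C8E)
  then show ?thesis using assms(2-4) by auto
qed

lemma C4_direction:
  assumes "C4 v u X" "a \<in> X"
  shows "\<exists>r>0. \<exists>w\<in>{1, -1, \<i>, -\<i>}. joins a v (v + of_real r * (w * u))"
proof -
  obtain a1 a2 b1 b2 k c1 c2 where *: "X = {a1, a2, b1, b2}"
    "enters v (- u) k a1" "leaves v u k a2"
    "enters v (\<i> * u) c1 b1" "enters v (- \<i> * u) c2 b2"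
    using assms(1) by (elim C4E)
  have "\<exists>r>0. joins a1 v (v + of_real r * (-1 * u))"
    "\<exists>r>0. joins a2 v (v + of_real r * (1 * u))"
    "\<exists>r>0. joins b1 v (v + of_real r * (\<i> * u))"
      "\<exists>r>0. joins b2 v (v + of_real r * (-\<i> * u))"
    using *(2,4,5)[THEN enters_joins] *(3)[THEN leaves_joins] by simp_all
  then show ?thesis using assms(2) *(1) by blast
qed

lemma C8_direction:
  assumes "C8 v u X"
  shows "a \<in> X \<Longrightarrow> \<exists>r>0. \<exists>w\<in>{1, -1, \<i>, -\<i>, 1 + \<i>, -1 + \<i>, -1 - \<i>, 1 - \<i>}. joins a v (v + of_real r * (w * u))"
    and "w \<in> {1, -1, \<i>, -\<i>, 1 + \<i>, -1 + \<i>, -1 - \<i>, 1 - \<i>} \<Longrightarrow> \<exists>a\<in>X. \<exists>r>0. joins a v (v + of_real r * (w * u))"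
proof -
  obtain a1 a2 b1 b2 d1 d2 d3 d4 k c1 c2 where *: "X = {a1, a2, b1, b2, d1, d2, d3, d4}"
    "enters v (- u) k a1" "leaves v u k a2"
    "enters v (\<i> * u) c1 b1" "enters v (- \<i> * u) c2 b2"
    "leaves v ((1 + \<i>) * u) Red d1" "leaves v ((- 1 + \<i>) * u) Green d2"
    "leaves v ((- 1 - \<i>) * u) Red d3" "leaves v ((1 - \<i>) * u) Green d4"
    using assms(1) by (elim C8E)
  have J: "\<exists>r>0. joins a1 v (v + of_real r * (-1 * u))"
    "\<exists>r>0. joins a2 v (v + of_real r * (1 * u))"
    "\<exists>r>0. joins b1 v (v + of_real r * (\<i> * u))"
      "\<exists>r>0. joins b2 v (v + of_real r * (-\<i> * u))"
    "\<exists>r>0. joins d1 v (v + of_real r * ((1 + \<i>) * u))"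
      "\<exists>r>0. joins d2 v (v + of_real r * ((-1 + \<i>) * u))"
    "\<exists>r>0. joins d3 v (v + of_real r * ((-1 - \<i>) * u))"
      "\<exists>r>0. joins d4 v (v + of_real r * ((1 - \<i>) * u))"
    using *(2,4,5)[THEN enters_joins] *(3,6-9)[THEN leaves_joins] by simp_all
  show "a \<in> X \<Longrightarrow> \<exists>r>0. \<exists>w\<in>{1, -1, \<i>, -\<i>, 1 + \<i>, -1 + \<i>, -1 - \<i>, 1 - \<i>}. joins a v (v + of_real r * (w * u))"
    using J *(1) by blast
  show "w \<in> {1, -1, \<i>, -\<i>, 1 + \<i>, -1 + \<i>, -1 - \<i>, 1 - \<i>} \<Longrightarrow> \<exists>a\<in>X. \<exists>r>0. joins a v (v + of_real r * (w * u))"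
    using J *(1) by blast
qed

text \<open>The existential list of named arrows becomes a lookup by direction: what the definition
  says of the arrow in a given direction holds for any side of a tile found there.\<close>

lemma C4_values:
  assumes "C4 v u X"
  obtains k c1 c2 where "u \<noteq> 0" "c1 \<noteq> c2"
    "\<forall>a\<in>X. dirsgn v u a = (-1, 0) \<longrightarrow> enters v (- u) k a"
    "\<forall>a\<in>X. dirsgn v u a = (1, 0) \<longrightarrow> leaves v u k a"
    "\<forall>a\<in>X. dirsgn v u a = (0, 1) \<longrightarrow> enters v (\<i> * u) c1 a"
    "\<forall>a\<in>X. dirsgn v u a = (0, -1) \<longrightarrow> enters v (- \<i> * u) c2 a"
proof -
  obtain a1 a2 b1 b2 k c1 c2 where *: "u \<noteq> 0" "X = {a1, a2, b1, b2}"
    "enters v (- u) k a1" "leaves v u k a2"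
    "enters v (\<i> * u) c1 b1" "enters v (- \<i> * u) c2 b2" "c1 \<noteq> c2"
    "dirsgn v u a1 = (-1, 0)" "dirsgn v u a2 = (1, 0)"
    "dirsgn v u b1 = (0, 1)" "dirsgn v u b2 = (0, -1)"
    using assms by (elim C4E)
  show ?thesis
  proof (rule that[OF *(1,7), of k]; intro ballI)
    fix a assume a: "a \<in> X"
    have u: "dirsgn v u a = dirsgn v u b \<Longrightarrow> b \<in> X \<Longrightarrow> a = b" for b
      using C4_arrow_unique[OF assms a] by blast
    show "dirsgn v u a = (-1, 0) \<longrightarrow> enters v (- u) k a" using u[of a1] *(2,3,8)
      by auto
    show "dirsgn v u a = (1, 0) \<longrightarrow> leaves v u k a" using u[of a2] *(2,4,9) by auto
    show "dirsgn v u a = (0, 1) \<longrightarrow> enters v (\<i> * u) c1 a" using u[of b1] *(2,5,10)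
      by auto
    show "dirsgn v u a = (0, -1) \<longrightarrow> enters v (- \<i> * u) c2 a"
      using u[of b2] *(2,6,11) by auto
  qed
qed

lemma C8_values:
  assumes "C8 v u X"
  obtains k c1 c2 where "u \<noteq> 0" "c1 \<noteq> c2"
    "\<forall>a\<in>X. dirsgn v u a = (-1, 0) \<longrightarrow> enters v (- u) k a"
    "\<forall>a\<in>X. dirsgn v u a = (1, 0) \<longrightarrow> leaves v u k a"
    "\<forall>a\<in>X. dirsgn v u a = (0, 1) \<longrightarrow> enters v (\<i> * u) c1 a"
    "\<forall>a\<in>X. dirsgn v u a = (0, -1) \<longrightarrow> enters v (- \<i> * u) c2 a"
    "\<forall>a\<in>X. dirsgn v u a = (1, 1) \<longrightarrow> leaves v ((1 + \<i>) * u) Red a"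
    "\<forall>a\<in>X. dirsgn v u a = (-1, 1) \<longrightarrow> leaves v ((- 1 + \<i>) * u) Green a"
    "\<forall>a\<in>X. dirsgn v u a = (-1, -1) \<longrightarrow> leaves v ((- 1 - \<i>) * u) Red a"
    "\<forall>a\<in>X. dirsgn v u a = (1, -1) \<longrightarrow> leaves v ((1 - \<i>) * u) Green a"
proof -
  obtain a1 a2 b1 b2 d1 d2 d3 d4 k c1 c2 where *: "u \<noteq> 0"
    "X = {a1, a2, b1, b2, d1, d2, d3, d4}"
    "enters v (- u) k a1" "leaves v u k a2"
    "enters v (\<i> * u) c1 b1" "enters v (- \<i> * u) c2 b2" "c1 \<noteq> c2"
    "leaves v ((1 + \<i>) * u) Red d1" "leaves v ((- 1 + \<i>) * u) Green d2"
    "leaves v ((- 1 - \<i>) * u) Red d3" "leaves v ((1 - \<i>) * u) Green d4"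
    "dirsgn v u a1 = (-1, 0)" "dirsgn v u a2 = (1, 0)"
    "dirsgn v u b1 = (0, 1)" "dirsgn v u b2 = (0, -1)"
    "dirsgn v u d1 = (1, 1)" "dirsgn v u d2 = (-1, 1)"
    "dirsgn v u d3 = (-1, -1)" "dirsgn v u d4 = (1, -1)"
    using assms by (elim C8E)
  show ?thesis
  proof (rule that[OF *(1,7), of k]; intro ballI)
    fix a assume a: "a \<in> X"
    have u: "dirsgn v u a = dirsgn v u b \<Longrightarrow> b \<in> X \<Longrightarrow> a = b" for b
      using C8_arrow_unique[OF assms a] by blast
    show "dirsgn v u a = (-1, 0) \<longrightarrow> enters v (- u) k a" using u[of a1] *(2,3,12)
      by auto
    show "dirsgn v u a = (1, 0) \<longrightarrow> leaves v u k a" using u[of a2] *(2,4,13) by auto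
    show "dirsgn v u a = (0, 1) \<longrightarrow> enters v (\<i> * u) c1 a" using u[of b1] *(2,5,14)
      by auto
    show "dirsgn v u a = (0, -1) \<longrightarrow> enters v (- \<i> * u) c2 a"
      using u[of b2] *(2,6,15) by auto
    show "dirsgn v u a = (1, 1) \<longrightarrow> leaves v ((1 + \<i>) * u) Red a"
      using u[of d1] *(2,8,16) by auto
    show "dirsgn v u a = (-1, 1) \<longrightarrow> leaves v ((- 1 + \<i>) * u) Green a"
      using u[of d2] *(2,9,17) by auto
    show "dirsgn v u a = (-1, -1) \<longrightarrow> leaves v ((- 1 - \<i>) * u) Red a"
      using u[of d3] *(2,10,18) by auto
    show "dirsgn v u a = (1, -1) \<longrightarrow> leaves v ((1 - \<i>) * u) Green a"
      using u[of d4] *(2,11,19) by auto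
  qed
qed

text \<open>Both arrows would lie along \<open>p * u\<close> and \<open>p' * u\<close> with
  \<open>p * p\<close> and \<open>p' * p'\<close> equal to 1 or -1, so the quotient of their
  directions has a real square. But the factor \<open>w\<close> of a turn by 45 degrees squares to
  \<open>2 * \<i>\<close> or \<open>- 2 * \<i>\<close>.\<close>

lemma C4_no_half_right_angle:
  assumes "C4 v u X" "a \<in> X" "b \<in> X" "joins a v (v + z)" "joins b v (v + w * z)"
    "w = 1 + \<i> \<or> w = 1 - \<i>"
  shows False
proof -
  obtain r p where r: "r > 0" "p \<in> {1, -1, \<i>, -\<i>}" "joins a v (v + of_real r * (p * u))"
    using C4_direction[OF assms(1,2)] by blast
  obtain r' p' where r': "r' > 0" "p' \<in> {1, -1, \<i>, -\<i>}"
    "joins b v (v + of_real r' * (p' * u))"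
    using C4_direction[OF assms(1,3)] by blast
  have u: "u \<noteq> 0" using assms(1) by (auto simp: C4_def)
  have "z = of_real r * (p * u)" using assms(4) r u by (auto simp: joins_iff)
  moreover have "w * z = of_real r' * (p' * u)" using assms(5) r' u by (auto simp: joins_iff)
  ultimately have "w * of_real r * p * u = of_real r' * p' * u" by (simp add: algebra_simps)
  then have "w * of_real r * p = of_real r' * p'" by (simp only: mult_right_cancel[OF u])
  then have "(w * w) * of_real (r * r) * (p * p) = of_real (r' * r') * (p' * p')"
    by (metis (no_types, opaque_lifting) mult.assoc mult.commute of_real_mult)
  moreover have "w * w = 2 * \<i> \<or> w * w = - 2 * \<i>" using assms(6)
    by (elim disjE) (simp_all add: complex_eq_iff)
  moreover have "p * p = 1 \<or> p * p = -1" "p' * p' = 1 \<or> p' * p' = -1" using r r' by auto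
  ultimately show False using r(1) by (elim disjE) (simp_all add: complex_eq_iff)
qed

section \<open>Tilings with a fixed leg length: overlaps and local finiteness\<close>

locale triangle_tiling =
  fixes T :: "tile set" and s :: real
  assumes tiling: "tiling T" and s_pos: "s > 0"
    and tile: "\<And>t. t \<in> T \<Longrightarrow> triangle_tile s t"
begin

lemma covering: "\<exists>t\<in>T. z \<in> region t"
  using tiling by (auto simp: tiling_def)

lemma overlap_eq:
  assumes "t \<in> T" "t' \<in> T" "z \<in> interior (region t)" "z \<in> region t'"
  shows "t = t'"
proof -
  have "interior (region t) \<inter> interior (region t') \<noteq> {}"
    using open_meets_interior_region[OF tile[OF assms(2)] s_pos, of "interior (region t)" z] assms
      by auto
  then show ?thesis using tiling assms by (auto simp: tiling_def)
qed

lemmas position_eq = tile_eqI_position[OF tiling]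
lemmas dir_nonzero = triangle_tile_dir_nonzero[OF tile s_pos]
lemmas lv_eq = triangle_tile_rv_lv(2)[OF tile]

text \<open>One interior point \<open>c t\<close> is chosen in each tile. These points are uniformly
  separated and, for tiles near \<open>x\<close>, bounded, so there are only finitely many of
  them.\<close>

lemma finite_near: "finite {t \<in> T. region t \<inter> ball x 1 \<noteq> {}}" (is "finite ?F")
proof -
  \<comment> \<open>The point with coordinates (1/4, 1/4) may be moved by less than 1/8 in both
    coordinates without leaving the interior, whence the separation \<open>s / 8\<close>.\<close>
  define c where "c t = apex t + Complex (1/4) (1/4) * (rv t - apex t)" for t :: tile
  have sep: "t = t'" if tt: "t \<in> T" "t' \<in> T" "dist (c t) (c t') < s / 8" for t t'
  proof -
    let ?d = "rv t - apex t"
    define q where "q = (c t' - c t) / ?d"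
    have d: "?d \<noteq> 0" using dir_nonzero tt by blast
    have "norm q < 1/8"
      using tt(3) norm_dir[OF tile[OF tt(1)]] s_pos
        by (simp add: q_def norm_divide dist_norm norm_minus_commute field_simps)
    then have "\<bar>Re q\<bar> < 1/8" "\<bar>Im q\<bar> < 1/8"
      using abs_Re_le_cmod[of q] abs_Im_le_cmod[of q] by linarith+
    then have "apex t + (Complex (1/4) (1/4) + q) * ?d \<in> interior (region t)"
      by (intro tile_point_in_interior[OF tile[OF tt(1)] s_pos]) auto
    moreover have "c t' = apex t + (Complex (1/4) (1/4) + q) * ?d"
      using d by (simp add: q_def c_def[of t] distrib_right)
    moreover have "c t' \<in> region t'"
      unfolding c_def by (subst tile_point_in_region[OF tile[OF tt(2)] s_pos]) auto
    ultimately show ?thesis using overlap_eq tt by metis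
  qed
  have bd: "dist x (c t) \<le> 1 + 4 * s" if t: "t \<in> ?F" for t
  proof -
    let ?d = "rv t - apex t"
    have tT: "t \<in> T" using t by auto
    obtain z where z: "z \<in> region t" "dist x z < 1" using t by auto
    obtain q where q: "z = apex t + q * ?d" using tile_coordinate[OF tile[OF tT] s_pos] by blast
    have "0 \<le> Re q \<and> 0 \<le> Im q \<and> Re q + Im q \<le> 1"
      using z q tile_point_in_region[OF tile[OF tT] s_pos] by auto
    then have "norm q \<le> 2" using cmod_le[of q] by linarith
    moreover have "norm (Complex (1/4) (1/4)) \<le> 2" using cmod_le[of "Complex (1/4) (1/4)"]
      by simp
    ultimately have "norm (q - Complex (1/4) (1/4)) \<le> 4"
      using norm_triangle_ineq4[of q "Complex (1/4) (1/4)"] by linarith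
    then have "norm (q - Complex (1/4) (1/4)) * s \<le> 4 * s" using s_pos by simp
    moreover have "z - c t = (q - Complex (1/4) (1/4)) * ?d" by (simp add: c_def q algebra_simps)
    ultimately have "dist z (c t) \<le> 4 * s" using norm_dir[OF tile[OF tT]]
      by (simp add: dist_norm norm_mult)
    then show ?thesis using z(2) dist_triangle[of x "c t" z] by linarith
  qed
  have "uniform_discrete (c ` ?F)"
    unfolding uniform_discrete_def using sep s_pos by (intro exI[of _ "s/8"]) auto
  moreover have "bounded (c ` ?F)"
    unfolding bounded_def using bd by (intro exI[of _ x] exI[of _ "1 + 4 * s"]) auto
  ultimately have "finite (c ` ?F)" using uniform_discrete_finite_iff by blast
  moreover have "inj_on c ?F" using sep s_pos by (auto simp: inj_on_def)
  ultimately show ?thesis using finite_imageD by blast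
qed

text \<open>\<open>w\<close> points out of \<open>t\<close> at \<open>x\<close>; local finiteness forces one single tile to contain
  \<open>x\<close> together with points of the outgoing ray close to it.\<close>

lemma tile_at_boundary:
  assumes "t \<in> T"
    and out: "\<And>e. e > 0 \<Longrightarrow> x + of_real e * w \<notin> region t"
  shows "\<exists>t'\<in>T. t' \<noteq> t \<and> x \<in> region t'"
proof -
  let ?F = "{t \<in> T. region t \<inter> ball x 1 \<noteq> {}}"
  \<comment> \<open>The nearby tiles that miss \<open>x\<close>: a finite union of closed sets, so a
    whole ball around \<open>x\<close> avoids all of them.\<close>
  define K where "K = (\<Union>t\<in>{t \<in> ?F. x \<notin> region t}. region t)"
  have "closed K" unfolding K_def using closed_region
    by (intro closed_UN finite_subset[OF _ finite_near[of x]]) auto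
  moreover have "x \<notin> K" by (auto simp: K_def)
  ultimately obtain e where "e > 0" "ball x e \<subseteq> - K"
    by (metis ComplI open_Compl openE[of "- K" x])
  then have e: "e > 0" "ball x e \<inter> K = {}" by auto
  \<comment> \<open>The step along \<open>w\<close> stays below 1, so that the tile reached is among
    the finitely many in \<open>?F\<close>, and below \<open>e\<close>, so that the point reached is
    outside \<open>K\<close>. The summand 1 keeps the denominator positive.\<close>
  define e' where "e' = min e 1 / (2 * (norm w + 1))"
  have e': "e' > 0" using e by (simp add: e'_def add_nonneg_pos)
  have "e' * norm w < min e 1"
  proof -
    have "e' * norm w \<le> e' * (norm w + 1)" using e' by simp
    also have "\<dots> = min e 1 / 2"
    proof -
      have "norm w + 1 > 0" by (simp add: add_nonneg_pos)
      then show ?thesis by (simp add: e'_def field_simps)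
    qed
    finally show ?thesis using e by linarith
  qed
  then have d: "dist x (x + of_real e' * w) < min e 1" using e' by (simp add: dist_norm norm_mult)
  obtain t' where t': "t' \<in> T" "x + of_real e' * w \<in> region t'" using covering by blast
  have "x \<in> region t'"
  proof (rule ccontr)
    assume "x \<notin> region t'"
    moreover have "t' \<in> ?F" using t' d by auto
    ultimately have "x + of_real e' * w \<in> K" using t' by (auto simp: K_def)
    then show False using e d by auto
  qed
  then show ?thesis using t' out[OF e'] by auto
qed

end

section \<open>Neighbours in a correct tiling\<close>

lemma tile_point_in_vertices:
  assumes "triangle_tile s t" "s > 0"
  shows "apex t + c * (rv t - apex t) \<in> vertices t \<longleftrightarrow> c = 0 \<or> c = 1 \<or> c = \<i>"
proof -
  have d: "rv t - apex t \<noteq> 0" using triangle_tile_dir_nonzero[OF assms] .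
  have "vertices t = {apex t + 0 * (rv t - apex t), apex t + 1 * (rv t - apex t), apex t + \<i> * (rv t - apex t)}"
    using triangle_tile_rv_lv(2)[OF assms(1)] by (auto simp: vertices_def)
  then show ?thesis
    by (simp only: insert_iff empty_iff add_left_cancel mult_right_cancel[OF d]) auto
qed

lemma tile_vertices_by_hyp:
  assumes "triangle_tile s t" "triangle_tile s' t'" "rv t = rv t'" "lv t = lv t'"
  shows "apex t = apex t'"
proof -
  have "(1 - \<i>) * apex t = (1 - \<i>) * apex t'"
    using triangle_tile_rv_lv(2)[OF assms(1)] triangle_tile_rv_lv(2)[OF assms(2)] assms(3,4)
    by (simp add: algebra_simps)
  then show ?thesis by (simp add: complex_eq_iff)
qed

lemma sides_endpoints: "triangle_tile s t \<Longrightarrow> a \<in> sides t \<Longrightarrow> src a \<in> vertices t \<and> tgt a \<in> vertices t"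
  by (auto simp: triangle_tile_def sides_def joins_iff vertices_def)

lemma seg_eq_iff: "seg a = seg b \<longleftrightarrow> {src a, tgt a} = {src b, tgt b}"
  by (simp add: seg_def)

lemma seg_dist: "seg a = seg b \<Longrightarrow> dist (src a) (tgt a) = dist (src b) (tgt b)"
  by (auto simp: seg_eq_iff doubleton_eq_iff dist_commute)

lemma vertex_in_seg:
  assumes "triangle_tile s t" "s > 0" "a \<in> sides t" "v \<in> vertices t" "v \<in> seg a"
  shows "v \<in> {src a, tgt a}"
proof -
  obtain c where c: "v = apex t + c * (rv t - apex t)" using tile_coordinate[OF assms(1,2)] by blast
  have J: "{src (rleg t), tgt (rleg t)} = {apex t, rv t}"
    "{src (lleg t), tgt (lleg t)} = {apex t, lv t}"
    "{src (hyp t), tgt (hyp t)} = {rv t, lv t}" using assms(1)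
      by (auto simp: triangle_tile_def joins_def)
  have "c = 0 \<or> c = 1 \<or> c = \<i>" using assms(4) c tile_point_in_vertices[OF assms(1,2)]
    by auto
  moreover from assms(3) consider "a = rleg t" | "a = lleg t" | "a = hyp t"
    by (auto simp: sides_def)
  then show ?thesis
    using assms(5) c rleg_point[OF assms(1,2), of c] lleg_point[OF assms(1,2), of c]
      hyp_point[OF assms(1,2), of c] triangle_tile_rv_lv(2)[OF assms(1)] calculation
    by cases (auto simp: J)
qed

lemma color_neq_trans: "(a::color) \<noteq> b \<Longrightarrow> b \<noteq> c \<Longrightarrow> a = c"
  by (cases a; cases b; cases c) auto

text \<open>The vertices \<open>apex t\<close>, \<open>rv t\<close>, \<open>lv t\<close> run
  counterclockwise, so an arrow from \<open>lv t\<close> to \<open>apex t\<close> follows the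
  positively oriented boundary and has the tile on its left. A right leg that enters the apex runs
  against this orientation. Through these two facts the colouring rule at a \<open>C4\<close>
  crossing applies to tiles.\<close>

lemma on_left_lleg:
  assumes "triangle_tile s t" "tgt (lleg t) = apex t"
  shows "on_left (lleg t) t"
proof -
  define d where "d = rv t - apex t"
  have l: "lv t = apex t + \<i> * d" and r: "rv t = apex t + d"
    using triangle_tile_rv_lv[OF assms(1)] by (auto simp: d_def)
  have "src (lleg t) = lv t" using assms by (auto simp: triangle_tile_def joins_iff)
  then show ?thesis using assms(2) l r
    by (auto simp: on_left_def sides_def vertices_def algebra_simps)
qed

lemma on_right_rleg:
  assumes "triangle_tile s t" "tgt (rleg t) = apex t"
  shows "on_right (rleg t) t"
proof -
  define d where "d = rv t - apex t"
  have l: "lv t = apex t + \<i> * d" and r: "rv t = apex t + d"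
    using triangle_tile_rv_lv[OF assms(1)] by (auto simp: d_def)
  have "src (rleg t) = rv t" using assms by (auto simp: triangle_tile_def joins_iff)
  then show ?thesis using assms(2) l r
    by (auto simp: on_right_def sides_def vertices_def algebra_simps)
qed

locale correct_triangle_tiling = triangle_tiling +
  assumes correct: "correct_tiling T"
begin

lemma correct_facts:
  "side_to_side T"
  "\<forall>t\<in>T. \<forall>t'\<in>T. \<forall>a\<in>sides t. \<forall>b\<in>sides t'. seg a = seg b \<longrightarrow> a = b"
  "\<forall>t\<in>T. \<forall>t'\<in>T. t \<noteq> t' \<and> sides t \<inter> sides t' \<noteq> {} \<longrightarrow> tcol t \<noteq> tcol t'"
  "\<forall>v\<in>(\<Union>t\<in>T. vertices t). \<exists>u. C4 v u (crossing T v) \<or> C8 v u (crossing T v)"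
  "\<forall>v u b. C4 v u (crossing T v) \<and> b \<in> crossing T v \<and> tgt b = v \<and> (src b - v) \<bullet> u = 0 \<longrightarrow>
     (\<forall>t\<in>T. (on_left b t \<longrightarrow> tcol t = Red) \<and> (on_right b t \<longrightarrow> tcol t = Green))"
  using correct unfolding correct_tiling_def by - (elim conjE, assumption)+

lemma arrow_eq: "t \<in> T \<Longrightarrow> t' \<in> T \<Longrightarrow> a \<in> sides t \<Longrightarrow> b \<in> sides t' \<Longrightarrow> seg a = seg b \<Longrightarrow> a = b"
  using correct_facts(2) by blast

lemma color_neq: "t \<in> T \<Longrightarrow> t' \<in> T \<Longrightarrow> t \<noteq> t' \<Longrightarrow> a \<in> sides t \<Longrightarrow> a \<in> sides t' \<Longrightarrow> tcol t \<noteq> tcol t'"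
  using correct_facts(3) by blast

lemma vertex_C4_C8: "t \<in> T \<Longrightarrow> v \<in> vertices t \<Longrightarrow> \<exists>u. C4 v u (crossing T v) \<or> C8 v u (crossing T v)"
  using correct_facts(4) by blast

lemma C4_left_right:
  "C4 v u (crossing T v) \<Longrightarrow> b \<in> crossing T v \<Longrightarrow> tgt b = v \<Longrightarrow> (src b - v) \<bullet> u = 0 \<Longrightarrow> t \<in> T \<Longrightarrow>
   (on_left b t \<longrightarrow> tcol t = Red) \<and> (on_right b t \<longrightarrow> tcol t = Green)"
  using correct_facts(5) by blast

lemma intersection_cases:
  assumes "t \<in> T" "t' \<in> T" "t \<noteq> t'"
  obtains "region t \<inter> region t' = {}"
  | v where "v \<in> vertices t" "v \<in> vertices t'" "region t \<inter> region t' = {v}"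
  | a where "a \<in> sides t" "a \<in> sides t'" "region t \<inter> region t' = seg a"
proof -
  have "region t \<inter> region t' = {} \<or>
     (\<exists>v\<in>vertices t \<inter> vertices t'. region t \<inter> region t' = {v}) \<or>
     (\<exists>a\<in>sides t. \<exists>b\<in>sides t'. seg a = seg b \<and> region t \<inter> region t' = seg a)"
    using assms correct_facts(1) unfolding side_to_side_def by blast
  then show ?thesis using that arrow_eq[OF assms(1,2)] by blast
qed

text \<open>The intersection of two tiles is a common vertex or a common side, and a vertex of
  \<open>t\<close> on a side of \<open>t\<close> is an end of it; the ends of a common side are
  vertices of \<open>t'\<close> too.\<close>

lemma vertex_in_region:
  assumes "t \<in> T" "t' \<in> T" "v \<in> vertices t" "v \<in> region t'"
  shows "v \<in> vertices t'"
proof (cases "t = t'")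
  case False
  have "v \<in> region t" using assms(3) by (simp add: region_def hull_inc)
  with assms(4) have v: "v \<in> region t \<inter> region t'" by simp
  show ?thesis
    using assms(1,2) False
  proof (cases rule: intersection_cases)
    case 1
    then show ?thesis using v by simp
  next
    case (2 w)
    then show ?thesis using v by simp
  next
    case (3 a)
    then have "v \<in> {src a, tgt a}" using vertex_in_seg[OF tile s_pos] assms v by blast
    then show ?thesis using sides_endpoints[OF tile[OF assms(2)] 3(2)] by auto
  qed
qed (use assms in simp)

text \<open>\<open>x\<close> stands for a point in the relative interior of the side
  \<open>a\<close>, and \<open>w\<close> for an outward direction. The tile found beyond
  \<open>x\<close> cannot meet \<open>t\<close> in a vertex only, so it shares a side through
  \<open>x\<close>, and this can only be \<open>a\<close>.\<close>

lemma neighbour_at: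
  assumes "t \<in> T" "a \<in> sides t" "x \<in> region t" "x \<notin> vertices t"
    and "\<And>b. b \<in> sides t \<Longrightarrow> x \<in> seg b \<Longrightarrow> b = a"
    and "\<And>e. e > 0 \<Longrightarrow> x + of_real e * w \<notin> region t"
  shows "\<exists>t'\<in>T. t' \<noteq> t \<and> a \<in> sides t'"
proof -
  obtain t' where t': "t' \<in> T" "t' \<noteq> t" "x \<in> region t'"
    using tile_at_boundary[of t x w] assms by blast
  have x: "x \<in> region t \<inter> region t'" using assms t' by simp
  show ?thesis
    using assms(1) t'(1) t'(2)[symmetric]
  proof (cases rule: intersection_cases)
    case 1
    then show ?thesis using x by simp
  next
    case (2 w)
    then show ?thesis using x assms by auto
  next
    case (3 b)
    then have "b = a" using x assms by blast
    then show ?thesis using 3 t' by blast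
  qed
qed

lemma neighbour:
  assumes t: "t \<in> T" and a: "a \<in> sides t"
  shows "\<exists>t'\<in>T. t' \<noteq> t \<and> a \<in> sides t'"
proof -
  define d where "d = rv t - apex t"
  note pt = tile_point_in_region[OF tile[OF t] s_pos, folded d_def]
    tile_point_in_vertices[OF tile[OF t] s_pos, folded d_def]
    rleg_point[OF tile[OF t] s_pos, folded d_def] lleg_point[OF tile[OF t] s_pos, folded d_def]
    hyp_point[OF tile[OF t] s_pos, folded d_def]
  have ex: "\<exists>t'\<in>T. t' \<noteq> t \<and> a \<in> sides t'"
    if "0 \<le> Re c" "0 \<le> Im c" "Re c + Im c \<le> 1" "c \<noteq> 0" "c \<noteq> 1"
      "c \<noteq> \<i>"
      "Im c = 0 \<Longrightarrow> rleg t = a" "Re c = 0 \<Longrightarrow> lleg t = a"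
        "Re c + Im c = 1 \<Longrightarrow> hyp t = a"
      and out: "\<And>e. e > 0 \<Longrightarrow> Re c + e * Re w < 0 \<or> Im c + e * Im w < 0 \<or>
         Re c + e * Re w + (Im c + e * Im w) > 1" for c w
  proof (rule neighbour_at[OF t a, of "apex t + c * d" "w * d"])
    show "apex t + c * d \<in> region t" "apex t + c * d \<notin> vertices t" using that
      by (auto simp: pt)
    show "b = a" if "b \<in> sides t" "apex t + c * d \<in> seg b" for b
      using that \<open>Im c = 0 \<Longrightarrow> rleg t = a\<close> \<open>Re c = 0 \<Longrightarrow> lleg t = a\<close> \<open>Re c + Im c = 1 \<Longrightarrow> hyp t = a\<close>
      by (auto simp: sides_def pt)
    show "apex t + c * d + of_real e * (w * d) \<notin> region t" if "e > 0" for e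
    proof -
      have *: "apex t + c * d + of_real e * (w * d) = apex t + (c + of_real e * w) * d"
        by (simp add: algebra_simps)
      show ?thesis unfolding * pt using out[OF that] by auto
    qed
  qed
  \<comment> \<open>In each case \<open>c\<close> is the coordinate of the midpoint of the side and
    \<open>w\<close> that of an outward normal.\<close>
  from a consider "a = rleg t" | "a = lleg t" | "a = hyp t" by (auto simp: sides_def)
  then show ?thesis
  proof cases
    case 1
    then show ?thesis by (intro ex[of "1/2" "-\<i>"]) (auto simp: complex_eq_iff)
  next
    case 2
    then show ?thesis by (intro ex[of "\<i>/2" "-1"]) (auto simp: complex_eq_iff)
  next
    case 3
    then show ?thesis by (intro ex[of "(1+\<i>)/2" "1+\<i>"]) (auto simp: complex_eq_iff)
  qed
qed

lemma rleg_joins: "t \<in> T \<Longrightarrow> joins (rleg t) (apex t) (rv t)"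
  and lleg_joins: "t \<in> T \<Longrightarrow> joins (lleg t) (apex t) (lv t)"
  and hyp_joins: "t \<in> T \<Longrightarrow> joins (hyp t) (rv t) (lv t)"
  using tile by (auto simp: triangle_tile_def)

lemma side_in_crossing: "t \<in> T \<Longrightarrow> a \<in> sides t \<Longrightarrow> joins a v w \<Longrightarrow> a \<in> crossing T v"
  by (auto simp: crossing_def joins_iff)

text \<open>In a crossing of type \<open>C8\<close> some arrow would run into the interior of the tile.\<close>

lemma apex_C4:
  assumes t: "t \<in> T"
  shows "\<exists>u. C4 (apex t) u (crossing T (apex t))"
proof (rule ccontr)
  assume "\<nexists>u. C4 (apex t) u (crossing T (apex t))"
  then obtain u where C: "C8 (apex t) u (crossing T (apex t))"
    using vertex_C4_C8[OF t, of "apex t"] by (auto simp: vertices_def)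
  define m d where "m = apex t" and "d = rv t - apex t"
  have d0: "d \<noteq> 0" using dir_nonzero t d_def by auto
  have "rleg t \<in> crossing T (apex t)" using side_in_crossing[OF t _ rleg_joins[OF t]]
    by (simp add: sides_def)
  then obtain r w where r: "r > 0" "joins (rleg t) m (m + of_real r * (w * u))"
    and w: "w \<in> {1, -1, \<i>, -\<i>, 1 + \<i>, -1 + \<i>, -1 - \<i>, 1 - \<i>}"
    using C8_direction(1)[OF C] unfolding m_def by blast
  have "joins (rleg t) m (m + d)" using rleg_joins[OF t] by (simp add: m_def d_def)
  with r d0 have dw: "d = of_real r * (w * u)" by (auto simp: joins_iff)
  \<comment> \<open>\<open>1 + \<i>\<close> turns the leg onto the bisector of the right angle. The
    factor \<open>q\<close> is 1 for \<open>w\<close> along or across the axis and 1/2 for diagonal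
    \<open>w\<close>, because a product of two diagonal directions has modulus 2.\<close>
  obtain q where q: "q > 0"
    "of_real q * ((1 + \<i>) * w) \<in> {1, -1, \<i>, -\<i>, 1 + \<i>, -1 + \<i>, -1 - \<i>, 1 - \<i>}"
  proof -
    have sq: "(1 + \<i>) * (1 + \<i>) = 2 * \<i>" "(1 + \<i>) * (-1 + \<i>) = -2"
      "(1 + \<i>) * (-1 - \<i>) = -2 * \<i>"
      "(1 + \<i>) * (1 - \<i>) = 2" "(1 + \<i>) * \<i> = -1 + \<i>" "(1 + \<i>) * -\<i> = 1 - \<i>"
        "(1 + \<i>) * -1 = -1 - \<i>"
      by (simp_all add: complex_eq_iff)
    from w have "w \<in> {1, -1, \<i>, -\<i>} \<or> w \<in> {1 + \<i>, -1 + \<i>, -1 - \<i>, 1 - \<i>}" by blast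
    then show ?thesis
    proof
      assume "w \<in> {1, -1, \<i>, -\<i>}"
      then have "of_real 1 * ((1 + \<i>) * w) \<in> {1, -1, \<i>, -\<i>, 1 + \<i>, -1 + \<i>, -1 - \<i>, 1 - \<i>}"
        by (elim insertE emptyE) (simp_all only: sq of_real_1 mult_1_left mult_1_right, simp_all)
      then show ?thesis using that[of 1] by simp
    next
      assume "w \<in> {1 + \<i>, -1 + \<i>, -1 - \<i>, 1 - \<i>}"
      then have "of_real (1/2) * ((1 + \<i>) * w) \<in> {1, -1, \<i>, -\<i>, 1 + \<i>, -1 + \<i>, -1 - \<i>, 1 - \<i>}"
        by (elim insertE emptyE) (simp_all only: sq, simp_all)
      then show ?thesis using that[of "1/2"] by simp
    qed
  qed
  then obtain e r' where e: "e \<in> crossing T m" "r' > 0"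
    "joins e m (m + of_real r' * (of_real q * ((1 + \<i>) * w) * u))"
    using C8_direction(2)[OF C] unfolding m_def by blast
  define k where "k = r' * q / r"
  have k: "k > 0" using e q r by (simp add: k_def)
  have ej: "joins e m (m + of_real k * (1 + \<i>) * d)"
  proof -
    have "of_real k * (1 + \<i>) * d = of_real r' * (of_real q * ((1 + \<i>) * w) * u)"
      using r by (simp add: dw k_def)
    then show ?thesis using e(3) by (simp only:)
  qed
  obtain t' where t': "t' \<in> T" "e \<in> sides t'" using e(1) by (auto simp: crossing_def)
  \<comment> \<open>Shrinking by \<open>h\<close> keeps the point on the arrow \<open>e\<close> and
    brings both coordinates below 1/2, that is, into the interior of \<open>t\<close>.\<close>
  define h where "h = min 1 (1 / (4 * k))"
  have h: "0 < h" "h \<le> 1" "h * k < 1/2"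
  proof -
    show "0 < h" "h \<le> 1" using k by (simp_all add: h_def)
    have "h * k \<le> 1 / (4 * k) * k" using k by (intro mult_right_mono) (simp_all add: h_def)
    then show "h * k < 1/2" using k by simp
  qed
  let ?z = "m + (of_real (h * k) * (1 + \<i>)) * d"
  have "?z \<in> interior (region t)"
    unfolding m_def d_def by (rule tile_point_in_interior[OF tile[OF t] s_pos]) (use h k in auto)
  moreover have "?z \<in> region t'"
  proof -
    have "m \<in> vertices t'" "m + of_real k * (1 + \<i>) * d \<in> vertices t'"
      using sides_endpoints[OF tile[OF t'(1)] t'(2)] ej by (auto simp: joins_iff)
    then have "closed_segment m (m + of_real k * (1 + \<i>) * d) \<subseteq> region t'"
      unfolding region_def using convex_contains_segment hull_inc convex_convex_hull by meson
    moreover have "?z \<in> closed_segment m (m + of_real k * (1 + \<i>) * d)"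
      unfolding in_segment using h
        by (intro exI[of _ h]) (auto simp: scaleR_conv_of_real algebra_simps)
    ultimately show ?thesis by blast
  qed
  \<comment> \<open>The arrow \<open>e\<close> is thus a side of \<open>t\<close> itself, but its
    far end lies on the bisector of the right angle, where \<open>t\<close> has no vertex except the
    apex.\<close>
  ultimately have "t' = t" using overlap_eq t t' by metis
  then have "m + of_real k * (1 + \<i>) * d \<in> vertices t"
    using sides_endpoints[OF tile[OF t'(1)] t'(2)] ej by (auto simp: joins_iff)
  then have "of_real k * (1 + \<i>) \<in> {0, 1, \<i>}"
    using tile_point_in_vertices[OF tile[OF t] s_pos, of "of_real k * (1 + \<i>)"]
      by (auto simp: m_def d_def)
  then show False using k by (auto simp: complex_eq_iff)
qed

lemma acute_not_C4:
  assumes "t \<in> T" "v = rv t \<or> v = lv t"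
  shows "\<not> C4 v u (crossing T v)"
proof
  assume C: "C4 v u (crossing T v)"
  note j = rleg_joins[OF assms(1)] lleg_joins[OF assms(1)] hyp_joins[OF assms(1)]
  have l: "lv t = apex t + \<i> * (rv t - apex t)" using lv_eq assms by blast
  from assms(2) show False
  proof
    assume v: "v = rv t"
    have h: "lv t = v + (1 - \<i>) * (apex t - v)" using l by (simp add: v algebra_simps)
    have 1: "joins (rleg t) v (v + (apex t - v))" using j v by (simp add: joins_commute)
    have 2: "joins (hyp t) v (v + (1 - \<i>) * (apex t - v))" using j(3) h v by simp
    show False
      using C4_no_half_right_angle[OF C _ _ 1 2] side_in_crossing[OF assms(1) _ 1]
        side_in_crossing[OF assms(1) _ 2] by (simp add: sides_def)
  next
    assume v: "v = lv t"
    have h: "rv t = v + (1 + \<i>) * (apex t - v)" unfolding v l by (simp add: algebra_simps)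
    have 1: "joins (lleg t) v (v + (apex t - v))" using j v by (simp add: joins_commute)
    have 2: "joins (hyp t) v (v + (1 + \<i>) * (apex t - v))" using j(3) h v joins_commute by simp
    show False
      using C4_no_half_right_angle[OF C _ _ 1 2] side_in_crossing[OF assms(1) _ 1]
        side_in_crossing[OF assms(1) _ 2] by (simp add: sides_def)
  qed
qed

text \<open>Apexes have type \<open>C4\<close> and acute corners do not, so no vertex of the tiling
  plays both roles. This excludes several ways in which two tiles could share a leg.\<close>

lemma apex_not_acute: "t \<in> T \<Longrightarrow> t' \<in> T \<Longrightarrow> apex t \<noteq> rv t' \<and> apex t \<noteq> lv t'"
  using apex_C4[of t] acute_not_C4[of t' "apex t"] by blast

lemma acute_C8: "t \<in> T \<Longrightarrow> v = rv t \<or> v = lv t \<Longrightarrow> \<exists>u. C8 v u (crossing T v)"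
  using vertex_C4_C8[of t v] acute_not_C4[of t v] by (auto simp: vertices_def)

text \<open>A hypotenuse with named ends fixes the apex, so different tiles on one hypotenuse must
  name its ends the other way round.\<close>

lemma shared_hyp:
  assumes "t \<in> T" "t' \<in> T" "t \<noteq> t'" "hyp t = hyp t'"
  shows "rv t' = lv t \<and> lv t' = rv t"
proof -
  have "\<not> (rv t = rv t' \<and> lv t = lv t')"
    using tile_vertices_by_hyp[OF tile[OF assms(1)] tile[OF assms(2)]] position_eq assms by blast
  then show ?thesis using hyp_joins[OF assms(1)] hyp_joins[OF assms(2)] assms(4)
    by (auto simp: joins_iff)
qed

lemma leg_not_hyp: "t \<in> T \<Longrightarrow> t' \<in> T \<Longrightarrow> rleg t \<noteq> hyp t' \<and> lleg t \<noteq> hyp t'"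
  using dist_rleg[OF tile, of t] dist_lleg[OF tile, of t] dist_hyp[OF tile, of t'] sqrt2_mult_neq[OF s_pos]
  by metis

text \<open>Lengths exclude that the shared leg is a hypotenuse of the neighbour,
  \<open>apex_not_acute\<close> that the neighbour has its apex at the other end, and
  \<open>position_eq\<close> that the leg is a right leg again. What remains is the mirror image
  across the leg.\<close>

lemma neighbour_rleg:
  assumes t: "t \<in> T"
  shows "\<exists>t'\<in>T. apex t' = apex t \<and> lv t' = rv t \<and> lleg t' = rleg t \<and> tcol t' \<noteq> tcol t"
proof -
  obtain t' where t': "t' \<in> T" "t' \<noteq> t" "rleg t \<in> sides t'"
    using neighbour[OF t, of "rleg t"] by (auto simp: sides_def)
  have c: "tcol t' \<noteq> tcol t" using color_neq[OF t'(1) t t'(2,3)] by (simp add: sides_def)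
  have n: "\<not> (apex t = apex t' \<and> rv t = rv t')" using position_eq t t' by blast
  note j = rleg_joins[OF t] rleg_joins[OF t'(1)] lleg_joins[OF t'(1)] apex_not_acute[OF t t'(1)]
  from t'(3) leg_not_hyp[OF t t'(1)] have "rleg t = rleg t' \<or> rleg t = lleg t'"
    by (auto simp: sides_def)
  then show ?thesis using t' c n j by (intro bexI[of _ t']) (auto simp: joins_iff)
qed

lemma neighbour_lleg:
  assumes t: "t \<in> T"
  shows "\<exists>t'\<in>T. apex t' = apex t \<and> rv t' = lv t \<and> rleg t' = lleg t \<and> tcol t' \<noteq> tcol t"
proof -
  obtain t' where t': "t' \<in> T" "t' \<noteq> t" "lleg t \<in> sides t'"
    using neighbour[OF t, of "lleg t"] by (auto simp: sides_def)
  have c: "tcol t' \<noteq> tcol t" using color_neq[OF t'(1) t t'(2,3)] by (simp add: sides_def)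
  have n: "\<not> (apex t = apex t' \<and> lv t = lv t')"
    using position_eq[OF t t'(1)] t'(2) lv_eq[OF t] lv_eq[OF t'(1)] by auto
  note j = lleg_joins[OF t] rleg_joins[OF t'(1)] lleg_joins[OF t'(1)] apex_not_acute[OF t t'(1)]
  from t'(3) leg_not_hyp[OF t t'(1)] have "lleg t = rleg t' \<or> lleg t = lleg t'"
    by (auto simp: sides_def)
  then show ?thesis using t' c n j by (intro bexI[of _ t']) (auto simp: joins_iff)
qed

text \<open>The two tiles form a square, whose diagonals bisect each other. Combining the equations
  for the two left vertices leaves the unknown apex with the invertible factor
  \<open>1 - \<i>\<close>.\<close>

lemma apex_across_hyp:
  assumes "t \<in> T" "t' \<in> T" "rv t' = lv t" "lv t' = rv t"
  shows "apex t' = rv t + lv t - apex t"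
proof -
  have "(1 - \<i>) * apex t' - (1 - \<i>) * (rv t + lv t - apex t) =
    - (rv t - (apex t' + \<i> * (lv t - apex t'))) - (lv t - (apex t + \<i> * (rv t - apex t)))"
    by (simp add: algebra_simps)
  also have "\<dots> = 0" using lv_eq[OF assms(1)] lv_eq[OF assms(2)] assms(3,4) by simp
  finally show ?thesis by (simp add: complex_eq_iff)
qed

lemma neighbour_hyp:
  assumes t: "t \<in> T"
  shows "\<exists>t'\<in>T. rv t' = lv t \<and> lv t' = rv t \<and> apex t' = rv t + lv t - apex t \<and> tcol t' \<noteq> tcol t"
proof -
  obtain t' where t': "t' \<in> T" "t' \<noteq> t" "hyp t \<in> sides t'"
    using neighbour[OF t, of "hyp t"] by (auto simp: sides_def)
  have c: "tcol t' \<noteq> tcol t" using color_neq[OF t'(1) t t'(2,3)] by (simp add: sides_def)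
  have "hyp t = hyp t'" using t'(3) leg_not_hyp[OF t'(1) t] by (auto simp: sides_def)
  then have "rv t' = lv t \<and> lv t' = rv t" using shared_hyp t t' by metis
  then show ?thesis using t' c apex_across_hyp[OF t t'(1)] by blast
qed

section \<open>Tiles around an apex: directions, colours and orientations of their legs\<close>

lemma rleg_dirsgn: "t \<in> T \<Longrightarrow> dirsgn (apex t) u (rleg t) = sgn_pair ((rv t - apex t) / u)"
  using rleg_joins[of t] by (intro dirsgn_joins) simp

lemma lleg_dirsgn: "t \<in> T \<Longrightarrow> dirsgn (apex t) u (lleg t) = sgn_pair (\<i> * ((rv t - apex t) / u))"
  using lleg_joins[of t] lv_eq[of t] dirsgn_joins[of "lleg t" "apex t" "\<i> * (rv t - apex t)" u]
    by simp

lemma legs_in_crossing: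
  "t \<in> T \<Longrightarrow> rleg t \<in> crossing T (apex t)"
    "t \<in> T \<Longrightarrow> lleg t \<in> crossing T (apex t)"
  "t \<in> T \<Longrightarrow> rleg t \<in> crossing T (rv t)"
    "t \<in> T \<Longrightarrow> lleg t \<in> crossing T (lv t)"
  "t \<in> T \<Longrightarrow> hyp t \<in> crossing T (rv t)"
    "t \<in> T \<Longrightarrow> hyp t \<in> crossing T (lv t)"
  using rleg_joins[of t] lleg_joins[of t] hyp_joins[of t]
  by (auto simp: crossing_def sides_def joins_iff)

lemma apex_direction:
  assumes "t \<in> T" "C4 (apex t) u (crossing T (apex t))"
  obtains r p where "r > 0" "p \<in> {1, -1, \<i>, -\<i>}" "rv t - apex t = of_real r * (p * u)"
    "r * norm u = s"
proof -
  obtain r p where r: "r > 0" and p: "p \<in> {1, -1, \<i>, -\<i>}"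
    and "joins (rleg t) (apex t) (apex t + of_real r * (p * u))"
    using C4_direction[OF assms(2) legs_in_crossing(1)[OF assms(1)]] by blast
  then have e: "rv t - apex t = of_real r * (p * u)"
    using rleg_joins[OF assms(1)] dir_nonzero[OF assms(1)] by (auto simp: joins_iff)
  have "norm p = 1" using p by auto
  then have "r * norm u = s" using norm_dir[OF tile[OF assms(1)]] r by (simp add: e norm_mult)
  then show ?thesis using that r p e by blast
qed

lemma apex_quadrants:
  assumes "t \<in> T" "t' \<in> T" "apex t' = apex t"
  shows "\<exists>q\<in>{1, -1, \<i>, -\<i>}. rv t' - apex t = q * (rv t - apex t)"
proof -
  obtain u where C: "C4 (apex t) u (crossing T (apex t))" using apex_C4 assms by blast
  obtain r p where r: "p \<in> {1, -1, \<i>, -\<i>}" "rv t - apex t = of_real r * (p * u)"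
    "r * norm u = s"
    using apex_direction[OF assms(1) C] by blast
  obtain r' p' where r': "p' \<in> {1, -1, \<i>, -\<i>}" "rv t' - apex t = of_real r' * (p' * u)"
    "r' * norm u = s"
    using apex_direction[OF assms(2)] C unfolding assms(3) by metis
  have "u \<noteq> 0" using C by (auto simp: C4_def)
  then have "r' = r" using r(3) r'(3) by (metis mult_right_cancel norm_eq_zero)
  moreover have "\<exists>q\<in>{1, -1, \<i>, -\<i>}. p' = q * p"
    using r(1) r'(1) by (elim insertE emptyE) simp_all
  ultimately show ?thesis using r(2) r'(2) by (auto simp: algebra_simps)
qed

text \<open>If the right leg lies on the axis, the left leg is one of the perpendicular arrows, so
  it enters the apex and has the tile on its left. If the right leg is perpendicular, it enters and
  has the tile on its right. The colouring rule gives red and green respectively.\<close>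

lemma apex_legs:
  assumes t: "t \<in> T" and C: "C4 (apex t) u (crossing T (apex t))"
    and r: "r > 0" "rv t - apex t = of_real r * (p * u)"
  shows "p \<in> {1, -1} \<Longrightarrow> tcol t = Red \<and> tgt (lleg t) = apex t"
    and "p \<in> {\<i>, -\<i>} \<Longrightarrow> tcol t = Green \<and> tgt (rleg t) = apex t"
proof -
  obtain k c1 c2 where u: "u \<noteq> 0" and c: "c1 \<noteq> c2" and k:
    "\<forall>a\<in>crossing T (apex t). dirsgn (apex t) u a = (-1, 0) \<longrightarrow> enters (apex t) (- u) k a"
    "\<forall>a\<in>crossing T (apex t). dirsgn (apex t) u a = (1, 0) \<longrightarrow> leaves (apex t) u k a"
    "\<forall>a\<in>crossing T (apex t). dirsgn (apex t) u a = (0, 1) \<longrightarrow> enters (apex t) (\<i> * u) c1 a"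
    "\<forall>a\<in>crossing T (apex t). dirsgn (apex t) u a = (0, -1) \<longrightarrow> enters (apex t) (- \<i> * u) c2 a"
    using C by (elim C4_values)
  then have en: "tgt a = apex t" if "a \<in> crossing T (apex t)"
    "dirsgn (apex t) u a \<in> {(0, 1), (0, -1)}" for a
    using that by (auto simp: enters_def)
  have du: "(rv t - apex t) / u = of_real r * p" using u r by simp
  have sg: "dirsgn (apex t) u (rleg t) = sgn_pair p"
    "dirsgn (apex t) u (lleg t) = sgn_pair (\<i> * p)"
    using rleg_dirsgn[OF t, of u] lleg_dirsgn[OF t, of u] sgn_pair_scale[OF r(1), of p] sgn_pair_scale[OF r(1), of "\<i> * p"]
    by (simp_all add: du mult.left_commute)
  have [simp]: "(\<i> * u) \<bullet> u = 0" by (simp add: inner_complex_def)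
  have ru: "rv t - apex t = r *\<^sub>R (p * u)" "lv t - apex t = r *\<^sub>R (\<i> * (p * u))"
    using r lv_eq[OF t] by (auto simp: scaleR_conv_of_real)
  {
    assume p: "p \<in> {1, -1}"
    then have e: "tgt (lleg t) = apex t"
      by (intro en legs_in_crossing t) (auto simp: sg sgn_pair_def)
    then have "src (lleg t) = lv t" using lleg_joins[OF t] by (auto simp: joins_iff)
    then have "(src (lleg t) - apex t) \<bullet> u = 0" using p ru by auto
    then show "tcol t = Red \<and> tgt (lleg t) = apex t"
      using C4_left_right[OF C legs_in_crossing(2)[OF t] e _ t] on_left_lleg[OF tile[OF t] e] e
        by simp
  }
  {
    assume p: "p \<in> {\<i>, -\<i>}"
    then have e: "tgt (rleg t) = apex t"
      by (intro en legs_in_crossing t) (auto simp: sg sgn_pair_def)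
    then have "src (rleg t) = rv t" using rleg_joins[OF t] by (auto simp: joins_iff)
    then have "(src (rleg t) - apex t) \<bullet> u = 0" using p ru by auto
    then show "tcol t = Green \<and> tgt (rleg t) = apex t"
      using C4_left_right[OF C legs_in_crossing(1)[OF t] e _ t] on_right_rleg[OF tile[OF t] e] e
        by simp
  }
qed

text \<open>The colour tells which leg is the future height: the left leg of a red tile, the right
  leg of a green one. It enters the apex, as it must, because that apex is to be the midpoint of the
  composed hypotenuse.\<close>

lemma red_lleg: "t \<in> T \<Longrightarrow> tcol t = Red \<Longrightarrow> tgt (lleg t) = apex t \<and> src (lleg t) = lv t"
  and green_rleg: "t \<in> T \<Longrightarrow> tcol t = Green \<Longrightarrow> tgt (rleg t) = apex t \<and> src (rleg t) = rv t"
proof -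
  assume t: "t \<in> T"
  obtain u where C: "C4 (apex t) u (crossing T (apex t))" using apex_C4 t by blast
  obtain r p where r: "r > 0" "rv t - apex t = of_real r * (p * u)"
    and p: "p \<in> {1, -1, \<i>, -\<i>}"
    using apex_direction[OF t C] by metis
  have 1: "tcol t = Red \<and> tgt (lleg t) = apex t \<or> tcol t = Green \<and> tgt (rleg t) = apex t"
    using apex_legs[OF t C r] p by blast
  show "tcol t = Red \<Longrightarrow> tgt (lleg t) = apex t \<and> src (lleg t) = lv t"
    using 1 lleg_joins[OF t] by (auto simp: joins_iff)
  show "tcol t = Green \<Longrightarrow> tgt (rleg t) = apex t \<and> src (rleg t) = rv t"
    using 1 rleg_joins[OF t] by (auto simp: joins_iff)
qed

lemma red_axis:
  assumes t: "t \<in> T" "tcol t = Red"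
  obtains u r p where "C4 (apex t) u (crossing T (apex t))" "r > 0" "p = 1 \<or> p = -1"
    "rv t - apex t = of_real r * (p * u)"
proof -
  obtain u where C: "C4 (apex t) u (crossing T (apex t))" using apex_C4 t by blast
  obtain r p where r: "r > 0" "rv t - apex t = of_real r * (p * u)"
    and p: "p \<in> {1, -1, \<i>, -\<i>}"
    using apex_direction[OF t(1) C] by metis
  have "p = 1 \<or> p = -1" using apex_legs(2)[OF t(1) C r] t(2) p by auto
  then show ?thesis using that C r by blast
qed

text \<open>\<open>rleg t\<close> and \<open>lleg t'\<close> are the two arrows of the axis. With
  one colour and one direction of travel they are the halves of a single arrow, the hypotenuse of
  the composed tile.\<close>

lemma red_axis_legs:
  assumes t: "t \<in> T" "tcol t = Red" and t': "t' \<in> T" "apex t' = apex t" "rv t' = lv t"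
  shows "acol (lleg t') = acol (rleg t)"
    and "src (rleg t) = apex t \<and> tgt (rleg t) = rv t \<and> src (lleg t') = lv t' \<and> tgt (lleg t') = apex t \<or>
         tgt (rleg t) = apex t \<and> src (rleg t) = rv t \<and> tgt (lleg t') = lv t' \<and> src (lleg t') = apex t"
proof -
  obtain u r p where C: "C4 (apex t) u (crossing T (apex t))" and r: "r > 0"
    and p: "p = 1 \<or> p = -1"
    and e: "rv t - apex t = of_real r * (p * u)" using red_axis[OF t] by blast
  obtain k c1 c2 where u: "u \<noteq> 0" and c: "c1 \<noteq> c2" and k:
    "\<forall>a\<in>crossing T (apex t). dirsgn (apex t) u a = (-1, 0) \<longrightarrow> enters (apex t) (- u) k a"
    "\<forall>a\<in>crossing T (apex t). dirsgn (apex t) u a = (1, 0) \<longrightarrow> leaves (apex t) u k a"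
    "\<forall>a\<in>crossing T (apex t). dirsgn (apex t) u a = (0, 1) \<longrightarrow> enters (apex t) (\<i> * u) c1 a"
    "\<forall>a\<in>crossing T (apex t). dirsgn (apex t) u a = (0, -1) \<longrightarrow> enters (apex t) (- \<i> * u) c2 a"
    using C by (elim C4_values)
  have du: "(rv t - apex t) / u = of_real r * p" using u e by simp
  have du': "(rv t' - apex t') / u = of_real r * (\<i> * p)"
    using t' lv_eq[OF t(1)] u e by (simp add: field_simps)
  have sg: "dirsgn (apex t) u (rleg t) = sgn_pair p"
    using rleg_dirsgn[OF t(1), of u] sgn_pair_scale[OF r(1), of p] by (simp add: du)
  have "\<i> * ((rv t' - apex t') / u) = of_real r * (- p)" unfolding du'
    by (simp add: algebra_simps)
  then have sg': "dirsgn (apex t) u (lleg t') = sgn_pair (- p)"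
    using lleg_dirsgn[OF t'(1), of u] sgn_pair_scale[OF r(1), of "-p"] t'(2) by (simp only:)
  note j = rleg_joins[OF t(1)] lleg_joins[OF t'(1)]
  note X = legs_in_crossing(1)[OF t(1)] legs_in_crossing(2)[OF t'(1), unfolded t'(2)]
  have "acol (lleg t') = acol (rleg t) \<and>
    (src (rleg t) = apex t \<and> tgt (lleg t') = apex t \<or> tgt (rleg t) = apex t \<and> src (lleg t') = apex t)"
    using p
  proof
    assume "p = 1"
    then show ?thesis using k(2)[rule_format, OF X(1)] k(1)[rule_format, OF X(2)] sg sg'
      by (auto simp: sgn_pair_def enters_def leaves_def)
  next
    assume "p = -1"
    then show ?thesis using k(1)[rule_format, OF X(1)] k(2)[rule_format, OF X(2)] sg sg'
      by (auto simp: sgn_pair_def enters_def leaves_def)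
  qed
  then show "acol (lleg t') = acol (rleg t)"
    and "src (rleg t) = apex t \<and> tgt (rleg t) = rv t \<and> src (lleg t') = lv t' \<and> tgt (lleg t') = apex t \<or>
         tgt (rleg t) = apex t \<and> src (rleg t) = rv t \<and> tgt (lleg t') = lv t' \<and> src (lleg t') = apex t"
    using j t' by (auto simp: joins_iff)
qed

text \<open>The two left legs are the perpendicular arrows of the crossing, whose colours differ.
  They are the heights of the composed tiles on both sides of a long hypotenuse, so this becomes the
  colour condition across it.\<close>

lemma opposite_height_color:
  assumes t: "t \<in> T" "tcol t = Red" and t': "t' \<in> T" "apex t' = apex t"
    "rv t' - apex t = - (rv t - apex t)"
  shows "acol (lleg t') \<noteq> acol (lleg t)"
proof -
  obtain u r p where C: "C4 (apex t) u (crossing T (apex t))" and r: "r > 0"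
    and p: "p = 1 \<or> p = -1"
    and e: "rv t - apex t = of_real r * (p * u)" using red_axis[OF t] by blast
  obtain k c1 c2 where u: "u \<noteq> 0" and c: "c1 \<noteq> c2" and k:
    "\<forall>a\<in>crossing T (apex t). dirsgn (apex t) u a = (-1, 0) \<longrightarrow> enters (apex t) (- u) k a"
    "\<forall>a\<in>crossing T (apex t). dirsgn (apex t) u a = (1, 0) \<longrightarrow> leaves (apex t) u k a"
    "\<forall>a\<in>crossing T (apex t). dirsgn (apex t) u a = (0, 1) \<longrightarrow> enters (apex t) (\<i> * u) c1 a"
    "\<forall>a\<in>crossing T (apex t). dirsgn (apex t) u a = (0, -1) \<longrightarrow> enters (apex t) (- \<i> * u) c2 a"
    using C by (elim C4_values)
  have du: "(rv t - apex t) / u = of_real r * p" using u e by simp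
  have du': "(rv t' - apex t) / u = of_real r * (- p)" using u e t'(3) by simp
  have sg: "dirsgn (apex t) u (lleg t) = sgn_pair (\<i> * p)"
    using lleg_dirsgn[OF t(1), of u] sgn_pair_scale[OF r(1), of "\<i> * p"]
      by (simp add: du mult.left_commute)
  have sg': "dirsgn (apex t) u (lleg t') = sgn_pair (\<i> * - p)"
    using lleg_dirsgn[OF t'(1), of u] sgn_pair_scale[OF r(1), of "\<i> * -p"] t'(2) du'
      by (simp add: mult.left_commute)
  note X = legs_in_crossing(2)[OF t(1)] legs_in_crossing(2)[OF t'(1), unfolded t'(2)]
  from p show ?thesis
  proof
    assume "p = 1"
    then show ?thesis using k(3)[rule_format, OF X(1)] k(4)[rule_format, OF X(2)] sg sg' c
      by (auto simp: sgn_pair_def enters_def)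
  next
    assume "p = -1"
    then show ?thesis using k(4)[rule_format, OF X(1)] k(3)[rule_format, OF X(2)] sg sg' c
      by (auto simp: sgn_pair_def enters_def)
  qed
qed

end

section \<open>The composition\<close>

text \<open>The substitution before the final scaling, so that a composed tile and its halves cover
  the same part of the plane.\<close>

definition parts :: "tile set \<Rightarrow> tile set" where
  "parts T = (\<Union>t\<in>T. {left_part t, right_part t})"

lemma half_at_inject:
  assumes "joins a x y" "joins b x y" "x \<noteq> y" "half_at x a = half_at x b"
  shows "a = b"
proof -
  have m: "midpoint x y \<noteq> x" "midpoint y x \<noteq> x" "midpoint x y \<noteq> y"
    using assms(3) by (auto simp: midpoint_eq_endpoint)
  obtain s1 t1 c1 s2 t2 c2 where ab: "a = \<lparr>src = s1, tgt = t1, acol = c1\<rparr>"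
    "b = \<lparr>src = s2, tgt = t2, acol = c2\<rparr>"
    by (meson arrow.cases)
  show ?thesis using assms m by (auto simp: ab joins_iff half_at_def split: if_splits)
qed

text \<open>In the coordinate \<open>x + \<i> * y\<close> of \<open>t\<close> the height lies on the
  line \<open>x = y\<close>, and the halves are cut out by \<open>x \<le> y\<close> and
  \<open>y \<le> x\<close>.\<close>

lemma region_left_right_part:
  assumes t: "triangle_tile r t" "r > 0" and l: "triangle_tile s (left_part t)"
    and rr: "triangle_tile s (right_part t)" "s > 0"
  shows "region t = region (left_part t) \<union> region (right_part t)"
proof -
  define e where "e = rv t - apex t"
  have e0: "e \<noteq> 0" using triangle_tile_dir_nonzero[OF t] by (simp add: e_def)
  have lv: "lv t = apex t + \<i> * e" and rv: "rv t = apex t + e"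
    using triangle_tile_rv_lv[OF t(1)] by (auto simp: e_def)
  have m: "midpoint (rv t) (lv t) = apex t + (1 + \<i>) / 2 * e"
    by (simp add: midpoint_def lv rv scaleR_conv_of_real field_simps)
  have L: "apex (left_part t) = apex t + (1 + \<i>) / 2 * e"
    "rv (left_part t) - apex (left_part t) = (\<i> - 1) / 2 * e"
    by (simp add: left_part_def m) (simp add: left_part_def m, simp add: lv field_simps)
  have R: "apex (right_part t) = apex t + (1 + \<i>) / 2 * e"
    "rv (right_part t) - apex (right_part t) = - (1 + \<i>) / 2 * e"
    by (simp add: right_part_def m) (simp add: right_part_def m, simp add: field_simps)
  have "z \<in> region t \<longleftrightarrow> z \<in> region (left_part t) \<or> z \<in> region (right_part t)" for z
  proof -
    obtain c where c: "z = apex t + c * e" using tile_coordinate[OF t] unfolding e_def by blast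
    define x y where "x = Re c" and "y = Im c"
    have cxy: "c = Complex x y" by (simp add: x_def y_def)
    \<comment> \<open>The coordinate of the same point in each half. In units of the leg vector
      \<open>e\<close>, the apex of both halves is at \<open>(1 + \<i>) / 2\<close>, and their right
      legs are \<open>(\<i> - 1) / 2\<close> and \<open>- (1 + \<i>) / 2\<close>.\<close>
    have cl: "c = (1 + \<i>) / 2 + Complex (y - x) (1 - x - y) * ((\<i> - 1) / 2)"
      by (simp add: cxy complex_eq_iff field_simps)
    have cr: "c = (1 + \<i>) / 2 + Complex (1 - x - y) (x - y) * (- (1 + \<i>) / 2)"
      by (simp add: cxy complex_eq_iff field_simps)
    have zl: "z = apex (left_part t) + Complex (y - x) (1 - x - y) * (rv (left_part t) - apex (left_part t))"
      unfolding L(2) unfolding L(1) c by (subst cl) (simp only: distrib_right add.assoc mult.assoc)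
    have zr: "z = apex (right_part t) + Complex (1 - x - y) (x - y) * (rv (right_part t) - apex (right_part t))"
      unfolding R(2) unfolding R(1) c by (subst cr) (simp only: distrib_right add.assoc mult.assoc)
    have "z \<in> region t \<longleftrightarrow> 0 \<le> x \<and> 0 \<le> y \<and> x + y \<le> 1"
      unfolding c e_def tile_point_in_region[OF t] by (simp add: x_def y_def)
    moreover have "z \<in> region (left_part t) \<longleftrightarrow> 0 \<le> x \<and> x \<le> y \<and> x + y \<le> 1"
      by (subst zl, subst tile_point_in_region[OF l rr(2)]) auto
    moreover have "z \<in> region (right_part t) \<longleftrightarrow> 0 \<le> y \<and> y \<le> x \<and> x + y \<le> 1"
      by (subst zr, subst tile_point_in_region[OF rr]) auto
    ultimately show ?thesis by auto
  qed
  then show ?thesis by blast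
qed

text \<open>Halving loses no field: the legs are the hypotenuses of the halves, the colour is that
  of the height, and a half of the hypotenuse determines the whole once its ends are known.\<close>

lemma tile_eqI_parts:
  assumes t: "triangle_tile r t" "r > 0" and t': "triangle_tile r' t'"
    and "left_part t = left_part t'" "right_part t = right_part t'"
  shows "t = t'"
proof -
  have e: "apex t = apex t'" "lv t = lv t'" "rv t = rv t'" "lleg t = lleg t'" "rleg t = rleg t'"
    "height t = height t'" "half_at (lv t) (hyp t) = half_at (lv t') (hyp t')"
    using arg_cong[OF assms(4), of lv] arg_cong[OF assms(4), of rv] arg_cong[OF assms(5), of lv]
      arg_cong[OF assms(4), of hyp] arg_cong[OF assms(5), of hyp] arg_cong[OF assms(4), of lleg]
      arg_cong[OF assms(4), of rleg]
    unfolding left_part_def right_part_def tile.simps .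
  have "lv t \<noteq> rv t" using triangle_tile_rv_lv(2)[OF t(1)] triangle_tile_dir_nonzero[OF t]
    by (auto simp: complex_eq_iff)
  then have "hyp t = hyp t'"
    using half_at_inject[of "hyp t" "lv t" "rv t" "hyp t'"] t(1) t' e
    by (auto simp: triangle_tile_def joins_def insert_commute)
  moreover have "tcol t = tcol t'" using e(6) by (simp add: height_def)
  ultimately show ?thesis using e by simp
qed

context triangle_tiling
begin

text \<open>Left halves are red and right halves green, so a common half plays the same role in both
  tiles. It fixes the position of the other half, and in a tiling position fixes the tile.\<close>

lemma shared_part_eq:
  assumes "triangle_tile r t" "r > 0" "triangle_tile r t'"
    and T: "left_part t \<in> T" "right_part t \<in> T" "left_part t' \<in> T"
      "right_part t' \<in> T"
    and X: "X \<in> {left_part t, right_part t}" "X \<in> {left_part t', right_part t'}"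
  shows "t = t'"
proof -
  have c: "tcol (left_part u) = Red" "tcol (right_part u) = Green" for u
    by (simp_all add: left_part_def right_part_def)
  have "left_part t = left_part t' \<or> right_part t = right_part t'"
    using X c[of t] c[of t'] by auto
  moreover have "right_part t = right_part t'" if "left_part t = left_part t'"
  proof (rule position_eq[OF T(2,4)])
    show "apex (right_part t) = apex (right_part t')" "rv (right_part t) = rv (right_part t')"
      using arg_cong[OF that, of apex] arg_cong[OF that, of lv]
      unfolding left_part_def right_part_def tile.simps .
  qed
  moreover have "left_part t = left_part t'" if e: "right_part t = right_part t'"
  proof (rule position_eq[OF T(1,3)])
    show a: "apex (left_part t) = apex (left_part t')"
      using arg_cong[OF that, of apex] unfolding left_part_def right_part_def tile.simps .
    have "rv t = rv t'" "apex t = apex t'"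
      using arg_cong[OF e, of lv] arg_cong[OF e, of rv] unfolding right_part_def tile.simps .
    then show "rv (left_part t) = rv (left_part t')"
      using triangle_tile_rv_lv(2)[OF assms(1)] triangle_tile_rv_lv(2)[OF assms(3)]
      by (simp add: left_part_def)
  qed
  ultimately have "left_part t = left_part t'" "right_part t = right_part t'" by blast+
  then show ?thesis using tile_eqI_parts assms by blast
qed

end

context correct_triangle_tiling
begin

lemma red_composable:
  assumes t: "t \<in> T" "tcol t = Red"
  shows "\<exists>t1. triangle_tile (sqrt 2 * s) t1 \<and> left_part t1 = t \<and> right_part t1 \<in> T"
proof -
  obtain t' where t': "t' \<in> T" "apex t' = apex t" "rv t' = lv t" "rleg t' = lleg t"
    "tcol t' \<noteq> tcol t"
    using neighbour_lleg[OF t(1)] by blast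
  have g: "tcol t' = Green" using t'(5) t(2) by (cases "tcol t'") auto
  define d where "d = rv t - apex t"
  have d: "d \<noteq> 0" using dir_nonzero[OF t(1)] by (simp add: d_def)
  have v: "rv t = apex t + d" "lv t = apex t + \<i> * d" using lv_eq[OF t(1)] by (auto simp: d_def)
  have v': "rv t' = apex t + \<i> * d" "lv t' = apex t - d" using t'(2,3) v lv_eq[OF t'(1)] by auto
  note ax = red_axis_legs[OF t t'(1-3)] red_lleg[OF t]
  \<comment> \<open>The two arrows of the axis joined into one, oriented like
    \<open>rleg t\<close>.\<close>
  define h where "h = (if src (rleg t) = apex t then \<lparr>src = lv t', tgt = rv t, acol = acol (rleg t)\<rparr>
    else \<lparr>src = rv t, tgt = lv t', acol = acol (rleg t)\<rparr>)"
  \<comment> \<open>The height runs from \<open>lv t\<close> to the apex of \<open>t\<close>, so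
    \<open>lv t\<close> is the new right angle. The new tile takes its colour from this height, and
    its legs are the old hypotenuses.\<close>
  define t1 where "t1 = \<lparr>apex = lv t, rv = lv t', lv = rv t, tcol = acol (lleg t),
    rleg = hyp t', lleg = hyp t, hyp = h\<rparr>"
  have m: "midpoint (lv t') (rv t) = apex t" "midpoint (rv t) (lv t') = apex t"
    by (simp_all add: midpoint_def v v' scaleR_conv_of_real)
  have ne: "rv t \<noteq> lv t'" "rv t \<noteq> apex t" "lv t' \<noteq> apex t" using d
    by (auto simp: v v' complex_eq_iff)
  have H: "height t1 = lleg t" using ax(3) by (simp add: height_def t1_def m)
  have h1: "half_at (rv t) h = rleg t"
    using ax(2) ne m by (auto simp: h_def half_at_def)
  have h2: "half_at (lv t') h = lleg t'"
    using ax(1,2) ne m by (auto simp: h_def half_at_def)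
  have "left_part t1 = t"
    using H h1 t(2) m by (auto simp: left_part_def t1_def)
  moreover have "right_part t1 = t'"
    using H h2 g m t' by (auto simp: right_part_def t1_def)
  moreover have "triangle_tile (sqrt 2 * s) t1"
  proof -
    have "dist (rv t') (lv t') = sqrt 2 * s"
      using dist_hyp[OF tile[OF t'(1)]] hyp_joins[OF t'(1)] by (auto simp: joins_iff dist_commute)
    moreover have "joins (hyp t) (lv t) (rv t)" using hyp_joins[OF t(1)] by (auto simp: joins_iff)
    moreover have "joins h (lv t') (rv t)" by (simp add: h_def joins_iff)
    ultimately show ?thesis using hyp_joins[OF t'(1)] t'(3)
      by (simp add: triangle_tile_def t1_def v v' algebra_simps)
  qed
  ultimately show ?thesis using t' by blast
qed

lemma composable:
  assumes t: "t \<in> T"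
  shows "\<exists>t1. triangle_tile (sqrt 2 * s) t1 \<and> left_part t1 \<in> T \<and> right_part t1 \<in> T \<and>
    t \<in> {left_part t1, right_part t1}"
proof (cases "tcol t")
  case Red
  then show ?thesis using red_composable[OF t] t by blast
next
  case Green
  obtain t' where t': "t' \<in> T" "apex t' = apex t" "lv t' = rv t" "tcol t' \<noteq> tcol t"
    using neighbour_rleg[OF t] by blast
  have "tcol t' = Red" using t'(4) Green by (cases "tcol t'") auto
  then obtain t1 where t1: "triangle_tile (sqrt 2 * s) t1" "left_part t1 = t'"
    "right_part t1 \<in> T"
    using red_composable t' by blast
  have "right_part t1 = t"
  proof (rule position_eq[OF t1(3) t])
    show "apex (right_part t1) = apex t" "rv (right_part t1) = rv t"
      using t1(2) t' by (auto simp: left_part_def right_part_def)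
  qed
  then show ?thesis using t1 t' t by blast
qed

text \<open>All tiles of the right size with both halves present are taken, so that no partner has
  to be chosen for a tile of \<open>T\<close>.\<close>

definition composition :: "tile set" where
  "composition = {t. triangle_tile (sqrt 2 * s) t \<and> left_part t \<in> T \<and> right_part t \<in> T}"

lemma parts_composition: "parts composition = T"
proof
  show "parts composition \<subseteq> T" by (auto simp: parts_def composition_def)
  show "T \<subseteq> parts composition"
  proof
    fix t assume "t \<in> T"
    from composable[OF this] show "t \<in> parts composition"
      by (auto simp: parts_def composition_def)
  qed
qed

lemma tiling_composition: "tiling composition"
proof -
  have s2: "sqrt 2 * s > 0" using s_pos by simp
  have reg: "region t = region (left_part t) \<union> region (right_part t)"
    if "t \<in> composition" for t
    using that region_left_right_part[OF _ s2 tile tile s_pos] by (auto simp: composition_def)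
  have "(\<Union>t\<in>composition. region t) = (\<Union>t\<in>parts composition. region t)"
    using reg by (auto simp: parts_def)
  also have "\<dots> = UNIV" using tiling by (simp add: parts_composition tiling_def)
  finally have cov: "(\<Union>t\<in>composition. region t) = UNIV" .
  have "t = t'" if t: "t \<in> composition" "t' \<in> composition"
    "interior (region t) \<inter> interior (region t') \<noteq> {}" for t t'
  proof -
    let ?W = "interior (region t) \<inter> interior (region t')"
    have T: "left_part t \<in> T" "right_part t \<in> T" "left_part t' \<in> T"
      "right_part t' \<in> T"
      using t by (auto simp: composition_def)
    obtain z where z: "z \<in> ?W" using t by blast
    then have "z \<in> region t" using interior_subset by blast
    then obtain X where X: "X \<in> {left_part t, right_part t}" "z \<in> region X"
      using reg[OF t(1)] by auto
    then have XT: "X \<in> T" using T by auto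
    \<comment> \<open>\<open>z\<close> may lie on the boundary of the half \<open>X\<close>, so it
      is replaced by a point of the open overlap that is interior to \<open>X\<close>; to this point
      \<open>overlap_eq\<close> applies.\<close>
    obtain w where w: "w \<in> ?W" "w \<in> interior (region X)"
      using open_meets_interior_region[OF tile[OF XT] s_pos _ z X(2)] by (auto simp: open_Int)
    then have "w \<in> region t'" using interior_subset by blast
    then obtain X' where X': "X' \<in> {left_part t', right_part t'}" "w \<in> region X'"
      using reg[OF t(2)] by auto
    then have "X' \<in> T" using T by auto
    then have "X = X'" using overlap_eq XT w X' by blast
    then show ?thesis using shared_part_eq[OF _ s2 _ T] X X' t by (auto simp: composition_def)
  qed
  then show ?thesis using cov s2 unfolding tiling_def composition_def by blast
qed

end

section \<open>Size and uniqueness of the composed tiling\<close>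

lemma tiling_obtain_size:
  assumes "tiling T"
  obtains s where "triangle_tiling T s"
proof -
  have "\<exists>s>0. \<forall>t\<in>T. triangle_tile s t" using assms by (simp add: tiling_def)
  then obtain s where "s > 0" "\<forall>t\<in>T. triangle_tile s t" by blast
  then show ?thesis using that[of s] assms by (simp add: triangle_tiling_def)
qed

lemma tile_of_parts:
  assumes "triangle_tiling (parts T) s" "tiling T" "t \<in> T"
  shows "triangle_tile (sqrt 2 * s) t"
proof -
  interpret triangle_tiling "parts T" s by fact
  obtain r where "triangle_tiling T r" using tiling_obtain_size assms(2) by blast
  then have r: "triangle_tile r t" using assms(3) by (rule triangle_tiling.tile)
  have "left_part t \<in> parts T" using assms(3) by (auto simp: parts_def)
  from dist_hyp[OF tile[OF this]] have "r = sqrt 2 * s" using dist_lleg[OF r]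
    by (simp add: left_part_def)
  then show ?thesis using r by simp
qed

text \<open>Each tile of \<open>T\<close> shares a half with some tile of \<open>T'\<close> and
  therefore equals it. Used in both directions, this yields uniqueness of the composition.\<close>

lemma parts_inject:
  assumes "tiling (parts T)" "tiling T" "tiling T'" "parts T = parts T'"
  shows "T \<subseteq> T'"
proof
  fix t assume t: "t \<in> T"
  obtain s where s: "triangle_tiling (parts T) s" using tiling_obtain_size assms(1) by blast
  interpret triangle_tiling "parts T" s by fact
  have "left_part t \<in> parts T'" using t assms(4) by (auto simp: parts_def)
  then obtain t' where t': "t' \<in> T'"
    "left_part t = left_part t' \<or> left_part t = right_part t'" by (auto simp: parts_def)
  have "t = t'"
  proof (rule shared_part_eq[of "sqrt 2 * s" _ _ "left_part t"])
    show "triangle_tile (sqrt 2 * s) t" "triangle_tile (sqrt 2 * s) t'" 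
      using tile_of_parts[OF s assms(2) t] tile_of_parts[OF s[unfolded assms(4)] assms(3) t'(1)] .
    show "sqrt 2 * s > 0" using s_pos by simp
    show "left_part t \<in> parts T" "right_part t \<in> parts T" using t by (auto simp: parts_def)
    show "left_part t' \<in> parts T" "right_part t' \<in> parts T" using t' assms(4)
      by (auto simp: parts_def)
  qed (use t' in auto)
  then show "t \<in> T'" using t' by simp
qed

section \<open>Acute corners\<close>

context correct_triangle_tiling
begin

text \<open>Crossing the hypotenuse and then a leg turns the tile clockwise by a right angle about
  its corner \<open>rv p\<close>. Each crossing changes the colour, so two restore it.\<close>

lemma corner_rotate:
  assumes p: "p \<in> T"
  shows "\<exists>p'\<in>T. rv p' = rv p \<and> apex p' - rv p = - \<i> * (apex p - rv p) \<and> tcol p' = tcol p"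
proof -
  obtain q where q: "q \<in> T" "lv q = rv p" "apex q = rv p + lv p - apex p"
    "tcol q \<noteq> tcol p"
    using neighbour_hyp[OF p] by blast
  obtain p' where p': "p' \<in> T" "apex p' = apex q" "rv p' = lv q" "tcol p' \<noteq> tcol q"
    using neighbour_lleg[OF q(1)] by blast
  have "apex p' - rv p = - \<i> * (apex p - rv p)"
    using lv_eq[OF p] by (simp add: p' q algebra_simps)
  moreover have "tcol p' = tcol p" using color_neq_trans p'(4) q(4) by blast
  ultimately show ?thesis using p' q by (intro bexI[of _ p']) simp_all
qed

lemma corner_rotations:
  assumes p: "p \<in> T"
  shows "\<exists>p'\<in>T. rv p' = rv p \<and> apex p' - rv p = (- \<i>) ^ k * (apex p - rv p) \<and> tcol p' = tcol p"
proof (induction k)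
  case 0
  then show ?case using p by (intro bexI[of _ p]) simp_all
next
  case (Suc k)
  then obtain p' where p': "p' \<in> T" "rv p' = rv p"
    "apex p' - rv p = (- \<i>) ^ k * (apex p - rv p)" "tcol p' = tcol p"
    by blast
  obtain q where "q \<in> T" "rv q = rv p'" "apex q - rv p' = - \<i> * (apex p' - rv p')"
    "tcol q = tcol p'"
    using corner_rotate[OF p'(1)] by blast
  then show ?case using p' by (intro bexI[of _ q]) (simp_all add: mult.assoc)
qed

lemma corner_dirsgn:
  assumes p: "p \<in> T"
  shows "dirsgn (rv p) u (rleg p) = sgn_pair ((apex p - rv p) / u)"
    and "dirsgn (rv p) u (hyp p) = sgn_pair ((1 - \<i>) * ((apex p - rv p) / u))"
proof -
  have "joins (rleg p) (rv p) (rv p + (apex p - rv p))" using rleg_joins[OF p]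
    by (simp add: joins_commute)
  then show "dirsgn (rv p) u (rleg p) = sgn_pair ((apex p - rv p) / u)" by (rule dirsgn_joins)
  have "lv p = rv p + (1 - \<i>) * (apex p - rv p)" using lv_eq[OF p] by (simp add: algebra_simps)
  then have "joins (hyp p) (rv p) (rv p + (1 - \<i>) * (apex p - rv p))" using hyp_joins[OF p]
    by simp
  from dirsgn_joins[OF this] show "dirsgn (rv p) u (hyp p) = sgn_pair ((1 - \<i>) * ((apex p - rv p) / u))" by simp
qed

text \<open>Going around an acute corner, a rotation by a right angle crosses a hypotenuse
  and a leg, so it
  keeps the colour; this reduces the eight possible leg directions to two.\<close>

lemma corner_normalize:
  assumes p: "p \<in> T" and C: "C8 (rv p) u (crossing T (rv p))"
  shows "\<exists>p'\<in>T. \<exists>r>0. rv p' = rv p \<and> tcol p' = tcol p \<and>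
    (apex p' - rv p = of_real r * u \<or> apex p' - rv p = of_real r * ((1 + \<i>) * u))"
proof -
  obtain r w where r: "r > 0"
    and w: "w \<in> {1, -1, \<i>, -\<i>, 1 + \<i>, -1 + \<i>, -1 - \<i>, 1 - \<i>}"
    and j: "joins (rleg p) (rv p) (rv p + of_real r * (w * u))"
    using C8_direction(1)[OF C legs_in_crossing(3)[OF p]] by blast
  have e: "apex p - rv p = of_real r * (w * u)"
    using j rleg_joins[OF p] dir_nonzero[OF p] by (auto simp: joins_iff)
  have m: "(-\<i>) ^ 0 = 1" "(-\<i>) ^ 1 = -\<i>" "(-\<i>) ^ 2 = -1" "(-\<i>) ^ 3 = \<i>"
    by (simp_all add: eval_nat_numeral)
  \<comment> \<open>Quarter turns permute the four directions along and across the axis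
    transitively, and likewise the four diagonals; 1 and \<open>1 + \<i>\<close> represent the two
    orbits.\<close>
  have "\<exists>k. (-\<i>) ^ k * w = 1 \<or> (-\<i>) ^ k * w = 1 + \<i>"
  proof -
    have "\<exists>k\<in>{0, 1, 2, 3}. (-\<i>) ^ k * w = 1 \<or> (-\<i>) ^ k * w = 1 + \<i>"
      using w by (elim insertE emptyE; simp only: m bex_simps insert_iff empty_iff; simp add: complex_eq_iff)
    then show ?thesis by blast
  qed
  then obtain k where k: "(-\<i>) ^ k * w = 1 \<or> (-\<i>) ^ k * w = 1 + \<i>" by blast
  obtain p' where p': "p' \<in> T" "rv p' = rv p" "apex p' - rv p = (- \<i>) ^ k * (apex p - rv p)"
    "tcol p' = tcol p"
    using corner_rotations[OF p] by blast
  have "apex p' - rv p = of_real r * (((-\<i>) ^ k * w) * u)" unfolding p'(3) e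
    by (simp add: mult_ac)
  then have "apex p' - rv p = of_real r * u \<or> apex p' - rv p = of_real r * ((1 + \<i>) * u)"
    using k by auto
  then show ?thesis using p' r by blast
qed

text \<open>After rotation each tile has its leg along \<open>u\<close> or along
  \<open>(1 + \<i>) * u\<close>. With the same direction the tiles coincide, and the mixed case is
  impossible. So the colour of the tiles with right corner \<open>v\<close> depends on
  \<open>v\<close> only: green will mark the apexes of the composed tiling, red its acute
  vertices.\<close>

lemma corner_color:
  assumes p: "p \<in> T" and q: "q \<in> T" "rv q = rv p"
  shows "tcol q = tcol p"
proof -
  obtain u where C: "C8 (rv p) u (crossing T (rv p))" using acute_C8 p by blast
  then have u: "u \<noteq> 0" by (auto simp: C8_def)
  obtain p1 r1 where p1: "p1 \<in> T" "r1 > 0" "rv p1 = rv p" "tcol p1 = tcol p"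
    "apex p1 - rv p = of_real r1 * u \<or> apex p1 - rv p = of_real r1 * ((1 + \<i>) * u)"
    using corner_normalize[OF p C] by blast
  obtain q1 r2 where q1: "q1 \<in> T" "r2 > 0" "rv q1 = rv p" "tcol q1 = tcol q"
    "apex q1 - rv p = of_real r2 * u \<or> apex q1 - rv p = of_real r2 * ((1 + \<i>) * u)"
    using corner_normalize[OF q(1), unfolded q(2), OF C] by blast
  \<comment> \<open>Three clockwise quarter turns move the leg of \<open>x\<close> from
    \<open>u\<close> to \<open>\<i> * u\<close>, and its hypotenuse, 45 degrees clockwise from the
    leg, to \<open>(1 + \<i>) * u\<close>. There it would coincide with the leg of \<open>y\<close>,
    which is shorter.\<close>
  have mixed: False if x: "x \<in> T" "rv x = rv p" "apex x - rv p = of_real a * u" "a > 0"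
    and y: "y \<in> T" "rv y = rv p" "apex y - rv p = of_real b * ((1 + \<i>) * u)" "b > 0"
      for x y a b
  proof -
    obtain x' where x': "x' \<in> T" "rv x' = rv p"
      "apex x' - rv p = (- \<i>) ^ 3 * (apex x - rv p)"
      using corner_rotations[OF x(1), of 3] x(2) by auto
    have "(1 - \<i>) * ((apex x' - rv x') / u) = of_real a * (1 + \<i>)"
      unfolding x'(2) x'(3) x(3) using u by (simp add: eval_nat_numeral algebra_simps)
    then have "dirsgn (rv p) u (hyp x') = sgn_pair (1 + \<i>)"
      using corner_dirsgn(2)[OF x'(1), of u] sgn_pair_scale[OF x(4)] x'(2) by simp
    moreover have "(apex y - rv y) / u = of_real b * (1 + \<i>)" unfolding y(2) y(3) using u by simp
    then have "dirsgn (rv p) u (rleg y) = sgn_pair (1 + \<i>)"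
      using corner_dirsgn(1)[OF y(1), of u] sgn_pair_scale[OF y(4)] y(2) by simp
    ultimately have "rleg y = hyp x'"
      using C8_arrow_unique[OF C] legs_in_crossing(3)[OF y(1)] legs_in_crossing(5)[OF x'(1)] x'(2) y(2) by simp
    then show False using leg_not_hyp[OF y(1) x'(1)] by blast
  qed
  have n: "norm (apex p1 - rv p) = norm (apex q1 - rv p)"
    using norm_dir[OF tile[OF p1(1)]] norm_dir[OF tile[OF q1(1)]] p1(3) q1(3)
      by (simp add: norm_minus_commute)
  have "apex q1 = apex p1"
    using p1(5)
  proof
    assume a: "apex p1 - rv p = of_real r1 * u"
    have b: "apex q1 - rv p = of_real r2 * u" using q1(5) mixed[OF p1(1,3) a p1(2) q1(1,3) _ q1(2)]
      by blast
    have "r1 = r2" using n p1(2) q1(2) u unfolding a b by (simp add: norm_mult)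
    then show ?thesis using a b by (metis diff_add_cancel)
  next
    assume a: "apex p1 - rv p = of_real r1 * ((1 + \<i>) * u)"
    have b: "apex q1 - rv p = of_real r2 * ((1 + \<i>) * u)"
      using q1(5) mixed[OF q1(1,3) _ q1(2) p1(1,3) a p1(2)] by blast
    have "norm (1 + \<i>) \<noteq> 0" by (simp add: complex_eq_iff)
    then have "r1 = r2" using n p1(2) q1(2) u unfolding a b by (simp add: norm_mult)
    then show ?thesis using a b by (metis diff_add_cancel)
  qed
  then have "q1 = p1" using position_eq q1 p1 by auto
  then show ?thesis using p1(4) q1(4) by simp
qed

lemma opposite_corner:
  assumes "q \<in> T"
  shows "\<exists>p\<in>T. rv p = lv q \<and> tcol p \<noteq> tcol q"
  using neighbour_lleg[OF assms] by blast

text \<open>At the corner \<open>rv p\<close> of a green tile all legs are heights of composed tiles, hence leave the vertex. Since the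
  perpendicular arrows enter, the legs are the diagonal arrows of the crossing.\<close>

lemma green_corner_long:
  assumes p: "p \<in> T" "tcol p = Green" and C: "C8 (rv p) u (crossing T (rv p))"
    and a: "a \<in> crossing T (rv p)"
  shows "dirsgn (rv p) u a \<in> {(1, 0), (-1, 0), (0, 1), (0, -1)} \<longleftrightarrow> dist (src a) (tgt a) = sqrt 2 * s"
proof -
  define v where "v = rv p"
  have u: "u \<noteq> 0" using C by (auto simp: C8_def)
  obtain p1 r where p1: "p1 \<in> T" "r > 0" "rv p1 = v" "tcol p1 = Green"
    "apex p1 - v = of_real r * u \<or> apex p1 - v = of_real r * ((1 + \<i>) * u)"
    using corner_normalize[OF p(1) C] p(2) unfolding v_def by auto
  have m: "(-\<i>) ^ 0 = 1" "(-\<i>) ^ 1 = -\<i>" "(-\<i>) ^ 2 = -1" "(-\<i>) ^ 3 = \<i>"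
    by (simp_all add: eval_nat_numeral)
  have "apex p1 - v \<noteq> of_real r * u"
  proof
    assume e: "apex p1 - v = of_real r * u"
    obtain x where x: "x \<in> T" "rv x = v" "apex x - v = (- \<i>) ^ 3 * (apex p1 - v)"
      "tcol x = Green"
      using corner_rotations[OF p1(1), of 3] p1(3,4) by auto
    have "(apex x - rv x) / u = of_real r * \<i>" unfolding x(2) x(3) m e using u by simp
    then have d: "dirsgn v u (rleg x) = (0, 1)"
      using corner_dirsgn(1)[OF x(1), of u] sgn_pair_scale[OF p1(2), of \<i>] x(2)
        by (simp add: sgn_pair_def)
    have X: "rleg x \<in> crossing T v" using legs_in_crossing(3)[OF x(1)] x(2) by simp
    have "tgt (rleg x) = v" using C[folded v_def]
    proof (rule C8_values)
      fix c1 assume "\<forall>a\<in>crossing T v. dirsgn v u a = (0, 1) \<longrightarrow> enters v (\<i> * u) c1 a"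
      then have "enters v (\<i> * u) c1 (rleg x)" using d X by blast
      then show ?thesis by (simp add: enters_def)
    qed
    then show False using green_rleg[OF x(1,4)] dir_nonzero[OF x(1)] x(2) by simp
  qed
  then have e: "apex p1 - v = of_real r * ((1 + \<i>) * u)" using p1(5) by blast
  \<comment> \<open>The four rotated tiles have their legs on the diagonals and their hypotenuses
    along and across the axis; together they account for all eight directions of the
    crossing.\<close>
  have rot: "\<exists>x\<in>T. rv x = v \<and> dirsgn v u (rleg x) = sgn_pair ((-\<i>) ^ k * (1 + \<i>)) \<and> dirsgn v u (hyp x) = sgn_pair ((-\<i>) ^ k)" for k
  proof -
    obtain x where x: "x \<in> T" "rv x = v" "apex x - v = (- \<i>) ^ k * (apex p1 - v)"
      using corner_rotations[OF p1(1), of k] p1(3) by auto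
    have 1: "(apex x - rv x) / u = of_real r * ((-\<i>) ^ k * (1 + \<i>))" unfolding x(2) x(3) e
      using u by simp
    have "(1 - \<i>) * (1 + \<i>) = 2" by (simp add: complex_eq_iff)
    moreover have "(1 - \<i>) * ((apex x - rv x) / u) = ((1 - \<i>) * (1 + \<i>)) * (of_real r * (-\<i>) ^ k)"
      unfolding 1 by (simp only: mult_ac)
    ultimately have "(1 - \<i>) * ((apex x - rv x) / u) = of_real (2 * r) * (-\<i>) ^ k"
      by (simp only: of_real_mult of_real_numeral mult.assoc)
    then have "dirsgn v u (hyp x) = sgn_pair ((-\<i>) ^ k)"
      using corner_dirsgn(2)[OF x(1), of u] sgn_pair_scale[of "2 * r" "(-\<i>) ^ k"] p1(2) x(2)
        by simp
    moreover have "dirsgn v u (rleg x) = sgn_pair ((-\<i>) ^ k * (1 + \<i>))"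
      using corner_dirsgn(1)[OF x(1), of u] sgn_pair_scale[OF p1(2)] x(2) 1 by simp
    ultimately show ?thesis using x by blast
  qed
  have a': "a \<in> crossing T v" using a by (simp add: v_def)
  have long: "dist (src a) (tgt a) = sqrt 2 * s" if "dirsgn v u a = sgn_pair ((-\<i>) ^ k)" for k
  proof -
    obtain x where x: "x \<in> T" "rv x = v" "dirsgn v u (hyp x) = sgn_pair ((-\<i>) ^ k)" using rot
      by blast
    have "a = hyp x"
      using C8_arrow_unique[OF C[folded v_def] a'] legs_in_crossing(5)[OF x(1)] x that by simp
    then show ?thesis using dist_hyp[OF tile[OF x(1)]] by simp
  qed
  have short: "dist (src a) (tgt a) = s" if "dirsgn v u a = sgn_pair ((-\<i>) ^ k * (1 + \<i>))"
    for k
  proof -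
    obtain x where x: "x \<in> T" "rv x = v"
      "dirsgn v u (rleg x) = sgn_pair ((-\<i>) ^ k * (1 + \<i>))" using rot by blast
    have "a = rleg x"
      using C8_arrow_unique[OF C[folded v_def] a'] legs_in_crossing(3)[OF x(1)] x that by simp
    then show ?thesis using dist_rleg[OF tile[OF x(1)]] by simp
  qed
  have "dirsgn v u a \<in> {(1, 0), (-1, 0), (0, 1), (0, -1), (1, 1), (-1, 1), (-1, -1), (1, -1)}"
    using C[folded v_def]
  proof (rule C8E)
    fix a1 a2 b1 b2 d1 d2 d3 d4
    assume "crossing T v = {a1, a2, b1, b2, d1, d2, d3, d4}" "dirsgn v u a1 = (-1, 0)"
      "dirsgn v u a2 = (1, 0)"
    "dirsgn v u b1 = (0, 1)" "dirsgn v u b2 = (0, -1)"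
    "dirsgn v u d1 = (1, 1)" "dirsgn v u d2 = (-1, 1)"
    "dirsgn v u d3 = (-1, -1)" "dirsgn v u d4 = (1, -1)"
    then show ?thesis using a' by auto
  qed
  then consider "dirsgn v u a \<in> {(1, 0), (-1, 0), (0, 1), (0, -1)}" | "dirsgn v u a \<in> {(1, 1), (-1, 1), (-1, -1), (1, -1)}"
    by auto
  then show ?thesis
  proof cases
    case 1
    then have "dist (src a) (tgt a) = sqrt 2 * s"
      using long[of 0] long[of 1] long[of 2] long[of 3] unfolding m by (auto simp: sgn_pair_def)
    then show ?thesis using 1 by (simp add: v_def)
  next
    case 2
    then have "dist (src a) (tgt a) = s"
      using short[of 0] short[of 1] short[of 2] short[of 3] unfolding m by (auto simp: sgn_pair_def)
    then show ?thesis using 2 sqrt2_mult_neq[OF s_pos] by (auto simp: v_def)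
  qed
qed

end

section \<open>Crossings of the composition\<close>

text \<open>Doubles an arrow away from its end \<open>v\<close>, undoing
  \<open>half_at v\<close>.\<close>

definition stretch :: "complex \<Rightarrow> arrow \<Rightarrow> arrow" where
  "stretch v a = (if src a = v then a\<lparr>tgt := 2 * tgt a - v\<rparr> else a\<lparr>src := 2 * src a - v\<rparr>)"

lemma stretch_half_at:
  assumes "joins a v y" "v \<noteq> y"
  shows "stretch v (half_at v a) = a"
proof -
  have m: "midpoint y v \<noteq> v" using assms(2) by (auto simp: midpoint_eq_endpoint)
  have e: "2 * midpoint v y - v = y" "2 * midpoint y v - v = y"
    by (simp_all add: midpoint_def scaleR_conv_of_real algebra_simps)
  show ?thesis using assms m e by (cases a) (auto simp: joins_iff half_at_def stretch_def)
qed

lemma enters_stretch: "enters v d c a \<Longrightarrow> d \<noteq> 0 \<Longrightarrow> enters v d c (stretch v a)"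
proof -
  assume a: "enters v d c a" "d \<noteq> 0"
  then obtain r where r: "r > 0" "src a = v + of_real r * d" by (auto simp: enters_def)
  have "2 * src a - v = v + of_real (2 * r) * d" by (simp add: r)
  moreover have "src a \<noteq> v" using r a by simp
  ultimately show ?thesis using a r by (auto simp: enters_def stretch_def intro!: exI[of _ "2 * r"])
qed

lemma leaves_stretch: "leaves v d c a \<Longrightarrow> leaves v d c (stretch v a)"
proof -
  assume a: "leaves v d c a"
  then obtain r where r: "r > 0" "tgt a = v + of_real r * d" by (auto simp: leaves_def)
  have "2 * tgt a - v = v + of_real (2 * r) * d" by (simp add: r)
  then show ?thesis using a r by (auto simp: leaves_def stretch_def intro!: exI[of _ "2 * r"])
qed

text \<open>Type \<open>C8\<close> sees only directions, orientations and colours, all of which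
  survive doubling; \<open>f\<close> may decide for each arrow separately whether to double
  it.\<close>

lemma C8_stretch:
  assumes "C8 v u X" and f: "\<And>a. f a = a \<or> f a = stretch v a"
  shows "C8 v u (f ` X)"
proof -
  obtain a1 a2 b1 b2 d1 d2 d3 d4 k c1 c2 where *: "u \<noteq> 0"
    "X = {a1, a2, b1, b2, d1, d2, d3, d4}"
    "enters v (- u) k a1" "leaves v u k a2"
    "enters v (\<i> * u) c1 b1" "enters v (- \<i> * u) c2 b2" "c1 \<noteq> c2"
    "leaves v ((1 + \<i>) * u) Red d1" "leaves v ((- 1 + \<i>) * u) Green d2"
    "leaves v ((- 1 - \<i>) * u) Red d3" "leaves v ((1 - \<i>) * u) Green d4"
    using assms(1) by (elim C8E)
  have E: "enters v d c (f a)" if "enters v d c a" "d \<noteq> 0" for d c a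
    using that enters_stretch f[of a] by metis
  have L: "leaves v d c (f a)" if "leaves v d c a" for d c a
    using that leaves_stretch f[of a] by metis
  have "enters v (- u) k (f a1)" "leaves v u k (f a2)"
    "enters v (\<i> * u) c1 (f b1)" "enters v (- \<i> * u) c2 (f b2)"
    "leaves v ((1 + \<i>) * u) Red (f d1)" "leaves v ((- 1 + \<i>) * u) Green (f d2)"
    "leaves v ((- 1 - \<i>) * u) Red (f d3)" "leaves v ((1 - \<i>) * u) Green (f d4)"
    using * by (auto intro!: E L)
  moreover have "f ` X = {f a1, f a2, f b1, f b2, f d1, f d2, f d3, f d4}" using * by auto
  ultimately show ?thesis using *(1,7) unfolding C8_def by blast
qed

lemma C4_not_C8: "C4 v u X \<Longrightarrow> \<not> C8 v u' X"
proof
  assume "C4 v u X" "C8 v u' X"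
  have "card X \<le> 4"
    using \<open>C4 v u X\<close>
  proof (rule C4E)
    fix a1 a2 b1 b2
    assume "X = {a1, a2, b1, b2}"
    then show ?thesis using card_length[of "[a1, a2, b1, b2]"] by simp
  qed
  moreover have "8 \<le> card X"
    using \<open>C8 v u' X\<close>
  proof (rule C8E)
    fix a1 a2 b1 b2 d1 d2 d3 d4
    assume X: "X = {a1, a2, b1, b2, d1, d2, d3, d4}" and d: "dirsgn v u' a1 = (-1, 0)"
      "dirsgn v u' a2 = (1, 0)"
    "dirsgn v u' b1 = (0, 1)" "dirsgn v u' b2 = (0, -1)"
    "dirsgn v u' d1 = (1, 1)" "dirsgn v u' d2 = (-1, 1)"
    "dirsgn v u' d3 = (-1, -1)" "dirsgn v u' d4 = (1, -1)"
    have "dirsgn v u' ` X = {(-1, 0), (1, 0), (0, 1), (0, -1), (1, 1), (-1, 1), (-1, -1), (1, -1)}"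
      by (simp add: X d)
    then have "card (dirsgn v u' ` X) = 8" by simp
    moreover have "card (dirsgn v u' ` X) \<le> card X" by (rule card_image_le) (simp add: X)
    ultimately show ?thesis by simp
  qed
  ultimately show False by simp
qed

lemma left_simps [simp]:
  "apex (left_part t) = midpoint (rv t) (lv t)" "rv (left_part t) = lv t"
    "lv (left_part t) = apex t"
  "tcol (left_part t) = Red" "rleg (left_part t) = half_at (lv t) (hyp t)"
  "lleg (left_part t) = height t" "hyp (left_part t) = lleg t"
  by (simp_all add: left_part_def)

lemma right_simps [simp]:
  "apex (right_part t) = midpoint (rv t) (lv t)" "rv (right_part t) = apex t"
    "lv (right_part t) = rv t"
  "tcol (right_part t) = Green" "rleg (right_part t) = height t"
  "lleg (right_part t) = half_at (rv t) (hyp t)" "hyp (right_part t) = rleg t"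
  by (simp_all add: right_part_def)

text \<open>\<open>T1\<close> is an arbitrary tiling with halves \<open>T\<close>, because
  correctness is claimed for every tiling whose decomposition is \<open>T\<close>.\<close>

locale composed_tiling = correct_triangle_tiling +
  fixes T1 :: "tile set"
  assumes tiling1: "tiling T1" and parts1: "parts T1 = T"
begin

lemma left_in: "t \<in> T1 \<Longrightarrow> left_part t \<in> T"
  and right_in: "t \<in> T1 \<Longrightarrow> right_part t \<in> T"
  using parts1 by (auto simp: parts_def)

lemma part_of: "p \<in> T \<Longrightarrow> \<exists>t\<in>T1. p = left_part t \<or> p = right_part t"
  using parts1 by (auto simp: parts_def)

sublocale T1: triangle_tiling T1 "sqrt 2 * s"
proof
  show "tiling T1" by (rule tiling1)
  show "sqrt 2 * s > 0" using s_pos by simp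
  show "triangle_tile (sqrt 2 * s) t" if "t \<in> T1" for t
  proof (rule tile_of_parts[OF _ tiling1 that])
    show "triangle_tiling (parts T1) s" unfolding parts1 by (rule triangle_tiling_axioms)
  qed
qed

lemma joins1:
  assumes "t \<in> T1"
  shows "joins (rleg t) (apex t) (rv t)" "joins (lleg t) (apex t) (lv t)"
    "joins (hyp t) (rv t) (lv t)"
  using T1.tile[OF assms] by (auto simp: triangle_tile_def)

lemma apex_green_corner: "t \<in> T1 \<Longrightarrow> \<exists>p\<in>T. rv p = apex t \<and> tcol p = Green"
  using right_in[of t] by (intro bexI[of _ "right_part t"]) simp_all

lemma lv_red_corner: "t \<in> T1 \<Longrightarrow> \<exists>p\<in>T. rv p = lv t \<and> tcol p = Red"
  using left_in[of t] by (intro bexI[of _ "left_part t"]) simp_all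

text \<open>\<open>rv t\<close> is the left corner of the green right half; the tile beyond the left
  leg of that half has its right corner there and the other colour.\<close>

lemma rv_red_corner:
  assumes "t \<in> T1"
  shows "\<exists>p\<in>T. rv p = rv t \<and> tcol p = Red"
proof -
  obtain p where "p \<in> T" "rv p = rv t" "tcol p \<noteq> Green"
    using opposite_corner[OF right_in[OF assms]] by auto
  then show ?thesis by (cases "tcol p") auto
qed

text \<open>A vertex with both roles would be the right corner of a green and of a red tile.\<close>

lemma apex1_not_acute: "t \<in> T1 \<Longrightarrow> t' \<in> T1 \<Longrightarrow> apex t \<noteq> rv t' \<and> apex t \<noteq> lv t'"
proof -
  assume t: "t \<in> T1" "t' \<in> T1"
  obtain p where p: "p \<in> T" "rv p = apex t" "tcol p = Green" using apex_green_corner t by blast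
  obtain q where q: "q \<in> T" "rv q = rv t'" "tcol q = Red" using rv_red_corner t by blast
  obtain q' where q': "q' \<in> T" "rv q' = lv t'" "tcol q' = Red" using lv_red_corner t by blast
  show ?thesis using corner_color[OF p(1) q(1)] corner_color[OF p(1) q'(1)] p q q' by auto
qed

text \<open>Midpoints of composed hypotenuses are apexes in \<open>T\<close>, whereas all vertices
  of composed tiles are acute corners in \<open>T\<close>.\<close>

lemma mid_not_vertex:
  assumes "t \<in> T1" "t' \<in> T1"
  shows "midpoint (rv t) (lv t) \<noteq> apex t'" "midpoint (rv t) (lv t) \<noteq> rv t'"
    "midpoint (rv t) (lv t) \<noteq> lv t'"
  using apex_not_acute[OF left_in[OF assms(1)] left_in[OF assms(2)]]
    apex_not_acute[OF left_in[OF assms(1)] right_in[OF assms(2)]] by simp_all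

text \<open>Arrows of length \<open>sqrt 2 * s\<close> at \<open>v\<close> are legs of composed
  tiles and stay. The short ones are halves of composed hypotenuses and get doubled, since a height
  runs from a composed apex to a midpoint and neither can be \<open>v\<close>.\<close>

lemma crossing_acute:
  assumes t: "t \<in> T1" and v: "v = rv t \<or> v = lv t"
  shows "crossing T1 v = (\<lambda>a. if dist (src a) (tgt a) = sqrt 2 * s then a else stretch v a) ` crossing T v"
proof -
  define f where "f a = (if dist (src a) (tgt a) = sqrt 2 * s then a else stretch v a)" for a
  have na: "apex t1 \<noteq> v" if "t1 \<in> T1" for t1 using apex1_not_acute[OF that t] v by auto
  have nm: "midpoint (rv t1) (lv t1) \<noteq> v" if "t1 \<in> T1" for t1
    using mid_not_vertex[OF that t] v by auto
  have long: "f (hyp p) = hyp p" if "p \<in> T" for p using dist_hyp[OF tile[OF that]]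
    by (simp add: f_def)
  have short: "f (rleg p) = stretch v (rleg p)" "f (lleg p) = stretch v (lleg p)" if "p \<in> T"
    for p
    using dist_rleg[OF tile[OF that]] dist_lleg[OF tile[OF that]] sqrt2_mult_neq[OF s_pos]
      by (simp_all add: f_def)
  have ne: "rv t1 \<noteq> lv t1" if "t1 \<in> T1" for t1
    using T1.lv_eq[OF that] T1.dir_nonzero[OF that] by (auto simp: complex_eq_iff)
  have "crossing T1 v \<subseteq> f ` crossing T v"
  proof
    fix a assume a: "a \<in> crossing T1 v"
    then obtain t1 where t1: "t1 \<in> T1" "a \<in> sides t1" "src a = v \<or> tgt a = v"
      by (auto simp: crossing_def)
    note j = joins1[OF t1(1)]
    note L = left_in[OF t1(1)] and R = right_in[OF t1(1)]
    from t1(2) consider "a = rleg t1" | "a = lleg t1" | "a = hyp t1" by (auto simp: sides_def)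
    then show "a \<in> f ` crossing T v"
    proof cases
      case 1
      then have "rv t1 = v" using t1(3) j na[OF t1(1)] by (auto simp: joins_iff)
      then have "a \<in> crossing T v" using legs_in_crossing(6)[OF R] 1 by simp
      then show ?thesis using long[OF R] 1 by (intro image_eqI[of _ _ a]) simp_all
    next
      case 2
      then have "lv t1 = v" using t1(3) j na[OF t1(1)] by (auto simp: joins_iff)
      then have "a \<in> crossing T v" using legs_in_crossing(5)[OF L] 2 by simp
      then show ?thesis using long[OF L] 2 by (intro image_eqI[of _ _ a]) simp_all
    next
      case 3
      then have "rv t1 = v \<or> lv t1 = v" using t1(3) j by (auto simp: joins_iff)
      then show ?thesis
      proof
        assume e: "rv t1 = v"
        have "lleg (right_part t1) \<in> crossing T v" using legs_in_crossing(4)[OF R] e by simp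
        moreover have "f (lleg (right_part t1)) = a"
          unfolding short[OF R] using stretch_half_at[of "hyp t1" v "lv t1"] j(3) e ne[OF t1(1)] 3
            by simp
        ultimately show ?thesis by (metis image_eqI)
      next
        assume e: "lv t1 = v"
        have "rleg (left_part t1) \<in> crossing T v" using legs_in_crossing(3)[OF L] e by simp
        moreover have "f (rleg (left_part t1)) = a"
          unfolding short[OF L] using stretch_half_at[of "hyp t1" v "rv t1"] j(3) e ne[OF t1(1)] 3
          by (simp add: joins_commute)
        ultimately show ?thesis by (metis image_eqI)
      qed
    qed
  qed
  moreover have "f ` crossing T v \<subseteq> crossing T1 v"
  proof (rule image_subsetI)
    fix a assume "a \<in> crossing T v"
    then obtain p where p: "p \<in> T" "a \<in> sides p" and v: "src a = v \<or> tgt a = v"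
      by (auto simp: crossing_def)
    obtain t1 where t1: "t1 \<in> T1" "p = left_part t1 \<or> p = right_part t1"
      using part_of[OF p(1)] by blast
    note j = joins1[OF t1(1)] rleg_joins[OF p(1)] lleg_joins[OF p(1)] hyp_joins[OF p(1)]
    have X: "rleg t1 \<in> (\<Union>t\<in>T1. sides t)" "lleg t1 \<in> (\<Union>t\<in>T1. sides t)"
      "hyp t1 \<in> (\<Union>t\<in>T1. sides t)"
      using t1(1) by (auto simp: sides_def)
    have H: "a \<noteq> height t1" using v na[OF t1(1)] nm[OF t1(1)] by (auto simp: height_def)
    from t1(2) show "f a \<in> crossing T1 v"
    proof
      assume L: "p = left_part t1"
      then have "a = rleg p \<or> a = hyp p" using p(2) H by (auto simp: sides_def)
      then show ?thesis
      proof
        assume a: "a = rleg p"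
        then have "lv t1 = v" using j(4) L v nm[OF t1(1)] by (auto simp: joins_iff)
        then have "f a = hyp t1"
          unfolding a short[OF p(1)]
            using stretch_half_at[of "hyp t1" v "rv t1"] j(3) ne[OF t1(1)] L
          by (simp add: joins_commute)
        then show ?thesis using X \<open>lv t1 = v\<close> j(3)
          by (auto simp: crossing_def joins_iff)
      next
        assume a: "a = hyp p"
        then show ?thesis using long[OF p(1)] X L v by (auto simp: crossing_def)
      qed
    next
      assume L: "p = right_part t1"
      then have "a = lleg p \<or> a = hyp p" using p(2) H by (auto simp: sides_def)
      then show ?thesis
      proof
        assume a: "a = lleg p"
        then have "rv t1 = v" using j(5) L v nm[OF t1(1)] by (auto simp: joins_iff)
        then have "f a = hyp t1"
          unfolding a short[OF p(1)]
            using stretch_half_at[of "hyp t1" v "lv t1"] j(3) ne[OF t1(1)] L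
          by simp
        then show ?thesis using X \<open>rv t1 = v\<close> j(3)
          by (auto simp: crossing_def joins_iff)
      next
        assume a: "a = hyp p"
        then show ?thesis using long[OF p(1)] X L v by (auto simp: crossing_def)
      qed
    qed
  qed
  ultimately show ?thesis by (simp add: f_def subset_antisym)
qed

lemma acute1_C8:
  assumes "t \<in> T1" "v = rv t \<or> v = lv t"
  shows "\<exists>u. C8 v u (crossing T1 v)"
proof -
  obtain p where "p \<in> T" "rv p = v" using rv_red_corner lv_red_corner assms by blast
  then obtain u where "C8 v u (crossing T v)" using acute_C8 by blast
  then show ?thesis unfolding crossing_acute[OF assms] by (intro exI[of _ u] C8_stretch) auto
qed

text \<open>Sides of \<open>T1\<close> that end at a composed apex are legs, that is, hypotenuses of
  halves; so length decides which arrows of \<open>T\<close> survive there.\<close>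

lemma crossing_apex:
  assumes t: "t \<in> T1"
  shows "crossing T1 (apex t) = {a \<in> crossing T (apex t). dist (src a) (tgt a) = sqrt 2 * s}"
proof
  show "crossing T1 (apex t) \<subseteq> {a \<in> crossing T (apex t). dist (src a) (tgt a) = sqrt 2 * s}"
  proof
    fix a assume "a \<in> crossing T1 (apex t)"
    then obtain t1 where t1: "t1 \<in> T1" "a \<in> sides t1"
      and v: "src a = apex t \<or> tgt a = apex t" by (auto simp: crossing_def)
    have "a \<noteq> hyp t1" using joins1(3)[OF t1(1)] v apex1_not_acute[OF t t1(1)]
      by (auto simp: joins_iff)
    then have "a = hyp (left_part t1) \<or> a = hyp (right_part t1)" using t1(2)
      by (auto simp: sides_def)
    then obtain p where p: "p \<in> T" "a = hyp p" using left_in right_in t1(1) by blast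
    have "a \<in> (\<Union>t\<in>T. sides t)" using p by (auto simp: sides_def)
    then show "a \<in> {a \<in> crossing T (apex t). dist (src a) (tgt a) = sqrt 2 * s}"
      using p dist_hyp[OF tile[OF p(1)]] v by (auto simp: crossing_def)
  qed
  show "{a \<in> crossing T (apex t). dist (src a) (tgt a) = sqrt 2 * s} \<subseteq> crossing T1 (apex t)"
  proof
    fix a assume "a \<in> {a \<in> crossing T (apex t). dist (src a) (tgt a) = sqrt 2 * s}"
    then obtain p where p: "p \<in> T" "a \<in> sides p"
      and v: "src a = apex t \<or> tgt a = apex t"
      and d: "dist (src a) (tgt a) = sqrt 2 * s" by (auto simp: crossing_def)
    have "a = hyp p"
      using p(2) d dist_rleg[OF tile[OF p(1)]] dist_lleg[OF tile[OF p(1)]] sqrt2_mult_neq[OF s_pos]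
      by (auto simp: sides_def)
    moreover obtain t1 where "t1 \<in> T1" "p = left_part t1 \<or> p = right_part t1"
      using part_of[OF p(1)] by blast
    ultimately have "a \<in> (\<Union>t\<in>T1. sides t)" by (auto simp: sides_def)
    then show "a \<in> crossing T1 (apex t)" using v by (auto simp: crossing_def)
  qed
qed

lemma apex1_long:
  assumes t: "t \<in> T1" and C: "C8 (apex t) u (crossing T (apex t))"
  shows "crossing T1 (apex t) = {a \<in> crossing T (apex t). dirsgn (apex t) u a \<in> {(1, 0), (-1, 0), (0, 1), (0, -1)}}"
proof -
  obtain p where p: "p \<in> T" "rv p = apex t" "tcol p = Green" using apex_green_corner t by blast
  show ?thesis unfolding crossing_apex[OF t] using green_corner_long[OF p(1,3), of u] C
    unfolding p(2) by blast
qed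

lemma apex1_C8: "t \<in> T1 \<Longrightarrow> \<exists>u. C8 (apex t) u (crossing T (apex t))"
  using acute_C8[OF left_in[of t], of "apex t"] by simp

lemma apex1_C4:
  assumes t: "t \<in> T1" and C: "C8 (apex t) u (crossing T (apex t))"
  shows "C4 (apex t) u (crossing T1 (apex t))"
  using C
proof (rule C8E)
  fix a1 a2 b1 b2 d1 d2 d3 d4 k c1 c2
  assume X: "crossing T (apex t) = {a1, a2, b1, b2, d1, d2, d3, d4}"
    and d: "dirsgn (apex t) u a1 = (-1, 0)" "dirsgn (apex t) u a2 = (1, 0)"
    "dirsgn (apex t) u b1 = (0, 1)" "dirsgn (apex t) u b2 = (0, -1)"
    "dirsgn (apex t) u d1 = (1, 1)" "dirsgn (apex t) u d2 = (-1, 1)"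
    "dirsgn (apex t) u d3 = (-1, -1)" "dirsgn (apex t) u d4 = (1, -1)"
    and u: "u \<noteq> 0" "enters (apex t) (- u) k a1" "leaves (apex t) u k a2"
    "enters (apex t) (\<i> * u) c1 b1" "enters (apex t) (- \<i> * u) c2 b2" "c1 \<noteq> c2"
  have "crossing T1 (apex t) = {a1, a2, b1, b2}"
    unfolding apex1_long[OF t C] unfolding X by (auto simp: d)
  then show ?thesis using u unfolding C4_def by blast
qed

text \<open>The height lies 45 degrees counterclockwise from the right leg and has the colour of the
  tile. A right leg along the axis puts it on a red diagonal of the \<open>C8\<close> crossing, a
  perpendicular one on a green diagonal.\<close>

lemma apex1_color:
  assumes t: "t \<in> T1" and C: "C8 (apex t) u (crossing T (apex t))"
  shows "Im ((rv t - apex t) / u) = 0 \<and> tcol t = Red \<or> Re ((rv t - apex t) / u) = 0 \<and> tcol t = Green"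
proof -
  define x y where "x = Re ((rv t - apex t) / u)" and "y = Im ((rv t - apex t) / u)"
  have "rleg t \<in> crossing T1 (apex t)" using joins1(1)[OF t] t
    by (auto simp: crossing_def sides_def joins_iff)
  then have "dirsgn (apex t) u (rleg t) \<in> {(1, 0), (-1, 0), (0, 1), (0, -1)}"
    unfolding apex1_long[OF t C] by blast
  moreover have "dirsgn (apex t) u (rleg t) = sgn_pair ((rv t - apex t) / u)"
    using joins1(1)[OF t] by (intro dirsgn_joins) simp
  ultimately have xy: "(sgn x, sgn y) \<in> {(1, 0), (-1, 0), (0, 1), (0, -1)}"
    by (simp add: sgn_pair_def x_def y_def)
  have "midpoint (rv t) (lv t) = apex t + (1/2) * ((1 + \<i>) * (rv t - apex t))"
    by (subst T1.lv_eq[OF t]) (simp add: midpoint_def scaleR_conv_of_real field_simps)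
  then have "joins (height t) (apex t) (apex t + of_real (1/2) * ((1 + \<i>) * (rv t - apex t)))"
    by (simp add: height_def joins_iff)
  from dirsgn_joins[OF this, of u]
  have "dirsgn (apex t) u (height t) = sgn_pair (of_real (1/2) * ((1 + \<i>) * ((rv t - apex t) / u)))" by simp
  then have h: "dirsgn (apex t) u (height t) = sgn_pair ((1 + \<i>) * ((rv t - apex t) / u))"
    using sgn_pair_scale[of "1/2" "(1 + \<i>) * ((rv t - apex t) / u)"] by simp
  have "dirsgn (apex t) u (height t) = (sgn (x - y), sgn (x + y))"
  proof -
    have "Re ((1 + \<i>) * z) = Re z - Im z" "Im ((1 + \<i>) * z) = Re z + Im z" for z by simp_all
    then show ?thesis unfolding h sgn_pair_def x_def y_def by (simp only:)
  qed
  moreover have "height t \<in> crossing T (apex t)" using legs_in_crossing(4)[OF left_in[OF t]]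
    by simp
  moreover obtain k c1 c2 where
    "\<forall>a\<in>crossing T (apex t). dirsgn (apex t) u a = (1, 1) \<longrightarrow> leaves (apex t) ((1 + \<i>) * u) Red a"
    "\<forall>a\<in>crossing T (apex t). dirsgn (apex t) u a = (-1, 1) \<longrightarrow> leaves (apex t) ((- 1 + \<i>) * u) Green a"
    "\<forall>a\<in>crossing T (apex t). dirsgn (apex t) u a = (-1, -1) \<longrightarrow> leaves (apex t) ((- 1 - \<i>) * u) Red a"
    "\<forall>a\<in>crossing T (apex t). dirsgn (apex t) u a = (1, -1) \<longrightarrow> leaves (apex t) ((1 - \<i>) * u) Green a"
    using C by (elim C8_values)
  ultimately have c: "(sgn (x - y), sgn (x + y)) \<in> {(1, 1), (-1, -1)} \<Longrightarrow> tcol t = Red"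
    "(sgn (x - y), sgn (x + y)) \<in> {(-1, 1), (1, -1)} \<Longrightarrow> tcol t = Green"
    by (auto simp: leaves_def height_def)
  from xy have "y = 0 \<and> x \<noteq> 0 \<or> x = 0 \<and> y \<noteq> 0"
    by (auto simp: sgn_zero_iff)
  then show ?thesis
  proof
    assume "y = 0 \<and> x \<noteq> 0"
    then have "tcol t = Red" by (intro c(1)) (cases "x > 0"; simp)
    then show ?thesis using \<open>y = 0 \<and> x \<noteq> 0\<close> by (simp add: y_def)
  next
    assume "x = 0 \<and> y \<noteq> 0"
    then have "tcol t = Green" by (intro c(2)) (cases "y > 0"; simp)
    then show ?thesis using \<open>x = 0 \<and> y \<noteq> 0\<close> by (simp add: x_def)
  qed
qed

end

section \<open>Sides of the composition\<close>

context composed_tiling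
begin

lemma part_region: "t \<in> T1 \<Longrightarrow> region t = region (left_part t) \<union> region (right_part t)"
  using region_left_right_part[OF T1.tile T1.s_pos tile[OF left_in] tile[OF right_in] s_pos]
    by blast

lemma shared_part: "t \<in> T1 \<Longrightarrow> t' \<in> T1 \<Longrightarrow> X \<in> {left_part t, right_part t} \<Longrightarrow> X \<in> {left_part t', right_part t'} \<Longrightarrow> t = t'"
  using shared_part_eq[OF T1.tile T1.s_pos T1.tile left_in right_in left_in right_in] by blast

lemma midpoint_in_region: "t \<in> T1 \<Longrightarrow> midpoint (rv t) (lv t) \<in> region t"
proof -
  assume t: "t \<in> T1"
  have "apex (left_part t) \<in> region (left_part t)" unfolding region_def
    by (rule hull_inc) (simp add: vertices_def)
  then show ?thesis using part_region[OF t] by simp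
qed

text \<open>The midpoint is an apex in \<open>T\<close>, so it is also the midpoint of
  \<open>t'\<close>, and the left halves differ by a multiple of a quarter turn about it. Turns by 0
  or 90 degrees would make \<open>t\<close> and \<open>t'\<close> share a half; the half turn swaps
  the ends of the hypotenuse.\<close>

lemma midpoint_shared:
  assumes t: "t \<in> T1" "t' \<in> T1" "t \<noteq> t'"
    and m: "midpoint (rv t) (lv t) \<in> region t'"
  shows "rv t' = lv t \<and> lv t' = rv t"
proof -
  let ?m = "midpoint (rv t) (lv t)"
  define L L' where "L = left_part t" and "L' = left_part t'"
  have T: "L \<in> T" "L' \<in> T" "right_part t \<in> T" "right_part t' \<in> T"
    using t left_in right_in by (auto simp: L_def L'_def)
  have "?m \<in> region L' \<or> ?m \<in> region (right_part t')"
    using m part_region[OF t(2)] L'_def by auto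
  then obtain X where X: "X \<in> {L', right_part t'}" "?m \<in> region X" by blast
  then have XT: "X \<in> T" using T by auto
  have "?m \<in> vertices L" by (simp add: L_def vertices_def)
  then have "?m \<in> vertices X" using vertex_in_region[OF T(1) XT] X by blast
  then have "?m = apex X" using apex_not_acute[OF T(1) XT] by (auto simp: vertices_def L_def)
  then have mm: "midpoint (rv t') (lv t') = ?m" using X by (auto simp: L'_def)
  have ap: "apex L' = apex L" by (simp add: L_def L'_def mm)
  obtain q where q: "q \<in> {1, -1, \<i>, -\<i>}" "rv L' - apex L = q * (rv L - apex L)"
    using apex_quadrants[OF T(1,2) ap] by blast
  have q1: "q \<noteq> 1"
  proof
    assume "q = 1"
    then have "L = L'" using position_eq[OF T(1,2)] q(2) ap by simp
    then show False using shared_part[of t t' L] t by (simp add: L_def L'_def)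
  qed
  have qi: "q \<noteq> \<i>"
  proof
    assume "q = \<i>"
    then have "rv L' = lv L" using q(2) by (metis add.commute diff_add_cancel lv_eq[OF T(1)])
    then have "L' = right_part t" using position_eq[OF T(2,3)] ap by (simp add: L_def)
    then show False using shared_part[of t t' L'] t by (simp add: L_def L'_def)
  qed
  have qi': "q \<noteq> - \<i>"
  proof
    assume "q = - \<i>"
    then have "lv L' = apex L + \<i> * (- \<i> * (rv L - apex L))" using q(2) lv_eq[OF T(2)] ap
      by metis
    then have "lv L' = rv L" by (simp add: algebra_simps)
    then have "L = right_part t'" using position_eq[OF T(1,4)] ap by (simp add: L'_def)
    then show False using shared_part[of t t' L] t by (simp add: L_def L'_def)
  qed
  from q q1 qi qi' have "rv L' - apex L = - (rv L - apex L)" by auto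
  then have 1: "lv t' - ?m = - (lv t - ?m)" by (simp add: L_def L'_def)
  have "x - midpoint x y = - (y - midpoint x y)" for x y :: complex
    by (simp add: midpoint_def scaleR_conv_of_real field_simps)
  from this[of "rv t" "lv t"] this[of "rv t'" "lv t'"]
  have 2: "rv t - ?m = - (lv t - ?m)" "rv t' - ?m = - (lv t' - ?m)" unfolding mm .
  have "rv t' - ?m = lv t - ?m" "lv t' - ?m = rv t - ?m" unfolding 2 1
    by (simp_all only: minus_minus)
  then show ?thesis by simp
qed

text \<open>A composed leg is the hypotenuse of a half, so the two halves are neighbours across it
  in \<open>T\<close> and differ in colour: one is a left half, the other a right half.\<close>

lemma shared_leg:
  assumes t: "t \<in> T1" "t' \<in> T1" "t \<noteq> t'" and X: "X \<in> {left_part t, right_part t}"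
    "X' \<in> {left_part t', right_part t'}"
    and h: "hyp X = hyp X'"
  shows "apex t' = apex t"
    "rv t' = lv t \<and> rleg t' = lleg t \<or> lv t' = rv t \<and> lleg t' = rleg t"
proof -
  have T: "X \<in> T" "X' \<in> T" using X t left_in right_in by auto
  have ne: "X \<noteq> X'" using shared_part t X by blast
  have c: "tcol X \<noteq> tcol X'" using color_neq[OF T ne, of "hyp X"] h by (simp add: sides_def)
  have s: "rv X' = lv X \<and> lv X' = rv X" using shared_hyp[OF T ne h] .
  show "apex t' = apex t"
    "rv t' = lv t \<and> rleg t' = lleg t \<or> lv t' = rv t \<and> lleg t' = rleg t"
    using X c s h by auto
qed

lemma leg_intersection:
  assumes t: "t \<in> T1" "t' \<in> T1" "apex t' = apex t" "rv t' = lv t"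
  shows "region t \<inter> region t' = seg (lleg t)"
proof -
  define d where "d = rv t - apex t"
  have d': "rv t' - apex t' = \<i> * d" using t T1.lv_eq[OF t(1)] by (simp add: d_def)
  have "z \<in> region t \<and> z \<in> region t' \<longleftrightarrow> z \<in> seg (lleg t)" for z
  proof -
    obtain c where c: "z = apex t + c * d" using tile_coordinate[OF T1.tile[OF t(1)] T1.s_pos]
      unfolding d_def by blast
    \<comment> \<open>The right leg of \<open>t'\<close> is that of \<open>t\<close> turned by
      \<open>\<i>\<close> about the common apex, so the coordinate is multiplied by
      \<open>- \<i>\<close>.\<close>
    have c': "z = apex t' + (- \<i> * c) * (rv t' - apex t')" unfolding d'
      by (simp add: c t(3) algebra_simps)
    have 1: "z \<in> region t \<longleftrightarrow> 0 \<le> Re c \<and> 0 \<le> Im c \<and> Re c + Im c \<le> 1"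
      unfolding c d_def tile_point_in_region[OF T1.tile[OF t(1)] T1.s_pos] ..
    have 2: "z \<in> region t' \<longleftrightarrow> 0 \<le> Im c \<and> 0 \<le> - Re c \<and> Im c - Re c \<le> 1"
      by (subst c', subst tile_point_in_region[OF T1.tile[OF t(2)] T1.s_pos]) simp
    have 3: "z \<in> seg (lleg t) \<longleftrightarrow> Re c = 0 \<and> 0 \<le> Im c \<and> Im c \<le> 1"
      unfolding c d_def lleg_point[OF T1.tile[OF t(1)] T1.s_pos] ..
    show ?thesis unfolding 1 2 3 by auto
  qed
  then show ?thesis by blast
qed

lemma hyp_intersection:
  assumes t: "t \<in> T1" "t' \<in> T1" "lv t' = rv t" "rv t' = lv t"
  shows "region t \<inter> region t' = seg (hyp t)"
proof -
  define d where "d = rv t - apex t"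
  have lv: "lv t = apex t + \<i> * d" and rv: "rv t = apex t + d" using T1.lv_eq[OF t(1)]
    by (auto simp: d_def)
  have "apex t + d = apex t' + \<i> * (apex t + \<i> * d - apex t')"
    using T1.lv_eq[OF t(2)] t(3,4) lv rv by simp
  then have "(1 - \<i>) * apex t' = (1 - \<i>) * (apex t + (1 + \<i>) * d)"
    by (simp add: algebra_simps)
  then have a: "apex t' = apex t + (1 + \<i>) * d" by (simp add: complex_eq_iff)
  have d': "rv t' - apex t' = - d" unfolding t(4) lv a by (simp add: algebra_simps)
  have "z \<in> region t \<and> z \<in> region t' \<longleftrightarrow> z \<in> seg (hyp t)" for z
  proof -
    obtain c where c: "z = apex t + c * d" using tile_coordinate[OF T1.tile[OF t(1)] T1.s_pos]
      unfolding d_def by blast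
    \<comment> \<open>\<open>t'\<close> is the image of \<open>t\<close> under the point reflection
      in the midpoint of the hypotenuse, which in coordinates exchanges \<open>c\<close> and
      \<open>1 + \<i> - c\<close>.\<close>
    have c': "z = apex t' + (1 + \<i> - c) * (rv t' - apex t')" unfolding d'
      by (simp add: c a algebra_simps)
    have 1: "z \<in> region t \<longleftrightarrow> 0 \<le> Re c \<and> 0 \<le> Im c \<and> Re c + Im c \<le> 1"
      unfolding c d_def tile_point_in_region[OF T1.tile[OF t(1)] T1.s_pos] ..
    have 2: "z \<in> region t' \<longleftrightarrow> 0 \<le> 1 - Re c \<and> 0 \<le> 1 - Im c \<and> 1 - Re c + (1 - Im c) \<le> 1"
      by (subst c', subst tile_point_in_region[OF T1.tile[OF t(2)] T1.s_pos]) simp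
    have 3: "z \<in> seg (hyp t) \<longleftrightarrow> 0 \<le> Re c \<and> 0 \<le> Im c \<and> Re c + Im c = 1"
      unfolding c d_def hyp_point[OF T1.tile[OF t(1)] T1.s_pos] ..
    show ?thesis unfolding 1 2 3 by auto
  qed
  then show ?thesis by blast
qed

text \<open>If one tile contains the midpoint of the other, they share a hypotenuse; if halves of
  them share a hypotenuse, they share a leg. Otherwise halves meet in at most one point each, so the
  intersection is both finite and convex, hence at most a point.\<close>

lemma side_to_side1: "side_to_side T1"
  unfolding side_to_side_def
proof (intro ballI impI)
  fix t t' assume t: "t \<in> T1" "t' \<in> T1" "t \<noteq> t'"
  let ?Z = "region t \<inter> region t'"
  let ?goal = "?Z = {} \<or> (\<exists>v\<in>vertices t \<inter> vertices t'. ?Z = {v}) \<or>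
     (\<exists>a\<in>sides t. \<exists>b\<in>sides t'. seg a = seg b \<and> ?Z = seg a)"
  have opp: ?goal if o: "rv t' = lv t" "lv t' = rv t"
  proof -
    have "?Z = seg (hyp t)" "seg (hyp t) = seg (hyp t')"
      using hyp_intersection[OF t(1,2) o(2,1)] hyp_intersection[OF t(2,1)] o
        by (auto simp: Int_commute)
    then show ?thesis by (auto simp: sides_def)
  qed
  show ?goal
  proof (cases "midpoint (rv t) (lv t) \<in> region t' \<or> midpoint (rv t') (lv t') \<in> region t")
    case True
    then show ?thesis using midpoint_shared[OF t] midpoint_shared[OF t(2,1)] t(3) opp by metis
  next
    case nomid: False
    show ?thesis
    proof (cases "\<exists>X\<in>{left_part t, right_part t}. \<exists>X'\<in>{left_part t', right_part t'}. hyp X = hyp X'")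
      case True
      then obtain X X' where "X \<in> {left_part t, right_part t}"
        "X' \<in> {left_part t', right_part t'}" "hyp X = hyp X'"
        by blast
      note sl = shared_leg[OF t this]
      from sl(2) show ?thesis
      proof
        assume a: "rv t' = lv t \<and> rleg t' = lleg t"
        then have "?Z = seg (lleg t)" using leg_intersection[OF t(1,2) sl(1)] by blast
        moreover have "seg (rleg t') = seg (lleg t)" using a by simp
        moreover have "rleg t' \<in> sides t'" "lleg t \<in> sides t" by (simp_all add: sides_def)
        ultimately show ?thesis by metis
      next
        assume a: "lv t' = rv t \<and> lleg t' = rleg t"
        then have "?Z = seg (lleg t')" using leg_intersection[OF t(2,1) sl(1)[symmetric]]
          by (simp add: Int_commute)
        moreover have "seg (lleg t') = seg (rleg t)" using a by simp
        moreover have "lleg t' \<in> sides t'" "rleg t \<in> sides t" by (simp_all add: sides_def)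
        ultimately show ?thesis by metis
      qed
    next
      case nohyp: False
      have piece: "region X \<inter> region X' = {} \<or> (\<exists>v. v \<in> vertices X \<and> v \<in> vertices X' \<and> region X \<inter> region X' = {v})"
        if X: "X \<in> {left_part t, right_part t}" "X' \<in> {left_part t', right_part t'}"
          for X X'
      proof -
        have T: "X \<in> T" "X' \<in> T" using X t left_in right_in by auto
        have ne: "X \<noteq> X'" using shared_part t X by blast
        show ?thesis
          using T ne
        proof (cases rule: intersection_cases)
          case 1
          then show ?thesis by simp
        next
          case (2 v)
          then show ?thesis by blast
        next
          case (3 a)
          have sub: "region X \<subseteq> region t" "region X' \<subseteq> region t'"
            using X part_region t by auto
          \<comment> \<open>A common side that is not the hypotenuse of both halves is a leg of one
            of them and contains its apex, the midpoint for \<open>t\<close> or \<open>t'\<close>;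
            this was excluded.\<close>
          have "a \<noteq> hyp X \<or> a \<noteq> hyp X'" using nohyp X by blast
          then have "apex X \<in> seg a \<or> apex X' \<in> seg a"
            using 3(1,2) seg_joins[OF rleg_joins[OF T(1)]] seg_joins[OF lleg_joins[OF T(1)]]
              seg_joins[OF rleg_joins[OF T(2)]] seg_joins[OF lleg_joins[OF T(2)]]
            by (auto simp: sides_def)
          then have "apex X \<in> region t' \<or> apex X' \<in> region t" using 3(3) sub by blast
          then show ?thesis using nomid X by auto
        qed
      qed
      have Z: "?Z = (\<Union>X\<in>{left_part t, right_part t}. \<Union>X'\<in>{left_part t', right_part t'}. region X \<inter> region X')"
        using part_region t by auto
      have "finite (region X \<inter> region X')"
        if "X \<in> {left_part t, right_part t}" "X' \<in> {left_part t', right_part t'}" for X X'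
        using piece[OF that] by auto
      then have fin: "finite ?Z" unfolding Z by (intro finite_UN_I) auto
      have cv: "convex ?Z" by (intro convex_Int) (simp_all add: region_def)
      have uni: "x = y" if "x \<in> ?Z" "y \<in> ?Z" for x y
      proof -
        have "closed_segment x y \<subseteq> ?Z" using cv that
          by (simp add: convex_contains_segment)
        then show ?thesis using fin finite_subset finite_closed_segment by blast
      qed
      show ?thesis
      proof (cases "?Z = {}")
        case False
        then obtain v where v: "v \<in> ?Z" by blast
        then have Zv: "?Z = {v}" using uni by blast
        from v obtain X X' where X: "X \<in> {left_part t, right_part t}"
          "X' \<in> {left_part t', right_part t'}" "v \<in> region X \<inter> region X'"
          unfolding Z by blast
        obtain w where w: "w \<in> vertices X" "w \<in> vertices X'"
          "region X \<inter> region X' = {w}"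
          using piece[OF X(1,2)] X(3) by blast
        then have "v = w" using X(3) by simp
        with w have "v \<in> vertices X" "v \<in> vertices X'" by auto
        moreover have "v \<noteq> midpoint (rv t) (lv t)" "v \<noteq> midpoint (rv t') (lv t')"
          using nomid v by auto
        ultimately have "v \<in> vertices t" "v \<in> vertices t'" using X
          by (auto simp: vertices_def)
        then show ?thesis using Zv by blast
      qed blast
    qed
  qed
qed

lemma side_length1:
  assumes "t \<in> T1"
  shows "dist (src (rleg t)) (tgt (rleg t)) = sqrt 2 * s"
    "dist (src (lleg t)) (tgt (lleg t)) = sqrt 2 * s"
    "dist (src (hyp t)) (tgt (hyp t)) = 2 * s"
  using dist_rleg[OF T1.tile[OF assms]] dist_lleg[OF T1.tile[OF assms]] dist_hyp[OF T1.tile[OF assms]] by auto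

text \<open>The lengths \<open>sqrt 2 * s\<close> and \<open>2 * s\<close> differ, so legs match
  only legs. These are presented as hypotenuses of halves, to which the conditions on
  \<open>T\<close> apply.\<close>

lemma side_cases1:
  assumes t: "t \<in> T1" "t' \<in> T1" and a: "a \<in> sides t" "b \<in> sides t'" "seg a = seg b"
  obtains "a = hyp t" "b = hyp t'"
  | X X' where "X \<in> {left_part t, right_part t}" "X' \<in> {left_part t', right_part t'}"
    "a = hyp X" "b = hyp X'"
proof -
  have "sqrt 2 < 2" by (rule real_less_lsqrt) simp_all
  then have "sqrt 2 * s \<noteq> 2 * s" using s_pos by simp
  then have "a = hyp t \<and> b = hyp t' \<or> a \<in> {rleg t, lleg t} \<and> b \<in> {rleg t', lleg t'}"
    using seg_dist[OF a(3)] a(1,2) side_length1[OF t(1)] side_length1[OF t(2)]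
      by (auto simp: sides_def)
  moreover have "\<exists>X\<in>{left_part u, right_part u}. c = hyp X"
    if "c \<in> {rleg u, lleg u}" for c u using that by auto
  ultimately show ?thesis using that by blast
qed

lemma arrow_eq1:
  assumes t: "t \<in> T1" "t' \<in> T1" and a: "a \<in> sides t" "b \<in> sides t'" "seg a = seg b"
  shows "a = b"
  using t a
proof (cases rule: side_cases1)
  case (2 X X')
  then have "X \<in> T" "X' \<in> T" using t left_in right_in by auto
  then show ?thesis using arrow_eq[of X X' a b] 2 a(3) by (simp add: sides_def)
next
  case 1
  have j: "joins a (rv t) (lv t)" "joins b (rv t') (lv t')" using joins1 t 1 by auto
  show ?thesis
  proof (cases "t = t'")
    case False
    have e: "{rv t, lv t} = {rv t', lv t'}" using a(3) j by (auto simp: seg_eq_iff joins_def)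
    have "midpoint (rv t) (lv t) \<in> region t'"
      using midpoint_in_region[OF t(2)] e by (auto simp: doubleton_eq_iff midpoint_sym)
    then have o: "rv t' = lv t" "lv t' = rv t" using midpoint_shared[OF t False] by auto
    \<comment> \<open>The hypotenuses are compared through their halves at the common end
      \<open>rv t\<close>, which are sides of \<open>T\<close> on the same segment; such a half
      determines its arrow.\<close>
    let ?h = "half_at (rv t) a" and ?h' = "half_at (rv t) b"
    have h: "?h = lleg (right_part t)" "?h' = rleg (left_part t')" using 1 o by simp_all
    have "seg ?h = closed_segment (midpoint (rv t) (lv t)) (rv t)"
      unfolding h using seg_joins[OF lleg_joins[OF right_in[OF t(1)]]] by simp
    moreover have "seg ?h' = closed_segment (midpoint (rv t) (lv t)) (rv t)"
      unfolding h using seg_joins[OF rleg_joins[OF left_in[OF t(2)]]] o by (simp add: midpoint_sym)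
    ultimately have "?h = ?h'"
      using arrow_eq[OF right_in[OF t(1)] left_in[OF t(2)], of ?h ?h'] h by (simp add: sides_def)
    moreover have "rv t \<noteq> lv t" using T1.lv_eq[OF t(1)] T1.dir_nonzero[OF t(1)]
      by (auto simp: complex_eq_iff)
    ultimately show ?thesis using half_at_inject[of a "rv t" "lv t" b] j o
      by (simp add: joins_commute)
  qed (use 1 in simp)
qed

text \<open>Across a hypotenuse the colours are those of the two heights at its midpoint, which
  differ. Across a leg the tiles differ by a quarter turn about the apex, which exchanges right legs
  along the axis with perpendicular ones, hence red with green.\<close>

lemma color_neq1:
  assumes t: "t \<in> T1" "t' \<in> T1" "t \<noteq> t'" and a: "a \<in> sides t" "a \<in> sides t'"
  shows "tcol t \<noteq> tcol t'"
  using t(1,2) a refl[of "seg a"]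
proof (cases rule: side_cases1)
  case 1
  have e: "{rv t, lv t} = {rv t', lv t'}" using joins1(3)[OF t(1)] joins1(3)[OF t(2)] 1
    by (auto simp: joins_def)
  have "midpoint (rv t) (lv t) \<in> region t'"
    using midpoint_in_region[OF t(2)] e by (auto simp: doubleton_eq_iff midpoint_sym)
  then have o: "rv t' = lv t" "lv t' = rv t" using midpoint_shared[OF t] by auto
  have "acol (lleg (left_part t')) \<noteq> acol (lleg (left_part t))"
  proof (rule opposite_height_color[OF left_in[OF t(1)] _ left_in[OF t(2)]])
    show "rv (left_part t') - apex (left_part t) = - (rv (left_part t) - apex (left_part t))"
      using o by (simp add: midpoint_def scaleR_conv_of_real field_simps)
  qed (simp_all add: o midpoint_sym)
  then show ?thesis by (auto simp: height_def)
next
  case (2 X X')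
  have h: "hyp X = hyp X'" using 2 by simp
  note sl = shared_leg[OF t 2(1,2) h]
  obtain u where C: "C8 (apex t) u (crossing T (apex t))" using apex1_C8 t by blast
  then have u: "u \<noteq> 0" by (auto simp: C8_def)
  have "rv t' - apex t = \<i> * (rv t - apex t) \<or> rv t' - apex t = - \<i> * (rv t - apex t)"
    using sl(2)
  proof
    assume "rv t' = lv t \<and> rleg t' = lleg t"
    then show ?thesis using T1.lv_eq[OF t(1)] by simp
  next
    assume "lv t' = rv t \<and> lleg t' = rleg t"
    then have "rv t - apex t = \<i> * (rv t' - apex t)"
      using T1.lv_eq[OF t(2)] sl(1) by (metis add_diff_cancel_left')
    then have "- \<i> * (rv t - apex t) = rv t' - apex t"
      by (simp del: mult_minus_left add: mult.assoc[symmetric])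
    then show ?thesis by simp
  qed
  then have q: "(rv t' - apex t) / u = \<i> * ((rv t - apex t) / u) \<or> (rv t' - apex t) / u = - \<i> * ((rv t - apex t) / u)"
    by auto
  define z z' where "z = (rv t - apex t) / u" and "z' = (rv t' - apex t) / u"
  have "z \<noteq> 0" using T1.dir_nonzero[OF t(1)] u by (simp add: z_def)
  moreover have "z' = \<i> * z \<or> z' = - \<i> * z" using q unfolding z_def z'_def .
  moreover have "Im z = 0 \<and> tcol t = Red \<or> Re z = 0 \<and> tcol t = Green"
    using apex1_color[OF t(1) C] unfolding z_def .
  moreover have "Im z' = 0 \<and> tcol t' = Red \<or> Re z' = 0 \<and> tcol t' = Green"
    using apex1_color[OF t(2), of u] C unfolding z'_def sl(1) by blast
  ultimately show ?thesis by (auto simp: complex_eq_iff)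
qed

end

lemma inner_zero_iff_Re_divide: "u \<noteq> 0 \<Longrightarrow> (z::complex) \<bullet> u = 0 \<longleftrightarrow> Re (z / u) = 0"
  by (auto simp: inner_complex_def Re_divide complex_eq_iff sum_power2_eq_zero_iff)

text \<open>Only one arrow of the crossing leaves \<open>v\<close>, and it shows the axis. As the
  colouring rule speaks of an arbitrary axis \<open>u\<close>, this links it to the axis of the
  \<open>C8\<close> crossing before composition.\<close>

lemma C4_axis_unique:
  assumes "C4 v u X" "C4 v u' X"
  shows "\<exists>q>0. u = q *\<^sub>R u'"
proof -
  obtain a k where a: "a \<in> X" "leaves v u k a" using assms(1) unfolding C4_def by blast
  have u: "u \<noteq> 0" using assms(1) by (simp add: C4_def)
  obtain r where r: "r > 0" "src a = v" "tgt a = v + of_real r * u" using a(2)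
    by (auto simp: leaves_def)
  have ne: "tgt a \<noteq> v" using r u by simp
  obtain a1 a2 b1 b2 k' c1 c2 where "X = {a1, a2, b1, b2}" "enters v (- u') k' a1"
    "leaves v u' k' a2"
    "enters v (\<i> * u') c1 b1" "enters v (- \<i> * u') c2 b2"
    using assms(2) unfolding C4_def by blast
  then have "leaves v u' k' a" using a(1) ne by (auto simp: enters_def)
  then obtain r' where r': "r' > 0" "tgt a = v + of_real r' * u'" by (auto simp: leaves_def)
  then have "of_real r * u = of_real r' * u'" using r by simp
  then have "u = (r' / r) *\<^sub>R u'" using r(1) by (simp add: scaleR_conv_of_real field_simps)
  then show ?thesis using r(1) r'(1) by (intro exI[of _ "r' / r"]) simp
qed

context composed_tiling
begin

lemma left_right1:
  assumes C: "C4 v u (crossing T1 v)" and b: "b \<in> crossing T1 v" "tgt b = v"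
    "(src b - v) \<bullet> u = 0" and t: "t \<in> T1"
  shows "(on_left b t \<longrightarrow> tcol t = Red) \<and> (on_right b t \<longrightarrow> tcol t = Green)"
proof (cases "b \<in> sides t")
  case True
  have na: "v \<noteq> rv t1 \<and> v \<noteq> lv t1" if "t1 \<in> T1" for t1
    using acute1_C8[OF that] C4_not_C8[OF C] by blast
  note j = joins1[OF t]
  have v: "v = apex t" and bb: "b = rleg t \<or> b = lleg t"
    using True j na[OF t] b(2) by (auto simp: sides_def joins_iff)
  obtain u0 where C8: "C8 v u0 (crossing T v)" using apex1_C8[OF t] v by blast
  then have u0: "u0 \<noteq> 0" by (auto simp: C8_def)
  have "C4 v u0 (crossing T1 v)" using apex1_C4[OF t] C8 v by simp
  then obtain q where "q > 0" "u = q *\<^sub>R u0" using C4_axis_unique[OF C] by blast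
  then have "(src b - v) \<bullet> u0 = 0" using b(3) by simp
  then have perp: "Re ((src b - v) / u0) = 0" using inner_zero_iff_Re_divide[OF u0] by blast
  define e where "e = rv t - v"
  have e0: "e \<noteq> 0" using T1.dir_nonzero[OF t] v by (simp add: e_def)
  have rv: "rv t = v + e" and lv: "lv t = v + \<i> * e" using T1.lv_eq[OF t] v
    by (simp_all add: e_def)
  have z0: "e / u0 \<noteq> 0" using e0 u0 by simp
  have col: "Im (e / u0) = 0 \<and> tcol t = Red \<or> Re (e / u0) = 0 \<and> tcol t = Green"
    using apex1_color[OF t, of u0] C8 v by (simp add: e_def)
  \<comment> \<open>This is the squared length of \<open>e\<close>. Up to sign it is the cross
    product that places the third vertex relative to \<open>b\<close>, so \<open>t\<close> cannot
    lie on the wrong side.\<close>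
  have pos: "Re e * Re e + Im e * Im e > 0"
    using e0 by (simp add: complex_eq_iff sum_squares_gt_zero_iff)
  from bb show ?thesis
  proof
    assume b': "b = rleg t"
    then have s: "src b = v + e" using j(1) b(2) v rv e0 by (auto simp: joins_iff)
    have "\<not> on_left b t"
    proof
      assume "on_left b t"
      then have "Im (cnj (tgt b - src b) * (lv t - src b)) \<ge> 0"
        by (auto simp: on_left_def vertices_def)
      then show False using pos by (simp add: s b(2) lv algebra_simps)
    qed
    moreover have "tcol t = Green" using col perp z0 by (auto simp: s complex_eq_iff)
    ultimately show ?thesis by simp
  next
    assume b': "b = lleg t"
    then have s: "src b = v + \<i> * e" using j(2) b(2) v lv e0 by (auto simp: joins_iff)
    have "\<not> on_right b t"
    proof
      assume "on_right b t"
      then have "Im (cnj (tgt b - src b) * (rv t - src b)) \<le> 0"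
        by (auto simp: on_right_def vertices_def)
      then show False using pos by (simp add: s b(2) rv algebra_simps)
    qed
    moreover have "Im (e / u0) = 0"
    proof -
      have "Re (\<i> * (e / u0)) = 0" using perp by (simp add: s)
      then show ?thesis by (simp only: Re_i_times neg_equal_0_iff_equal)
    qed
    then have "tcol t = Red" using col z0 by (auto simp: complex_eq_iff)
    ultimately show ?thesis by simp
  qed
qed (auto simp: on_left_def on_right_def)

lemma correct_tiling1: "correct_tiling T1"
  unfolding correct_tiling_def
proof (intro conjI)
  show "tiling T1" by (rule tiling1)
  show "side_to_side T1" by (rule side_to_side1)
  show "\<forall>t\<in>T1. \<forall>t'\<in>T1. \<forall>a\<in>sides t. \<forall>b\<in>sides t'. seg a = seg b \<longrightarrow> a = b"
    using arrow_eq1 by blast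
  show "\<forall>t\<in>T1. \<forall>t'\<in>T1. t \<noteq> t' \<and> sides t \<inter> sides t' \<noteq> {} \<longrightarrow> tcol t \<noteq> tcol t'"
    using color_neq1 by blast
  show "\<forall>v\<in>\<Union> (vertices ` T1). \<exists>u. C4 v u (crossing T1 v) \<or> C8 v u (crossing T1 v)"
  proof
    fix v assume "v \<in> \<Union> (vertices ` T1)"
    then obtain t where t: "t \<in> T1" and "v = apex t \<or> (v = rv t \<or> v = lv t)"
      by (auto simp: vertices_def)
    then show "\<exists>u. C4 v u (crossing T1 v) \<or> C8 v u (crossing T1 v)"
      using apex1_C8[OF t] apex1_C4[OF t] acute1_C8[OF t] by blast
  qed
  show "\<forall>v u b. C4 v u (crossing T1 v) \<and> b \<in> crossing T1 v \<and> tgt b = v \<and> (src b - v) \<bullet> u = 0 \<longrightarrow>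
        (\<forall>t\<in>T1. (on_left b t \<longrightarrow> tcol t = Red) \<and> (on_right b t \<longrightarrow> tcol t = Green))"
    using left_right1 by blast
qed

end

section \<open>Scaling\<close>

lemma scale_arrow_simps [simp]:
  "src (scale_arrow k a) = k *\<^sub>R src a" "tgt (scale_arrow k a) = k *\<^sub>R tgt a"
  "acol (scale_arrow k a) = acol a"
  by (simp_all add: scale_arrow_def)

lemma scale_tile_simps [simp]:
  "apex (scale_tile k t) = k *\<^sub>R apex t" "rv (scale_tile k t) = k *\<^sub>R rv t"
  "lv (scale_tile k t) = k *\<^sub>R lv t" "tcol (scale_tile k t) = tcol t"
  "rleg (scale_tile k t) = scale_arrow k (rleg t)" "lleg (scale_tile k t) = scale_arrow k (lleg t)"
  "hyp (scale_tile k t) = scale_arrow k (hyp t)"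
  by (simp_all add: scale_tile_def)

lemma scale_arrow_inverse: "k \<noteq> 0 \<Longrightarrow> scale_arrow (1 / k) (scale_arrow k a) = a"
  by (simp add: scale_arrow_def)

lemma scale_tile_inverse: "k \<noteq> 0 \<Longrightarrow> scale_tile (1 / k) (scale_tile k t) = t"
  by (simp add: scale_tile_def scale_arrow_inverse)

lemma scale_tiles_inverse: "k \<noteq> 0 \<Longrightarrow> scale_tile (1 / k) ` scale_tile k ` T = T"
  by (simp add: image_image scale_tile_inverse)

lemma scale_arrow_eq_iff: "k \<noteq> 0 \<Longrightarrow> scale_arrow k a = scale_arrow k b \<longleftrightarrow> a = b"
  by (metis scale_arrow_inverse)

lemma sides_scale: "sides (scale_tile k t) = scale_arrow k ` sides t"
  by (simp add: sides_def)

lemma vertices_scale: "vertices (scale_tile k t) = (*\<^sub>R) k ` vertices t"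
  by (simp add: vertices_def)

lemma region_scale: "region (scale_tile k t) = (*\<^sub>R) k ` region t"
  by (simp add: region_def vertices_scale convex_hull_scaling)

lemma seg_scale: "seg (scale_arrow k a) = (*\<^sub>R) k ` seg a"
  by (simp add: seg_def segment_convex_hull flip: convex_hull_scaling)

lemma image_scaleR_eq_iff: "k \<noteq> 0 \<Longrightarrow> (*\<^sub>R) k ` A = (*\<^sub>R) k ` B \<longleftrightarrow> A = (B :: complex set)"
  by (rule inj_image_eq_iff) (simp add: inj_on_def)

lemma image_scaleR_Int: "k \<noteq> 0 \<Longrightarrow> (*\<^sub>R) k ` (A \<inter> B) = (*\<^sub>R) k ` A \<inter> (*\<^sub>R) k ` (B :: complex set)"
  by (rule image_Int) (simp add: inj_on_def)

lemma interior_region_scale: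
  "k \<noteq> 0 \<Longrightarrow> interior (region (scale_tile k t)) = (*\<^sub>R) k ` interior (region t)"
  unfolding region_scale by (rule interior_injective_linear_image) (simp_all add: inj_on_def)

lemma joins_scale: "joins a x y \<Longrightarrow> joins (scale_arrow k a) (k *\<^sub>R x) (k *\<^sub>R y)"
  by (auto simp: joins_iff)

lemma triangle_tile_scale:
  assumes "triangle_tile s t" "k > 0"
  shows "triangle_tile (k * s) (scale_tile k t)"
proof -
  have "dist (k *\<^sub>R x) (k *\<^sub>R y) = k * dist x y" for x y :: complex
    using assms(2) by (simp add: dist_norm flip: scaleR_diff_right)
  then show ?thesis using assms
    by (auto simp: triangle_tile_def joins_scale simp flip: scaleR_diff_right)
qed

lemma tiling_scale:
  assumes "tiling T" "k > 0"
  shows "tiling (scale_tile k ` T)"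
proof -
  obtain s where s: "s > 0" "\<And>t. t \<in> T \<Longrightarrow> triangle_tile s t"
    using tiling_obtain_size[OF assms(1)] by (metis triangle_tiling_def)
  have "(\<Union>t\<in>scale_tile k ` T. region t) = (*\<^sub>R) k ` (\<Union>t\<in>T. region t)"
    by (simp add: region_scale image_UN)
  also have "(\<Union>t\<in>T. region t) = UNIV" using assms(1) by (simp add: tiling_def)
  also have "(*\<^sub>R) k ` (UNIV :: complex set) = UNIV"
    using assms(2) by (intro surjI[of _ "(*\<^sub>R) (1 / k)"]) simp
  finally have cov: "(\<Union>t\<in>scale_tile k ` T. region t) = UNIV" .
  have "interior (region t) \<inter> interior (region t') = {}" if "t \<in> T" "t' \<in> T"
    "t \<noteq> t'" for t t'
    using assms(1) that by (simp add: tiling_def)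
  then have "interior (region (scale_tile k t)) \<inter> interior (region (scale_tile k t')) = {}"
    if "t \<in> T" "t' \<in> T" "t \<noteq> t'" for t t'
    using that assms(2) by (simp add: interior_region_scale flip: image_scaleR_Int)
  then have "\<forall>t\<in>scale_tile k ` T. \<forall>t'\<in>scale_tile k ` T. t \<noteq> t' \<longrightarrow> interior (region t) \<inter> interior (region t') = {}"
    by blast
  moreover have "\<forall>t\<in>scale_tile k ` T. triangle_tile (k * s) t"
    using triangle_tile_scale s assms(2) by blast
  moreover have "k * s > 0" using s assms(2) by simp
  ultimately show ?thesis unfolding tiling_def using cov by blast
qed

lemma crossing_scale:
  assumes "k \<noteq> 0"
  shows "crossing (scale_tile k ` T) (k *\<^sub>R v) = scale_arrow k ` crossing T v"
  using assms by (auto simp: crossing_def sides_scale)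

lemma enters_scale: "enters v d c a \<Longrightarrow> k > 0 \<Longrightarrow> enters (k *\<^sub>R v) d c (scale_arrow k a)"
proof -
  assume a: "enters v d c a" "k > 0"
  then obtain r where "r > 0" "src a = v + of_real r * d" by (auto simp: enters_def)
  then have "k * r > 0" "k *\<^sub>R src a = k *\<^sub>R v + of_real (k * r) * d"
    using a(2) by (simp_all add: scaleR_conv_of_real algebra_simps)
  then show ?thesis using a(1) unfolding enters_def by auto
qed

lemma leaves_scale: "leaves v d c a \<Longrightarrow> k > 0 \<Longrightarrow> leaves (k *\<^sub>R v) d c (scale_arrow k a)"
proof -
  assume a: "leaves v d c a" "k > 0"
  then obtain r where "r > 0" "tgt a = v + of_real r * d" by (auto simp: leaves_def)
  then have "k * r > 0" "k *\<^sub>R tgt a = k *\<^sub>R v + of_real (k * r) * d"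
    using a(2) by (simp_all add: scaleR_conv_of_real algebra_simps)
  then show ?thesis using a(1) unfolding leaves_def by auto
qed

lemma C4_scale:
  assumes "C4 v u X" "k > 0"
  shows "C4 (k *\<^sub>R v) u (scale_arrow k ` X)"
proof -
  obtain a1 a2 b1 b2 c c1 c2 where *: "u \<noteq> 0" "X = {a1, a2, b1, b2}"
    "enters v (- u) c a1" "leaves v u c a2"
    "enters v (\<i> * u) c1 b1" "enters v (- \<i> * u) c2 b2" "c1 \<noteq> c2"
    using assms(1) unfolding C4_def by blast
  have "scale_arrow k ` X = {scale_arrow k a1, scale_arrow k a2, scale_arrow k b1, scale_arrow k b2}" using * by simp
  then show ?thesis unfolding C4_def
    using *(1,7) *(3,5,6)[THEN enters_scale, OF assms(2)] *(4)[THEN leaves_scale, OF assms(2)]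
      by blast
qed

lemma C8_scale:
  assumes "C8 v u X" "k > 0"
  shows "C8 (k *\<^sub>R v) u (scale_arrow k ` X)"
proof -
  obtain a1 a2 b1 b2 d1 d2 d3 d4 c c1 c2 where *: "u \<noteq> 0"
    "X = {a1, a2, b1, b2, d1, d2, d3, d4}"
    "enters v (- u) c a1" "leaves v u c a2"
    "enters v (\<i> * u) c1 b1" "enters v (- \<i> * u) c2 b2" "c1 \<noteq> c2"
    "leaves v ((1 + \<i>) * u) Red d1" "leaves v ((- 1 + \<i>) * u) Green d2"
    "leaves v ((- 1 - \<i>) * u) Red d3" "leaves v ((1 - \<i>) * u) Green d4"
    using assms(1) unfolding C8_def by blast
  have "scale_arrow k ` X = {scale_arrow k a1, scale_arrow k a2, scale_arrow k b1, scale_arrow k b2,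
    scale_arrow k d1, scale_arrow k d2, scale_arrow k d3, scale_arrow k d4}" using * by simp
  then show ?thesis unfolding C8_def
    using *(1,7) *(3,5,6)[THEN enters_scale, OF assms(2)] *(4,8-11)[THEN leaves_scale, OF assms(2)]
      by blast
qed

lemma Im_cnj_scale: "Im (cnj (k *\<^sub>R x - k *\<^sub>R y) * (k *\<^sub>R z - k *\<^sub>R y)) = k\<^sup>2 * Im (cnj (x - y) * (z - y))"
  by (simp add: power2_eq_square algebra_simps)

lemma scale_arrow_in_sides: "k \<noteq> 0 \<Longrightarrow> scale_arrow k a \<in> sides (scale_tile k t) \<longleftrightarrow> a \<in> sides t"
  by (auto simp: sides_scale scale_arrow_eq_iff)

lemma on_left_scale:
  assumes "k > 0"
  shows "on_left (scale_arrow k a) (scale_tile k t) \<longleftrightarrow> on_left a t"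
proof -
  have "0 \<le> k\<^sup>2 * x \<longleftrightarrow> 0 \<le> x" for x :: real using assms
    by (simp add: zero_le_mult_iff)
  moreover have "k \<noteq> 0" using assms by simp
  ultimately show ?thesis
    unfolding on_left_def vertices_scale ball_simps scale_arrow_simps Im_cnj_scale
    by (simp only: scale_arrow_in_sides not_False_eq_True)
qed

lemma on_right_scale:
  assumes "k > 0"
  shows "on_right (scale_arrow k a) (scale_tile k t) \<longleftrightarrow> on_right a t"
proof -
  have "k\<^sup>2 * x \<le> 0 \<longleftrightarrow> x \<le> 0" for x :: real using assms
    by (simp add: mult_le_0_iff)
  moreover have "k \<noteq> 0" using assms by simp
  ultimately show ?thesis
    unfolding on_right_def vertices_scale ball_simps scale_arrow_simps Im_cnj_scale
    by (simp only: scale_arrow_in_sides not_False_eq_True)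
qed

text \<open>Used with the factor \<open>1 / sqrt 2\<close>, which takes the composed tiling of leg
  length \<open>sqrt 2 * s\<close> back to leg length \<open>s\<close>.\<close>

lemma correct_tiling_scale:
  assumes C: "correct_tiling T" and k: "k > 0"
  shows "correct_tiling (scale_tile k ` T)"
proof -
  have "tiling T" using C by (simp add: correct_tiling_def)
  then obtain s where "triangle_tiling T s" using tiling_obtain_size by blast
  then interpret correct_triangle_tiling T s
    using C by (simp add: correct_triangle_tiling_def correct_triangle_tiling_axioms_def)
  have k0: "k \<noteq> 0" using k by simp
  show ?thesis
    unfolding correct_tiling_def
  proof (intro conjI)
    show "tiling (scale_tile k ` T)" using tiling_scale[OF tiling k] .
    show "side_to_side (scale_tile k ` T)"
      unfolding side_to_side_def
    proof (intro ballI impI)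
      fix t t' assume "t \<in> scale_tile k ` T" "t' \<in> scale_tile k ` T" "t \<noteq> t'"
      then obtain p p' where p: "p \<in> T" "p' \<in> T" "p \<noteq> p'" "t = scale_tile k p"
        "t' = scale_tile k p'" by blast
      have R: "region t \<inter> region t' = (*\<^sub>R) k ` (region p \<inter> region p')"
        using k0 by (simp add: p region_scale image_scaleR_Int)
      show "region t \<inter> region t' = {} \<or> (\<exists>v\<in>vertices t \<inter> vertices t'. region t \<inter> region t' = {v}) \<or>
        (\<exists>a\<in>sides t. \<exists>b\<in>sides t'. seg a = seg b \<and> region t \<inter> region t' = seg a)"
        using p(1-3)
      proof (cases rule: intersection_cases)
        case 1
        then show ?thesis using R by simp
      next
        case (2 v)
        then have "k *\<^sub>R v \<in> vertices t \<inter> vertices t'"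
          "region t \<inter> region t' = {k *\<^sub>R v}"
          unfolding R by (auto simp: p vertices_scale)
        then show ?thesis by blast
      next
        case (3 a)
        then have "scale_arrow k a \<in> sides t" "scale_arrow k a \<in> sides t'"
          "region t \<inter> region t' = seg (scale_arrow k a)"
          unfolding R by (auto simp: p sides_scale seg_scale)
        then show ?thesis by blast
      qed
    qed
    show "\<forall>t\<in>scale_tile k ` T. \<forall>t'\<in>scale_tile k ` T. \<forall>a\<in>sides t. \<forall>b\<in>sides t'. seg a = seg b \<longrightarrow> a = b"
      using correct_facts(2) k0
        by (auto simp: sides_scale seg_scale image_scaleR_eq_iff scale_arrow_eq_iff)
    show "\<forall>t\<in>scale_tile k ` T. \<forall>t'\<in>scale_tile k ` T. t \<noteq> t' \<and> sides t \<inter> sides t' \<noteq> {} \<longrightarrow> tcol t \<noteq> tcol t'"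
    proof (intro ballI impI)
      fix t t' assume t: "t \<in> scale_tile k ` T" "t' \<in> scale_tile k ` T"
        "t \<noteq> t' \<and> sides t \<inter> sides t' \<noteq> {}"
      then obtain p p' where p: "p \<in> T" "p' \<in> T" "p \<noteq> p'" "t = scale_tile k p"
        "t' = scale_tile k p'" by blast
      then obtain a where "a \<in> sides p" "a \<in> sides p'" using t(3) k0
        by (auto simp: sides_scale scale_arrow_eq_iff)
      then show "tcol t \<noteq> tcol t'" using color_neq[OF p(1-3)] p(4,5) by simp
    qed
    show "\<forall>v\<in>\<Union> (vertices ` scale_tile k ` T). \<exists>u. C4 v u (crossing (scale_tile k ` T) v) \<or> C8 v u (crossing (scale_tile k ` T) v)"
    proof
      fix v assume "v \<in> \<Union> (vertices ` scale_tile k ` T)"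
      then obtain t w where t: "t \<in> T" "w \<in> vertices t" "v = k *\<^sub>R w"
        by (auto simp: vertices_scale)
      then obtain u where "C4 w u (crossing T w) \<or> C8 w u (crossing T w)" using vertex_C4_C8
        by blast
      then show "\<exists>u. C4 v u (crossing (scale_tile k ` T) v) \<or> C8 v u (crossing (scale_tile k ` T) v)"
        unfolding t(3) crossing_scale[OF k0] using C4_scale[OF _ k] C8_scale[OF _ k] by blast
    qed
    show "\<forall>v u b. C4 v u (crossing (scale_tile k ` T) v) \<and> b \<in> crossing (scale_tile k ` T) v \<and> tgt b = v \<and> (src b - v) \<bullet> u = 0 \<longrightarrow>
        (\<forall>t\<in>scale_tile k ` T. (on_left b t \<longrightarrow> tcol t = Red) \<and> (on_right b t \<longrightarrow> tcol t = Green))"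
    proof (intro allI impI ballI, elim conjE)
      fix v u b t
      assume b: "C4 v u (crossing (scale_tile k ` T) v)" "b \<in> crossing (scale_tile k ` T) v"
        "tgt b = v"
        "(src b - v) \<bullet> u = 0" and t: "t \<in> scale_tile k ` T"
      \<comment> \<open>The rule for \<open>T\<close> is applied at the preimage of
        \<open>v\<close>, whose crossing is recovered by scaling back with
        \<open>1 / k\<close>.\<close>
      define w where "w = (1 / k) *\<^sub>R v"
      have v: "v = k *\<^sub>R w" using k0 by (simp add: w_def)
      have X: "crossing (scale_tile k ` T) v = scale_arrow k ` crossing T w"
        unfolding v crossing_scale[OF k0] ..
      obtain a where a: "a \<in> crossing T w" "b = scale_arrow k a" using b(2) unfolding X by blast
      obtain p where p: "p \<in> T" "t = scale_tile k p" using t by blast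
      have "C4 w u (scale_arrow (1 / k) ` scale_arrow k ` crossing T w)"
        using C4_scale[OF b(1), of "1 / k"] k unfolding X by (simp add: w_def)
      then have C4: "C4 w u (crossing T w)" using k0 by (simp add: image_image scale_arrow_inverse)
      have ta: "tgt a = w" using b(3) k0 unfolding a(2) v by simp
      have "(src b - v) = k *\<^sub>R (src a - w)" unfolding a(2) v by (simp add: scaleR_diff_right)
      then have "(src a - w) \<bullet> u = 0" using b(4) k0 by simp
      from C4_left_right[OF C4 a(1) ta this p(1)]
      show "(on_left b t \<longrightarrow> tcol t = Red) \<and> (on_right b t \<longrightarrow> tcol t = Green)"
        unfolding a(2) p(2) using k by (simp add: on_left_scale on_right_scale)
    qed
  qed
qed

lemma midpoint_scale: "midpoint (k *\<^sub>R x) (k *\<^sub>R y) = k *\<^sub>R midpoint x (y :: complex)"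
  by (simp add: midpoint_def scaleR_add_right)

lemma half_at_scale: "k \<noteq> 0 \<Longrightarrow> half_at (k *\<^sub>R x) (scale_arrow k a) = scale_arrow k (half_at x a)"
  by (simp add: half_at_def scale_arrow_def midpoint_scale)

lemma height_scale: "height (scale_tile k t) = scale_arrow k (height t)"
  by (simp add: height_def scale_arrow_def midpoint_scale)

lemma left_part_scale: "k \<noteq> 0 \<Longrightarrow> left_part (scale_tile k t) = scale_tile k (left_part t)"
  by (rule tile.equality) (simp_all add: left_part_def midpoint_scale half_at_scale height_scale)

lemma right_part_scale: "k \<noteq> 0 \<Longrightarrow> right_part (scale_tile k t) = scale_tile k (right_part t)"
  by (rule tile.equality) (simp_all add: right_part_def midpoint_scale half_at_scale height_scale)

text \<open>Since halving commutes with scaling, enlarging by \<open>sqrt 2\<close> turns tilings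
  with decomposition \<open>T\<close> into tilings with halves \<open>T\<close>, the setting of all
  earlier results.\<close>

lemma decomposition_eq_parts: "decomposition T = parts (scale_tile (sqrt 2) ` T)"
  by (auto simp: decomposition_def parts_def left_part_scale right_part_scale)

theorem theorem2:
  fixes T :: "tile set"
  assumes "correct_tiling T"
  shows "(\<exists>!T\<^sub>0. tiling T\<^sub>0 \<and> decomposition T\<^sub>0 = T) \<and>
         (\<forall>T\<^sub>0. tiling T\<^sub>0 \<and> decomposition T\<^sub>0 = T \<longrightarrow> correct_tiling T\<^sub>0)"
proof (intro conjI ex_ex1I allI impI)
  have tT: "tiling T" using assms by (simp add: correct_tiling_def)
  obtain s where "triangle_tiling T s" using tiling_obtain_size tT by blast
  then interpret correct_triangle_tiling T s
    using assms by (simp add: correct_triangle_tiling_def correct_triangle_tiling_axioms_def)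
  let ?S = "(`) (scale_tile (sqrt 2))" and ?S' = "(`) (scale_tile (1 / sqrt 2))"
  have inv: "?S' (?S U) = U" "?S (?S' U) = U" for U
    using scale_tiles_inverse[of "sqrt 2" U] scale_tiles_inverse[of "1 / sqrt 2" U] by simp_all
  have up: "tiling (?S U) \<and> parts (?S U) = T" if "tiling U \<and> decomposition U = T" for U
    using that tiling_scale[of U "sqrt 2"] by (simp add: decomposition_eq_parts)
  show "\<exists>T\<^sub>0. tiling T\<^sub>0 \<and> decomposition T\<^sub>0 = T"
  proof (intro exI conjI)
    show "tiling (?S' composition)" using tiling_scale[OF tiling_composition] by simp
    show "decomposition (?S' composition) = T" unfolding decomposition_eq_parts inv
      by (rule parts_composition)
  qed
  show "U = U'" if "tiling U \<and> decomposition U = T" "tiling U' \<and> decomposition U' = T"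
    for U U'
  proof -
    have "?S U = ?S U'"
      using parts_inject[of "?S U" "?S U'"] parts_inject[of "?S U'"
        "?S U"] up[OF that(1)] up[OF that(2)] tT
      by (simp add: subset_antisym)
    then show ?thesis using inv(1) by metis
  qed
  show "correct_tiling U" if "tiling U \<and> decomposition U = T" for U
  proof -
    interpret composed_tiling T s "?S U" using up[OF that] by unfold_locales auto
    show ?thesis using correct_tiling_scale[OF correct_tiling1, of "1 / sqrt 2"] by (simp add: inv)
  qed
qed

end
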